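(* Let $\mathsf{d}\ge 0$ and $k\ge 5+\mathsf{d}$ be even integers, and let $0\le j\le \mathsf{d}$ be an integer. Let $\phi\in \mathrm{Z}^1_{\mathrm{pb}}(\mathrm{SL}_2(\mathbb{Z}),\mathrm{sym}^{\mathsf d}(X))$ and $\phi^\vee\in \mathrm{Z}^1_{\mathrm{pb}}(\mathrm{SL}_2(\mathbb{Z}),\mathrm{sym}^{\mathsf d}(X)^\vee)$ be parabolic cocycles. Then for all $\tau$ in the upper half plane $$E_k^{[1]}(\tau;\phi)=\sum_{r=0}^{\mathsf d}(X-\tau)^r\sum_{n=1}^\infty c(n)_r\,e(n\tau)\qquad\text{and}\qquad E_k^{[1]}(\tau;\phi^\vee,j)=\sum_{n=1}^\infty c(n)\,e(n\tau),$$ where $$c(n)_r=\sum_{\substack{\gamma\in\Gamma_\infty\backslash \mathrm{SL}_2(\mathbb{Z})/\Gamma_\infty\\ \gamma\notin\Gamma_\infty}}\frac{e(n\frac dc)}{c^k}\sum_{s=r}^{\mathsf d}\phi(\gamma^{-1})_s\sum_{l=r}^{s}\frac{(-2\pi i)^{k-s+l}}{(k-s+l-1)!}\binom{l}{r}\binom{s}{l}\Big(-\frac dc\Big)^{l-r}n^{k-s+l-1}$$ and $$c(n)=\sum_{\substack{\gamma\in\Gamma_\infty\backslash \mathrm{SL}_2(\mathbb{Z})/\Gamma_\infty\\ \gamma\notin\Gamma_\infty}}\frac{(-1)^{j-k}e(n\frac dc)}{c^{k+2j-\mathsf d}}\sum_{r=0}^{j}\binom jr\frac{(2\pi i)^{k+r}}{(k+r-1)!}\,\phi^\vee(\gamma^{-1})\Big(\big(X+\tfrac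 dc\big)^{\mathsf d-j+r}\Big)\,n^{k+r-1},$$ and $(c,d)$ denotes the bottom row of the double coset representative $\gamma$.
   Context: Notation: $\mathbb{H}$ is the upper half plane, $e(z)=\exp(2\pi i z)$, $T=\begin{pmatrix}1&1\\0&1\end{pmatrix}$, $\Gamma_\infty=\{\pm T^n: n\in\mathbb{Z}\}$. Representation $\mathrm{sym}^{\mathsf d}(X)$: the space $\mathbb{C}[X]_{\mathsf d}$ of polynomials in $X$ of degree at most $\mathsf d$, with action $\mathrm{sym}^{\mathsf d}(X)(\gamma^{-1})p(X)=(cX+d)^{\mathsf d}\,p\big(\frac{aX+b}{cX+d}\big)$ for $\gamma=\begin{pmatrix}a&b\\c&d\end{pmatrix}\in\mathrm{SL}_2(\mathbb{Z})$. The coefficient of $X^s$ in $p$ is denoted $p_s$. $\mathrm{sym}^{\mathsf d}(X)^\vee$ is the dual representation, whose elements are linear functionals on $\mathbb{C}[X]_{\mathsf d}$. Cocycles: for a finite-dimensional complex representation $\rho$ of $\mathrm{SL}_2(\mathbb{Z})$ on $V(\rho)$, a $1$-cocycle is a map $\phi:\mathrm{SL}_2(\mathbb{Z})\to V(\rho)$ with $\phi(\gamma_1\gamma_2)=\rho(\gamma_1)\phi(\gamma_2)+\phi(\gamma_1)$. It is parabolic, i.e. in $\mathrm{Z}^1_{\mathrm{pb}}(\mathrm{SL}_2(\mathbb{Z}),\rho)$, if $\phi(\gamma)=0$ for all $\gamma\in\Gamma_\infty$. Slash action: for $f:\mathbb{H}\to V(\rho)$, $(f|_{k,\rho}\gamma)(\tau)=(c\tau+d)^{-k}\rho(\gamma^{-1})f(\gamma\tau)$.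 Generalized second order Eisenstein series: $$E_k^{[1]}(\tau;\phi)=\sum_{\gamma\in\Gamma_\infty\backslash\mathrm{SL}_2(\mathbb{Z})}(c\tau+d)^{-k}\,\phi(\gamma^{-1})\in\mathbb{C}[X]_{\mathsf d},$$ $$E_k^{[1]}(\tau;\phi^\vee,j)=\sum_{\gamma\in\Gamma_\infty\backslash\mathrm{SL}_2(\mathbb{Z})}\phi^\vee(\gamma^{-1})\Big(\big((X-\tau)^j\big|_{k,\mathrm{sym}^{\mathsf d}(X)}\gamma\big)(\tau)\Big)\in\mathbb{C},$$ where $(c,d)$ is the bottom row of $\gamma$. For $k\ge 5+\mathsf d$ these series converge absolutely and locally uniformly. *)

theory Defs
  imports
    "HOL-Analysis.Analysis"
    "HOL-Algebra.Coset"
    "HOL-Computational_Algebra.Polynomial"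
    "HOL-Library.Function_Algebras"
begin

section \<open>The modular group\<close>

definition SL2Z :: "(int^2^2) monoid" where
  "SL2Z = \<lparr>carrier = {A. det A = 1}, mult = (**), one = mat 1\<rparr>"

definition T_mat :: "int^2^2" where
  "T_mat = vector [vector [1, 1], vector [0, 1]]"

definition Gamma_inf :: "(int^2^2) set" where
  "Gamma_inf = {A. \<exists>n::int. A = T_mat [^]\<^bsub>SL2Z\<^esub> n \<or> A = - (T_mat [^]\<^bsub>SL2Z\<^esub> n)}"

text \<open>
  The quotient \<open>\<Gamma>\<^sub>\<infinity> \ SL\<^sub>2(\<int>)\<close> is \<open>rcosets\<^bsub>SL2Z\<^esub> Gamma_inf\<close>. The following is the
  set of double cosets \<open>\<Gamma>\<^sub>\<infinity> \<gamma> \<Gamma>\<^sub>\<infinity>\<close> with \<open>\<gamma> \<notin> \<Gamma>\<^sub>\<infinity>\<close>.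
\<close>

definition nontrivial_double_cosets :: "(int^2^2) set set" where
  "nontrivial_double_cosets =
     {Gamma_inf #>\<^bsub>SL2Z\<^esub> \<gamma> <#>\<^bsub>SL2Z\<^esub> Gamma_inf | \<gamma>. \<gamma> \<in> carrier SL2Z - Gamma_inf}"

lemma matrix_eq_2x2:
  fixes A B :: "'a^2^2"
  shows "A = B \<longleftrightarrow> A$1$1 = B$1$1 \<and> A$1$2 = B$1$2 \<and> A$2$1 = B$2$1 \<and> A$2$2 = B$2$2"
  by (auto simp: vec_eq_iff forall_2)

lemma group_SL2Z: "group SL2Z"
proof (rule groupI)
  fix x y assume "x \<in> carrier SL2Z" "y \<in> carrier SL2Z"
  then show "x \<otimes>\<^bsub>SL2Z\<^esub> y \<in> carrier SL2Z"
    by (simp add: SL2Z_def det_mul)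
next
  fix x assume x: "x \<in> carrier SL2Z"
  let ?y = "vector [vector [x$2$2, - x$1$2], vector [- x$2$1, x$1$1]] :: int^2^2"
  have "det x = 1" using x by (simp add: SL2Z_def)
  then have "det ?y = 1" "?y ** x = mat 1"
    by (simp_all add: det_2 matrix_eq_2x2 matrix_matrix_mult_def sum_2 mat_def vector_2 algebra_simps)
  then show "\<exists>y\<in>carrier SL2Z. y \<otimes>\<^bsub>SL2Z\<^esub> x = \<one>\<^bsub>SL2Z\<^esub>"
    by (auto simp: SL2Z_def)
qed (auto simp: SL2Z_def det_I matrix_mul_assoc)

lemma inv_SL2Z:
  assumes "\<gamma> \<in> carrier SL2Z"
  shows "inv\<^bsub>SL2Z\<^esub> \<gamma> = vector [vector [\<gamma>$2$2, - \<gamma>$1$2], vector [- \<gamma>$2$1, \<gamma>$1$1]]"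
    (is "_ = ?y")
proof -
  have "det \<gamma> = 1" using assms by (simp add: SL2Z_def)
  then have "det ?y = 1" "?y ** \<gamma> = mat 1"
    by (simp_all add: det_2 matrix_eq_2x2 matrix_matrix_mult_def sum_2 mat_def vector_2 algebra_simps)
  then show ?thesis
    using group.inv_equality[OF group_SL2Z, of ?y \<gamma>] assms by (simp add: SL2Z_def)
qed

lemma T_mat_int_pow:
  "T_mat [^]\<^bsub>SL2Z\<^esub> (n::int) = vector [vector [1, n], vector [0, 1]]"
proof -
  have nat: "T_mat [^]\<^bsub>SL2Z\<^esub> (m::nat) = vector [vector [1, int m], vector [0, 1]]" for m
  proof (induction m)
    case 0
    show ?case by (simp add: SL2Z_def matrix_eq_2x2 mat_def vector_2)
  next
    case (Suc m)
    have "T_mat [^]\<^bsub>SL2Z\<^esub> Suc m = (T_mat [^]\<^bsub>SL2Z\<^esub> m) ** T_mat"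
      by (simp add: SL2Z_def)
    also have "\<dots> = vector [vector [1, int m], vector [0, 1]] ** T_mat"
      by (simp only: Suc.IH)
    also have "\<dots> = vector [vector [1, int (Suc m)], vector [0, 1]]"
      by (simp add: T_mat_def matrix_eq_2x2 matrix_matrix_mult_def sum_2 vector_2)
    finally show ?case .
  qed
  show ?thesis
  proof (cases "n \<ge> 0")
    case True
    then show ?thesis using nat[of "nat n"] by (subst int_pow_def2) simp
  next
    case False
    let ?m = "nat (- n)"
    have "T_mat [^]\<^bsub>SL2Z\<^esub> n = inv\<^bsub>SL2Z\<^esub> (T_mat [^]\<^bsub>SL2Z\<^esub> ?m)"
      using False by (subst int_pow_def2) simp
    also have "\<dots> = inv\<^bsub>SL2Z\<^esub> (vector [vector [1, int ?m], vector [0, 1]])"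
      by (simp only: nat)
    also have "\<dots> = vector [vector [1, n], vector [0, 1]]"
    proof (subst inv_SL2Z)
      show "vector [vector [1, int ?m], vector [0, 1]] \<in> carrier SL2Z"
        by (simp add: SL2Z_def det_2 vector_2)
    qed (use False in \<open>simp add: vector_2\<close>)
    finally show ?thesis .
  qed
qed

definition moebius_act :: "int^2^2 \<Rightarrow> complex \<Rightarrow> complex" where
  "moebius_act \<gamma> \<tau> = (of_int (\<gamma>$1$1) * \<tau> + of_int (\<gamma>$1$2)) / (of_int (\<gamma>$2$1) * \<tau> + of_int (\<gamma>$2$2))"

definition ee :: "complex \<Rightarrow> complex" where
  "ee z = exp (2 * of_real pi * \<i> * z)"


section \<open>Symmetric powers and their duals\<close>

definition sym_space :: "nat \<Rightarrow> complex poly set" where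
  "sym_space d = {p. degree p \<le> d}"

text \<open>
  \<open>sym_inv d \<gamma>\<close> is the action of \<open>\<gamma>\<^sup>-\<^sup>1\<close>: the expression \<open>(cX + d)\<^sup>\<d> p((aX + b) / (cX + d))\<close> with
  its denominators cleared.
\<close>

definition sym_inv :: "nat \<Rightarrow> int^2^2 \<Rightarrow> complex poly \<Rightarrow> complex poly" where
  "sym_inv d \<gamma> p = (\<Sum>i\<le>d. smult (coeff p i)
     ([:of_int (\<gamma>$1$2), of_int (\<gamma>$1$1):] ^ i * [:of_int (\<gamma>$2$2), of_int (\<gamma>$2$1):] ^ (d - i)))"

definition sym_rep :: "nat \<Rightarrow> int^2^2 \<Rightarrow> complex poly \<Rightarrow> complex poly" where
  "sym_rep d \<gamma> = sym_inv d (inv\<^bsub>SL2Z\<^esub> \<gamma>)"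

lemma poly_sym_rep_inv:
  assumes "\<gamma> \<in> carrier SL2Z" "p \<in> sym_space d"
    and nz: "of_int (\<gamma>$2$1) * x + of_int (\<gamma>$2$2) \<noteq> 0"
  shows "poly (sym_rep d (inv\<^bsub>SL2Z\<^esub> \<gamma>) p) x =
           (of_int (\<gamma>$2$1) * x + of_int (\<gamma>$2$2)) ^ d * poly p (moebius_act \<gamma> x)"
proof -
  let ?u = "of_int (\<gamma>$1$1) * x + of_int (\<gamma>$1$2)" and ?v = "of_int (\<gamma>$2$1) * x + of_int (\<gamma>$2$2)"
  have "sym_rep d (inv\<^bsub>SL2Z\<^esub> \<gamma>) p = sym_inv d \<gamma> p"
    using assms by (simp add: sym_rep_def group.inv_inv[OF group_SL2Z])
  moreover have "poly p (moebius_act \<gamma> x) = (\<Sum>i\<le>d. coeff p i * (?u / ?v) ^ i)"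
  proof -
    have "poly p y = (\<Sum>i\<le>d. coeff p i * y ^ i)" for y
      unfolding poly_altdef using assms(2)
      by (intro sum.mono_neutral_left) (auto simp: sym_space_def coeff_eq_0)
    then show ?thesis by (simp add: moebius_act_def)
  qed
  moreover have "(\<Sum>i\<le>d. coeff p i * (?u ^ i * ?v ^ (d - i))) =
                   (\<Sum>i\<le>d. ?v ^ d * (coeff p i * (?u / ?v) ^ i))"
  proof (rule sum.cong[OF refl])
    fix i assume "i \<in> {..d}"
    then have "?v ^ d = ?v ^ i * ?v ^ (d - i)" by (simp flip: power_add)
    then show "coeff p i * (?u ^ i * ?v ^ (d - i)) = ?v ^ d * (coeff p i * (?u / ?v) ^ i)"
      using nz by (simp add: power_divide)
  qed
  ultimately show ?thesis
    by (simp add: sym_inv_def poly_sum sum_distrib_left mult.commute add.commute)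
qed

text \<open>
  A linear functional on \<open>V\<close> is represented by the function that vanishes outside \<open>V\<close>, so that
  equality of functions is equality of functionals.
\<close>

definition dual_space :: "complex poly set \<Rightarrow> (complex poly \<Rightarrow> complex) set" where
  "dual_space V = {L. (\<forall>p\<in>V. \<forall>q\<in>V. L (p + q) = L p + L q) \<and>
                      (\<forall>a. \<forall>p\<in>V. L (smult a p) = a * L p) \<and> (\<forall>p. p \<notin> V \<longrightarrow> L p = 0)}"

definition dual_rep :: "complex poly set \<Rightarrow> (int^2^2 \<Rightarrow> complex poly \<Rightarrow> complex poly) \<Rightarrow>
    int^2^2 \<Rightarrow> (complex poly \<Rightarrow> complex) \<Rightarrow> (complex poly \<Rightarrow> complex)" where
  "dual_rep V \<rho> \<gamma> L = (\<lambda>p. if p \<in> V then L (\<rho> (inv\<^bsub>SL2Z\<^esub> \<gamma>) p) else 0)"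


section \<open>Cocycles\<close>

definition cocycles :: "'v::ab_group_add set \<Rightarrow> (int^2^2 \<Rightarrow> 'v \<Rightarrow> 'v) \<Rightarrow> (int^2^2 \<Rightarrow> 'v) set" where
  "cocycles V \<rho> = {\<phi>. (\<forall>\<gamma>\<in>carrier SL2Z. \<phi> \<gamma> \<in> V) \<and>
     (\<forall>\<gamma>\<^sub>1\<in>carrier SL2Z. \<forall>\<gamma>\<^sub>2\<in>carrier SL2Z. \<phi> (\<gamma>\<^sub>1 \<otimes>\<^bsub>SL2Z\<^esub> \<gamma>\<^sub>2) = \<rho> \<gamma>\<^sub>1 (\<phi> \<gamma>\<^sub>2) + \<phi> \<gamma>\<^sub>1)}"

definition parabolic_cocycles ::
    "'v::ab_group_add set \<Rightarrow> (int^2^2 \<Rightarrow> 'v \<Rightarrow> 'v) \<Rightarrow> (int^2^2 \<Rightarrow> 'v) set" where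
  "parabolic_cocycles V \<rho> = {\<phi> \<in> cocycles V \<rho>. \<forall>\<gamma>\<in>Gamma_inf. \<phi> \<gamma> = 0}"


section \<open>Second order Eisenstein series\<close>

definition slash :: "nat \<Rightarrow> (int^2^2 \<Rightarrow> complex poly \<Rightarrow> complex poly) \<Rightarrow> (complex \<Rightarrow> complex poly) \<Rightarrow>
    int^2^2 \<Rightarrow> complex \<Rightarrow> complex poly" where
  "slash k \<rho> f \<gamma> \<tau> = smult ((of_int (\<gamma>$2$1) * \<tau> + of_int (\<gamma>$2$2)) powi (- int k))
                        (\<rho> (inv\<^bsub>SL2Z\<^esub> \<gamma>) (f (moebius_act \<gamma> \<tau>)))"

text \<open>
  In the series below, \<open>u\<close> picks a representative of each coset in \<open>\<Gamma>\<^sub>\<infinity> \ SL\<^sub>2(\<int>)\<close> and \<open>v\<close> one of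
  each nontrivial double coset. The sum of a series in the finite-dimensional space of polynomials
  of degree at most \<open>d\<close> is taken coefficientwise.
\<close>

definition eis_term :: "nat \<Rightarrow> (int^2^2 \<Rightarrow> complex poly) \<Rightarrow> complex \<Rightarrow> int^2^2 \<Rightarrow> complex poly" where
  "eis_term k \<phi> \<tau> \<gamma> = smult ((of_int (\<gamma>$2$1) * \<tau> + of_int (\<gamma>$2$2)) powi (- int k))
                        (\<phi> (inv\<^bsub>SL2Z\<^esub> \<gamma>))"

definition eis :: "((int^2^2) set \<Rightarrow> int^2^2) \<Rightarrow> nat \<Rightarrow> nat \<Rightarrow> (int^2^2 \<Rightarrow> complex poly) \<Rightarrow>
    complex \<Rightarrow> complex poly" where
  "eis u d k \<phi> \<tau> =
     (\<Sum>i\<le>d. monom (\<Sum>\<^sub>\<infinity>C\<in>rcosets\<^bsub>SL2Z\<^esub> Gamma_inf. coeff (eis_term k \<phi> \<tau> (u C)) i) i)"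

definition eis_dual_term :: "nat \<Rightarrow> nat \<Rightarrow> nat \<Rightarrow> (int^2^2 \<Rightarrow> complex poly \<Rightarrow> complex) \<Rightarrow>
    complex \<Rightarrow> int^2^2 \<Rightarrow> complex" where
  "eis_dual_term d k j \<psi> \<tau> \<gamma> =
     \<psi> (inv\<^bsub>SL2Z\<^esub> \<gamma>) (slash k (sym_rep d) (\<lambda>w. [:- w, 1:] ^ j) \<gamma> \<tau>)"

definition eis_dual :: "((int^2^2) set \<Rightarrow> int^2^2) \<Rightarrow> nat \<Rightarrow> nat \<Rightarrow> nat \<Rightarrow>
    (int^2^2 \<Rightarrow> complex poly \<Rightarrow> complex) \<Rightarrow> complex \<Rightarrow> complex" where
  "eis_dual u d k j \<psi> \<tau> = (\<Sum>\<^sub>\<infinity>C\<in>rcosets\<^bsub>SL2Z\<^esub> Gamma_inf. eis_dual_term d k j \<psi> \<tau> (u C))"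


section \<open>Fourier coefficients\<close>

text \<open>
  For \<open>k \<ge> 5 + d\<close>, \<open>j \<le> d\<close> and in the ranges of summation, no subtraction of natural numbers below
  is truncated.
\<close>

definition fc_term :: "nat \<Rightarrow> nat \<Rightarrow> (int^2^2 \<Rightarrow> complex poly) \<Rightarrow> nat \<Rightarrow> nat \<Rightarrow> int^2^2 \<Rightarrow> complex" where
  "fc_term d k \<phi> n r \<gamma> =
     (let c = of_int (\<gamma>$2$1); d' = of_int (\<gamma>$2$2) in
      ee (of_nat n * (d' / c)) / c ^ k *
      (\<Sum>s=r..d. coeff (\<phi> (inv\<^bsub>SL2Z\<^esub> \<gamma>)) s *
        (\<Sum>l=r..s. (- 2 * of_real pi * \<i>) ^ (k - s + l) / fact (k - s + l - 1) *
           of_nat (l choose r) * of_nat (s choose l) * (- d' / c) ^ (l - r) *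
           of_nat n ^ (k - s + l - 1))))"

definition fc :: "((int^2^2) set \<Rightarrow> int^2^2) \<Rightarrow> nat \<Rightarrow> nat \<Rightarrow> (int^2^2 \<Rightarrow> complex poly) \<Rightarrow>
    nat \<Rightarrow> nat \<Rightarrow> complex" where
  "fc v d k \<phi> n r = (\<Sum>\<^sub>\<infinity>D\<in>nontrivial_double_cosets. fc_term d k \<phi> n r (v D))"

definition fc_dual_term :: "nat \<Rightarrow> nat \<Rightarrow> nat \<Rightarrow> (int^2^2 \<Rightarrow> complex poly \<Rightarrow> complex) \<Rightarrow>
    nat \<Rightarrow> int^2^2 \<Rightarrow> complex" where
  "fc_dual_term d k j \<psi> n \<gamma> =
     (let c = of_int (\<gamma>$2$1); d' = of_int (\<gamma>$2$2) in
      (- 1) powi (int j - int k) * ee (of_nat n * (d' / c)) / c ^ (k + 2 * j - d) *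
      (\<Sum>r=0..j. of_nat (j choose r) * ((2 * of_real pi * \<i>) ^ (k + r) / fact (k + r - 1)) *
         \<psi> (inv\<^bsub>SL2Z\<^esub> \<gamma>) ([:d' / c, 1:] ^ (d - j + r)) * of_nat n ^ (k + r - 1)))"

definition fc_dual :: "((int^2^2) set \<Rightarrow> int^2^2) \<Rightarrow> nat \<Rightarrow> nat \<Rightarrow> nat \<Rightarrow>
    (int^2^2 \<Rightarrow> complex poly \<Rightarrow> complex) \<Rightarrow> nat \<Rightarrow> complex" where
  "fc_dual v d k j \<psi> n = (\<Sum>\<^sub>\<infinity>D\<in>nontrivial_double_cosets. fc_dual_term d k j \<psi> n (v D))"

end

theory Submission
  imports Defs
begin

text \<open>
  Both series are sums over \<open>\<Gamma>\<^sub>\<infinity> \ SL\<^sub>2(\<int>)\<close> of a function that vanishes on \<open>\<Gamma>\<^sub>\<infinity>\<close>. Every other coset is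
  \<open>\<Gamma>\<^sub>\<infinity> \<gamma> T\<^sup>m\<close> for a unique double coset and a unique \<open>m \<in> \<int>\<close>. The cocycle relation together with
  parabolicity expresses the term of \<open>\<gamma> T\<^sup>m\<close> through \<open>\<phi>(\<gamma>\<^sup>-\<^sup>1)(X + m)\<close>, and dually through the value of
  \<open>\<psi>(\<gamma>\<^sup>-\<^sup>1)\<close> at a polynomial shifted by \<open>- m\<close>. Expanding in powers of \<open>w = \<tau> + d/c + m\<close> leaves a finite
  combination \<open>\<Sum>\<^sub>i A\<^sub>i(\<gamma>) w\<^sup>-\<^sup>K\<close>, with \<open>K\<close> depending on \<open>i\<close>, and the sum over \<open>m\<close> is evaluated by the
  Lipschitz formula. The interchanges of summation are justified by \<open>\<bar>A\<^sub>i(\<gamma>)\<bar> \<le> B / \<bar>c\<bar>\<^sup>4\<close>, which comes from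
  the polynomial growth of parabolic cocycles: along the Euclidean algorithm \<open>\<phi>(\<gamma>)\<close> is a sum of at
  most \<open>\<bar>c\<bar>\<close> translates of \<open>\<phi>(S)\<close>.
\<close>

section \<open>The Lipschitz formula\<close>

text \<open>The exponent 4 comes from counting: up to sign a nontrivial double coset is determined
  by |c| and d mod |c|, so at most |c| of them share a value of |c|, and 1/|c|^4 leaves the
  convergent sum of 1/|c|^3. The coefficients are of size |c|^(D+1) with D the degree bound, and k
  \<ge> 5 + D brings this down to 1/|c|^4. The obstacle is uniformity: representatives are
  arbitrary, so d/c is unbounded and \<phi>(\<gamma>^-1) itself grows under \<gamma> -> \<gamma>
  T^m. The A_i are therefore built from quantities that this translation leaves alone:
  \<phi>(\<gamma>^-1) recentered at -d/c, and \<psi>(\<gamma>^-1) on powers of X + d/c. Parity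
  enters because -1 lies in the stabilizer: it makes the terms constant on cosets. The Lipschitz
  formula is obtained without Poisson summation: the sum over the integers splits into two polygamma
  values, which the repeatedly differentiated reflection formula of Gamma combines. Its exponents
  are at least 2, so the factor n^(K-1) removes n = 0 and no constant term appears.\<close>

definition qseries :: "nat \<Rightarrow> complex \<Rightarrow> complex" where
  "qseries j q = (\<Sum>n. of_nat n ^ j * q ^ n)"

text \<open>Termwise differentiation keeps the disc of convergence. \<open>diffs\<close> applied to
  n^j gives (n+1)^(j+1), so multiplying by q yields the next series with its index shifted by
  one.\<close>

lemma summable_power_times_geometric:
  fixes q :: complex
  assumes "norm q < 1"
  shows "summable (\<lambda>n. of_nat n ^ j * q ^ n)"
  using assms
proof (induction j arbitrary: q)
  case 0
  then show ?case by (simp add: summable_geometric)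
next
  case (Suc j)
  have "summable (\<lambda>n. diffs (\<lambda>n. of_nat n ^ j) n * q ^ n)"
    using Suc by (intro termdiff_converges[where K = 1]) auto
  then have "summable (\<lambda>n. q * (diffs (\<lambda>n. of_nat n ^ j) n * q ^ n))"
    by (rule summable_mult)
  also have "(\<lambda>n. q * (diffs (\<lambda>n. of_nat n ^ j) n * q ^ n)) =
      (\<lambda>n. of_nat (Suc n) ^ Suc j * q ^ Suc n)"
    by (simp add: diffs_def fun_eq_iff)
  finally show ?case
    by (subst (asm) summable_Suc_iff)
qed

lemma qseries_has_field_derivative:
  assumes "norm q < 1"
  shows "(qseries j has_field_derivative (\<Sum>n. diffs (\<lambda>n. of_nat n ^ j) n * q ^ n)) (at q)"
  unfolding qseries_def using assms
  by (intro termdiffs_strong'[where K = 1] summable_power_times_geometric) auto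

text \<open>The Euler operator q d/dq multiplies the n-th coefficient by n. Under q =
  \<open>ee z\<close> it is d/dz divided by 2 pi i, which is how the differentiated reflection
  formula uses it.\<close>

lemma qseries_Suc:
  assumes "norm q < 1"
  shows "q * (\<Sum>n. diffs (\<lambda>n. of_nat n ^ j) n * q ^ n) = qseries (Suc j) q"
proof -
  have "summable (\<lambda>n. diffs (\<lambda>n. of_nat n ^ j) n * q ^ n)"
    using assms by (intro termdiff_converges[where K = 1] summable_power_times_geometric) auto
  then have "q * (\<Sum>n. diffs (\<lambda>n. of_nat n ^ j) n * q ^ n) =
      (\<Sum>n. q * (diffs (\<lambda>n. of_nat n ^ j) n * q ^ n))"
    by (rule suminf_mult [symmetric])
  also have "\<dots> = (\<Sum>n. of_nat (Suc n) ^ Suc j * q ^ Suc n)"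
    by (simp add: diffs_def mult_ac)
  also have "\<dots> = qseries (Suc j) q"
    unfolding qseries_def
    by (subst suminf_split_head[OF summable_power_times_geometric[OF assms]]) simp
  finally show ?thesis .
qed

lemma norm_ee: "norm (ee z) = exp (- 2 * pi * Im z)"
  by (simp add: ee_def norm_exp_eq_Re)

lemma norm_ee_less_1: "Im z > 0 \<Longrightarrow> norm (ee z) < 1"
  by (simp add: norm_ee)

lemma ee_add: "ee (a + b) = ee a * ee b"
  by (simp add: ee_def distrib_left exp_add)

lemma ee_of_nat_mult: "ee (of_nat n * z) = ee z ^ n"
  by (simp add: ee_def exp_of_nat_mult [symmetric] mult_ac)

lemma ee_has_field_derivative [derivative_intros]:
  "(ee has_field_derivative (2 * of_real pi * \<i> * ee z)) (at z)"
  unfolding ee_def [abs_def] by (auto intro!: derivative_eq_intros)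

section \<open>Reflection formulas for the cotangent and the polygamma functions\<close>

lemma upper_half_plane_nonpos_Ints:
  assumes "Im z > 0"
  shows "z \<notin> \<int>\<^sub>\<le>\<^sub>0" and "1 - z \<notin> \<int>\<^sub>\<le>\<^sub>0" and "z \<notin> \<int>"
  using assms by (auto elim!: nonpos_Ints_cases Ints_cases simp: complex_eq_iff)

text \<open>In w = exp(pi i z) the cotangent is a rational function of w^2 = \<open>ee z\<close>.
  Since 0^0 = 1, \<open>qseries 0\<close> is the full geometric series 1/(1 - q), which converges
  because the norm of \<open>ee z\<close> is below 1.\<close>

lemma pi_cot_eq_qseries:
  assumes "Im z > 0"
  shows "of_real pi * (cos (of_real pi * z) / sin (of_real pi * z)) =
    of_real pi * \<i> - 2 * of_real pi * \<i> * qseries 0 (ee z)"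
proof -
  define w where "w = exp (\<i> * (of_real pi * z))"
  have w0: "w \<noteq> 0" by (simp add: w_def)
  have w: "exp (- (\<i> * (of_real pi * z))) = 1 / w" by (simp add: w_def exp_minus divide_simps)
  have ew: "ee z = w ^ 2"
    by (simp add: w_def ee_def exp_of_nat_mult [symmetric] mult_ac power2_eq_square flip: exp_add)
  have w2: "w ^ 2 \<noteq> 1" using norm_ee_less_1[OF assms] ew by (metis norm_one less_irrefl)
  have q: "qseries 0 (ee z) = 1 / (1 - w ^ 2)"
    using norm_ee_less_1[OF assms] by (simp add: qseries_def suminf_geometric ew)
  have c: "cos (of_real pi * z) = (w ^ 2 + 1) / (2 * w)"
    unfolding cos_exp_eq w w_def [symmetric] using w0 by (simp add: field_simps power2_eq_square)
  have s: "sin (of_real pi * z) = (w ^ 2 - 1) / (2 * \<i> * w)"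
    unfolding sin_exp_eq w w_def [symmetric] using w0 by (simp add: field_simps power2_eq_square)
  have "cos (of_real pi * z) / sin (of_real pi * z) = \<i> * (w ^ 2 + 1) / (w ^ 2 - 1)"
    unfolding c s using w0 w2 by (simp add: divide_simps)
  also have "\<dots> = \<i> - 2 * \<i> * qseries 0 (ee z)"
    unfolding q using w2 by (simp add: divide_simps) (simp add: algebra_simps)
  finally have e: "cos (of_real pi * z) / sin (of_real pi * z) = \<i> - 2 * \<i> * qseries 0 (ee z)" .
  show ?thesis unfolding e by (simp add: algebra_simps)
qed

text \<open>Logarithmic derivative of Euler's formula Gamma(z) Gamma(1 - z) = pi / sin(pi z): both
  sides are differentiated and the common factor pi / sin(pi z) is cancelled.\<close>

lemma Digamma_reflection_upper_half_plane:
  assumes "Im z > 0"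
  shows "Digamma (1 - z) - Digamma z = of_real pi * (cos (of_real pi * z) / sin (of_real pi * z))"
proof -
  note ni = upper_half_plane_nonpos_Ints[OF assms]
  let ?s = "sin (of_real pi * z)" and ?c = "cos (of_real pi * z)"
  \<comment> \<open>Were the sine 0, division by zero would make the right side of the reflection
    formula 0, while neither Gamma factor vanishes off the nonpositive integers.\<close>
  have s0: "?s \<noteq> 0"
    using ni(3) Gamma_reflection_complex[of z] Gamma_eq_zero_iff[of z] Gamma_eq_zero_iff[of "1 - z"] ni by auto
  have "((\<lambda>z. Gamma z * Gamma (1 - z)) has_field_derivative
      Gamma z * Gamma (1 - z) * (Digamma z - Digamma (1 - z))) (at z)"
    using ni by (auto intro!: derivative_eq_intros simp: algebra_simps)
  moreover have "((\<lambda>z. of_real pi / sin (of_real pi * z)) has_field_derivative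
      - (of_real pi * of_real pi * ?c) / (?s * ?s)) (at z)"
    using s0 by (auto intro!: derivative_eq_intros simp: algebra_simps)
  then have "((\<lambda>z. Gamma z * Gamma (1 - z)) has_field_derivative
      - (of_real pi * of_real pi * ?c) / (?s * ?s)) (at z)"
    by (simp add: Gamma_reflection_complex)
  ultimately have "Gamma z * Gamma (1 - z) * (Digamma z - Digamma (1 - z)) =
      - (of_real pi * of_real pi * ?c) / (?s * ?s)"
    by (rule DERIV_unique)
  then have "of_real pi / ?s * (Digamma z - Digamma (1 - z)) =
      - (of_real pi * of_real pi * ?c) / (?s * ?s)"
    by (simp add: Gamma_reflection_complex)
  then have "of_real pi / ?s * (Digamma (1 - z) - Digamma z) = of_real pi / ?s * (of_real pi * (?c / ?s))"
    by (simp add: algebra_simps)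
  then show ?thesis using s0 by (subst (asm) mult_cancel_left) auto
qed

text \<open>Induction by differentiation: the identity for j holds throughout the open half plane,
  so the derivatives at z agree. The constant pi i of the cotangent disappears after the first
  derivative, hence the case distinction.\<close>

lemma Polygamma_reflection_upper_half_plane:
  assumes "Im z > 0"
  shows "(- 1) ^ j * Polygamma j (1 - z) - Polygamma j z =
    (if j = 0 then of_real pi * \<i> else 0) - (2 * of_real pi * \<i>) ^ Suc j * qseries j (ee z)"
  using assms
proof (induction j arbitrary: z)
  case 0
  then show ?case
    by (simp only: power_0 power_Suc mult_1 mult_1_right simp_thms if_True
        Digamma_reflection_upper_half_plane pi_cot_eq_qseries)
next
  case (Suc j)
  note ni = upper_half_plane_nonpos_Ints[OF Suc.prems]
  let ?l = "\<lambda>z. (- 1) ^ j * Polygamma j (1 - z) - Polygamma j z"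
  let ?r = "\<lambda>z. (if j = 0 then of_real pi * \<i> else 0) - (2 * of_real pi * \<i>) ^ Suc j * qseries j (ee z)"
  have l: "(?l has_field_derivative (- 1) ^ Suc j * Polygamma (Suc j) (1 - z) - Polygamma (Suc j) z) (at z)"
    using ni by (auto intro!: derivative_eq_intros simp: algebra_simps)
  have q: "norm (ee z) < 1" by (rule norm_ee_less_1[OF Suc.prems])
  let ?S = "\<Sum>n. diffs (\<lambda>n. of_nat n ^ j) n * ee z ^ n"
  have r: "(?r has_field_derivative 0 - (2 * of_real pi * \<i>) ^ Suc j * (?S * (2 * of_real pi * \<i> * ee z))) (at z)"
    by (intro DERIV_diff DERIV_const DERIV_cmult ee_has_field_derivative
        DERIV_chain2[where f = "qseries j" and g = ee and x = z, OF qseries_has_field_derivative[OF q, of j]])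
  have "eventually (\<lambda>w. w \<in> {w. 0 < Im w}) (nhds z)"
    using Suc.prems by (intro eventually_nhds_in_open open_halfspace_Im_gt) auto
  then have "eventually (\<lambda>w. ?l w = ?r w) (nhds z)"
    by eventually_elim (use Suc.IH in auto)
  then have "(?r has_field_derivative (- 1) ^ Suc j * Polygamma (Suc j) (1 - z) - Polygamma (Suc j) z) (at z)"
    using l by (rule DERIV_cong_ev[OF refl _ refl, THEN iffD1])
  from DERIV_unique[OF this r] show ?case
    using qseries_Suc[OF q, of j] by (simp add: mult_ac)
qed

section \<open>Absolute convergence along horizontal lines\<close>

lemma summable_on_int_inverse_square: "(\<lambda>m::int. 1 / (1 + (real_of_int m)\<^sup>2)) summable_on UNIV"
proof -
  have s: "(\<lambda>n. 1 / (1 + (real n)\<^sup>2)) summable_on UNIV"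
  proof (subst summable_on_UNIV_nonneg_real_iff)
    have "summable (\<lambda>n. 1 / (real n)\<^sup>2)" using inverse_power_summable[of 2] by (simp add: divide_inverse)
    then show "summable (\<lambda>n. 1 / (1 + (real n)\<^sup>2))"
    proof (rule summable_comparison_test_ev[rotated])
      show "\<forall>\<^sub>F n in sequentially. norm (1 / (1 + (real n)\<^sup>2)) \<le> 1 / (real n)\<^sup>2"
        using eventually_gt_at_top[of 0]
      proof eventually_elim
        case (elim n)
        have "0 < 1 + (real n)\<^sup>2" by (simp add: add_pos_nonneg)
        then show ?case
          using elim frac_le[of 1 1 "(real n)\<^sup>2" "1 + (real n)\<^sup>2"] by (simp add: abs_of_pos)
      qed
    qed
  qed simp
  have "(\<lambda>m::int. 1 / (1 + (real_of_int m)\<^sup>2)) summable_on (range int \<union> range (\<lambda>n. - int n))"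
  proof (rule summable_on_union)
    show "(\<lambda>m::int. 1 / (1 + (real_of_int m)\<^sup>2)) summable_on range int"
      using s by (subst summable_on_reindex) (auto simp: o_def)
    show "(\<lambda>m::int. 1 / (1 + (real_of_int m)\<^sup>2)) summable_on range (\<lambda>n. - int n)"
      using s by (subst summable_on_reindex) (auto simp: o_def inj_on_def)
  qed
  also have "range int \<union> range (\<lambda>n. - int n) = UNIV"
  proof -
    have "m \<in> range int \<union> range (\<lambda>n. - int n)" for m :: int
      by (cases m rule: int_cases2) auto
    then show ?thesis by blast
  qed
  finally show ?thesis .
qed

text \<open>The bound M must serve all real parts at once, since z = \<tau> + d/c later runs over
  infinitely many points of one line. The sum is invariant under z -> z + 1, so it suffices to treat
  the strip 0 \<le> Re z < 1.\<close>

lemma lattice_line_sum_bounded: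
  assumes "y > 0" "K \<ge> 2"
  obtains M where "\<And>z. Im z = y \<Longrightarrow> (\<lambda>m::int. norm (1 / (z + of_int m) ^ K)) summable_on UNIV"
    and "\<And>z. Im z = y \<Longrightarrow> (\<Sum>\<^sub>\<infinity>m::int. norm (1 / (z + of_int m) ^ K)) \<le> M"
proof -
  \<comment> \<open>For x = Re z in [0,1), (2x + m)^2 \<ge> 0 gives 1 + m^2 \<le> 3 + 2(x + m)^2
    \<le> (3/y^2 + 2)|z + m|^2. The other K - 2 factors of |z + m|^K are at least y each.\<close>
  define M0 where "M0 = (3 / y ^ 2 + 2) / y ^ (K - 2)"
  let ?g = "\<lambda>m::int. M0 * (1 / (1 + (real_of_int m)\<^sup>2))"
  have g: "?g summable_on UNIV"
    by (intro summable_on_cmult_right summable_on_int_inverse_square)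
  have bound: "norm (1 / (z + of_int m) ^ K) \<le> ?g m" if z: "Im z = y" "0 \<le> Re z" "Re z < 1" for z m
  proof -
    define N where "N = norm (z + of_int m)"
    have Ny: "N \<ge> y" using abs_Im_le_cmod[of "z + of_int m"] z by (simp add: N_def)
    have N2: "N\<^sup>2 = (Re z + m)\<^sup>2 + y\<^sup>2" by (simp add: N_def cmod_power2 z)
    have "(Re z)\<^sup>2 \<le> 1" using z by (simp add: power_le_one)
    moreover have "(real_of_int m)\<^sup>2 \<le> 2 * (Re z + m)\<^sup>2 + 2 * (Re z)\<^sup>2"
      using zero_le_power2[of "2 * Re z + m"] by (simp add: power2_eq_square algebra_simps)
    ultimately have "1 + (real_of_int m)\<^sup>2 \<le> 3 + 2 * (Re z + m)\<^sup>2" by linarith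
    also have "\<dots> \<le> (3 / y\<^sup>2 + 2) * N\<^sup>2"
      unfolding N2 using assms by (simp add: distrib_left distrib_right field_simps)
    finally have 1: "1 + (real_of_int m)\<^sup>2 \<le> (3 / y\<^sup>2 + 2) * N\<^sup>2" .
    have "N ^ K = N\<^sup>2 * N ^ (K - 2)" using power_add[of N 2 "K - 2"] assms
      by (simp only: le_add_diff_inverse)
    moreover have "N ^ (K - 2) \<ge> y ^ (K - 2)" using Ny assms by (intro power_mono) auto
    ultimately have 2: "N\<^sup>2 * y ^ (K - 2) \<le> N ^ K" by (simp add: mult_left_mono)
    have "(1 + (real_of_int m)\<^sup>2) * y ^ (K - 2) \<le> (3 / y\<^sup>2 + 2) * N\<^sup>2 * y ^ (K - 2)"
      using 1 assms by (intro mult_right_mono) auto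
    also have "\<dots> \<le> (3 / y\<^sup>2 + 2) * N ^ K"
      using 2 assms by (simp add: mult.assoc mult_left_mono)
    finally have 3: "(1 + (real_of_int m)\<^sup>2) * y ^ (K - 2) \<le> (3 / y\<^sup>2 + 2) * N ^ K" .
    have "0 < N ^ K" "0 < y ^ (K - 2)" "0 < 1 + (real_of_int m)\<^sup>2"
      using Ny assms by (auto intro!: add_pos_nonneg)
    then have "1 / N ^ K \<le> ?g m" using 3 unfolding M0_def
      by (simp add: divide_simps mult_ac)
    then show ?thesis by (simp add: N_def norm_divide norm_power)
  qed
  have shift: "(\<lambda>m::int. norm (1 / (z + of_int m) ^ K)) summable_on UNIV \<and>
    (\<Sum>\<^sub>\<infinity>m::int. norm (1 / (z + of_int m) ^ K)) \<le> infsum ?g UNIV" if z: "Im z = y" for z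
  proof -
    define a where "a = \<lfloor>Re z\<rfloor>"
    let ?h = "\<lambda>m::int. norm (1 / (z - of_int a + of_int m) ^ K)"
    have b: "?h m \<le> ?g m" for m
      by (rule bound) (use z in \<open>auto simp: a_def, linarith\<close>)
    have sh: "?h summable_on UNIV"
      by (rule summable_on_comparison_test[OF g b]) auto
    have ih: "infsum ?h UNIV \<le> infsum ?g UNIV"
      by (rule infsum_mono[OF sh g b])
    have bij: "bij_betw (\<lambda>m. m + a) UNIV UNIV"
      by (rule bij_betw_byWitness[of _ "\<lambda>m. m - a"]) auto
    have "(\<lambda>m. ?h (m + a)) = (\<lambda>m::int. norm (1 / (z + of_int m) ^ K))" by (simp add: algebra_simps)
    then show ?thesis
      using sh ih summable_on_reindex_bij_betw[OF bij, of ?h] infsum_reindex_bij_betw[OF bij, of ?h] by simp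
  qed
  then show ?thesis using that[of "infsum ?g UNIV"] by blast
qed

text \<open>The integers m \<ge> 0 contribute the series of \<open>Polygamma\<close> at z, the
  integers m < 0 that at 1 - z. For K \<ge> 2 the order j = K - 1 is positive, so the reflection
  formula has no constant left.\<close>

lemma Lipschitz_formula:
  assumes "Im z > 0" "K \<ge> 2"
  shows "((\<lambda>m::int. 1 / (z + of_int m) ^ K) has_sum
    ((- 2 * of_real pi * \<i>) ^ K / fact (K - 1) * qseries (K - 1) (ee z))) UNIV"
proof -
  let ?f = "\<lambda>m::int. 1 / (z + of_int m) ^ K"
  obtain j where j: "K = Suc j" "j > 0" using assms by (cases K) auto
  note ni = upper_half_plane_nonpos_Ints[OF assms(1)]
  have z0: "z \<noteq> 0" "1 - z \<noteq> 0" using ni by auto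
  have abs: "(\<lambda>m. norm (?f m)) summable_on UNIV"
    by (rule lattice_line_sum_bounded[OF assms]) blast
  then have ab: "(\<lambda>m. ?f m) summable_on S" for S
    using summable_on_subset_banach[OF abs_summable_summable[OF abs], of S] by simp
  \<comment> \<open>Transfers the value of an ordinary series to the unordered sum over the image of
    its index map; absolute summability makes the two agree.\<close>
  have range: "infsum ?f (range i) = S" if i: "inj i" "(\<lambda>n. ?f (i n)) sums S" for i :: "nat \<Rightarrow> int" and S
  proof -
    have "(?f \<circ> i) summable_on UNIV" using ab[of "range i"] i(1) by (simp add: summable_on_reindex)
    then have "(?f \<circ> i) sums infsum (?f \<circ> i) UNIV" by (intro has_sum_imp_sums has_sum_infsum)
    then have "infsum (?f \<circ> i) UNIV = S" using i(2) by (auto simp: o_def intro: sums_unique2)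
    then show ?thesis using infsum_reindex[OF i(1), of ?f] by simp
  qed
  have 1: "infsum ?f (range int) = (- 1) ^ Suc j * Polygamma j z / fact j"
  proof (rule range)
    show "(\<lambda>n. ?f (int n)) sums ((- 1) ^ Suc j * Polygamma j z / fact j)"
      using Polygamma_LIMSEQ[OF z0(1) j(2)] by (simp add: j(1) divide_inverse)
  qed simp
  \<comment> \<open>Starting at -1 keeps the two ranges disjoint and turns z + m into -(1 - z + n),
    whence the argument 1 - z.\<close>
  have 2: "infsum ?f (range (\<lambda>n. - int (Suc n))) = Polygamma j (1 - z) / fact j"
  proof (rule range)
    have f: "?f (- int (Suc n)) = (- 1) ^ Suc j * inverse ((1 - z + of_nat n) ^ Suc j)" for n
    proof -
      have "z + of_int (- int (Suc n)) = (- 1) * (1 - z + of_nat n)" by simp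
      then have "?f (- int (Suc n)) = 1 / ((- 1) * (1 - z + of_nat n)) ^ Suc j"
        unfolding j by (simp only:)
      also have "\<dots> = inverse ((- 1) ^ Suc j) * inverse ((1 - z + of_nat n) ^ Suc j)"
        by (simp only: power_mult_distrib divide_inverse mult_1 inverse_mult_distrib)
      also have "inverse ((- 1) ^ Suc j :: complex) = (- 1) ^ Suc j"
        by (cases "even j") auto
      finally show ?thesis .
    qed
    have "(- 1) ^ Suc j * ((- 1) ^ Suc j * Polygamma j (1 - z) / fact j) = Polygamma j (1 - z) / fact j"
      by (cases "even j") auto
    with sums_mult[OF Polygamma_LIMSEQ[OF z0(2) j(2)], of "(- 1) ^ Suc j"]
    show "(\<lambda>n. ?f (- int (Suc n))) sums (Polygamma j (1 - z) / fact j)"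
      unfolding f by metis
  qed (auto simp: inj_on_def)
  have U: "(UNIV :: int set) = range int \<union> range (\<lambda>n. - int (Suc n))"
  proof -
    have "m \<in> range int \<union> range (\<lambda>n. - int (Suc n))" for m
      by (cases m rule: int_cases) (auto simp del: of_nat_Suc)
    then show ?thesis by blast
  qed
  have "infsum ?f UNIV = infsum ?f (range int) + infsum ?f (range (\<lambda>n. - int (Suc n)))"
    unfolding U by (intro infsum_Un_disjoint ab) auto
  also have "\<dots> = (- 1) ^ j * ((- 1) ^ j * Polygamma j (1 - z) - Polygamma j z) / fact j"
    unfolding 1 2 by (cases "even j") (auto simp: diff_divide_distrib add_divide_distrib)
  also have "\<dots> = (- 1) ^ j * (- ((2 * of_real pi * \<i>) ^ Suc j * qseries j (ee z))) / fact j"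
    unfolding Polygamma_reflection_upper_half_plane[OF assms(1)] using j(2) by simp
  also have "\<dots> = ((- 1) * (2 * of_real pi * \<i>)) ^ Suc j * qseries j (ee z) / fact j"
    unfolding power_mult_distrib by simp
  finally have "infsum ?f UNIV = (- 2 * of_real pi * \<i>) ^ K / fact (K - 1) * qseries (K - 1) (ee z)"
    by (simp add: j(1))
  then show ?thesis
    using has_sum_infsum[OF ab[of UNIV]] by simp
qed

section \<open>Cosets and double cosets of the stabilizer of infinity\<close>

lemma mult_SL2Z [simp]: "\<gamma> \<otimes>\<^bsub>SL2Z\<^esub> \<delta> = \<gamma> ** \<delta>"
  by (simp add: SL2Z_def)

lemma matrix_mult_2x2_nth [simp]:
  fixes A B :: "'a::semiring_1^2^2"
  shows "(A ** B) $ i $ l = A $ i $ 1 * B $ 1 $ l + A $ i $ 2 * B $ 2 $ l"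
  by (simp add: matrix_matrix_mult_def sum_2)

lemma carrier_SL2Z_iff:
  "\<gamma> \<in> carrier SL2Z \<longleftrightarrow> \<gamma> $ 1 $ 1 * \<gamma> $ 2 $ 2 - \<gamma> $ 1 $ 2 * \<gamma> $ 2 $ 1 = 1"
  by (simp add: SL2Z_def det_2)

lemma inv_SL2Z_nth [simp]:
  assumes "\<gamma> \<in> carrier SL2Z"
  shows "(inv\<^bsub>SL2Z\<^esub> \<gamma>) $ 1 $ 1 = \<gamma> $ 2 $ 2" "(inv\<^bsub>SL2Z\<^esub> \<gamma>) $ 1 $ 2 = - \<gamma> $ 1 $ 2"
    "(inv\<^bsub>SL2Z\<^esub> \<gamma>) $ 2 $ 1 = - \<gamma> $ 2 $ 1" "(inv\<^bsub>SL2Z\<^esub> \<gamma>) $ 2 $ 2 = \<gamma> $ 1 $ 1"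
  using assms by (simp_all add: inv_SL2Z vector_2)

lemma SL2Z_closed:
  "\<gamma> \<in> carrier SL2Z \<Longrightarrow> \<delta> \<in> carrier SL2Z \<Longrightarrow> \<gamma> ** \<delta> \<in> carrier SL2Z"
  "\<gamma> \<in> carrier SL2Z \<Longrightarrow> inv\<^bsub>SL2Z\<^esub> \<gamma> \<in> carrier SL2Z"
  using group.inv_closed[OF group_SL2Z] monoid.m_closed[OF group.is_monoid[OF group_SL2Z]] by force+

lemma inv_SL2Z_mult:
  "\<gamma> \<in> carrier SL2Z \<Longrightarrow> \<delta> \<in> carrier SL2Z \<Longrightarrow>
    inv\<^bsub>SL2Z\<^esub> (\<gamma> ** \<delta>) = inv\<^bsub>SL2Z\<^esub> \<delta> ** inv\<^bsub>SL2Z\<^esub> \<gamma>"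
  using group.inv_mult_group[OF group_SL2Z, of \<gamma> \<delta>] by simp

lemma inv_inv_SL2Z [simp]: "\<gamma> \<in> carrier SL2Z \<Longrightarrow> inv\<^bsub>SL2Z\<^esub> (inv\<^bsub>SL2Z\<^esub> \<gamma>) = \<gamma>"
  by (rule group.inv_inv[OF group_SL2Z])

definition T_pow :: "int \<Rightarrow> int^2^2" where
  "T_pow m = vector [vector [1, m], vector [0, 1]]"

lemma T_pow_nth [simp]:
  "T_pow m $ 1 $ 1 = 1" "T_pow m $ 1 $ 2 = m" "T_pow m $ 2 $ 1 = 0" "T_pow m $ 2 $ 2 = 1"
  by (simp_all add: T_pow_def)

lemma T_pow_carrier [simp]: "T_pow m \<in> carrier SL2Z"
  by (simp add: carrier_SL2Z_iff)

lemma inv_T_pow [simp]: "inv\<^bsub>SL2Z\<^esub> (T_pow m) = T_pow (- m)"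
  by (simp add: matrix_eq_2x2)

text \<open>With c = 0 the determinant condition reads a d = 1 over the integers, so a = d = 1 or a
  = d = -1, and the upper right entry is the exponent of T up to that sign.\<close>

lemma Gamma_inf_iff: "\<gamma> \<in> Gamma_inf \<longleftrightarrow> \<gamma> \<in> carrier SL2Z \<and> \<gamma> $ 2 $ 1 = 0"
proof
  assume "\<gamma> \<in> Gamma_inf"
  then show "\<gamma> \<in> carrier SL2Z \<and> \<gamma> $ 2 $ 1 = 0"
    by (auto simp: Gamma_inf_def T_mat_int_pow carrier_SL2Z_iff)
next
  assume *: "\<gamma> \<in> carrier SL2Z \<and> \<gamma> $ 2 $ 1 = 0"
  then have "\<gamma> $ 1 $ 1 * \<gamma> $ 2 $ 2 = 1" by (auto simp: carrier_SL2Z_iff)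
  then consider "\<gamma> $ 1 $ 1 = 1" "\<gamma> $ 2 $ 2 = 1" | "\<gamma> $ 1 $ 1 = - 1" "\<gamma> $ 2 $ 2 = - 1"
    by (auto simp: zmult_eq_1_iff)
  then show "\<gamma> \<in> Gamma_inf"
  proof cases
    case 1
    with * show ?thesis unfolding Gamma_inf_def T_mat_int_pow
      by (intro CollectI exI[of _ "\<gamma> $ 1 $ 2"] disjI1) (simp add: matrix_eq_2x2)
  next
    case 2
    with * show ?thesis unfolding Gamma_inf_def T_mat_int_pow
      by (intro CollectI exI[of _ "- \<gamma> $ 1 $ 2"] disjI2) (simp add: matrix_eq_2x2)
  qed
qed

lemma T_pow_Gamma_inf [simp]: "T_pow m \<in> Gamma_inf"
  by (simp add: Gamma_inf_iff)

lemma Gamma_inf_carrier: "\<gamma> \<in> Gamma_inf \<Longrightarrow> \<gamma> \<in> carrier SL2Z"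
  by (simp add: Gamma_inf_iff)

lemma Gamma_inf_diagonal:
  assumes "t \<in> Gamma_inf"
  shows "t $ 2 $ 1 = 0" and "t $ 1 $ 1 = t $ 2 $ 2" and "t $ 2 $ 2 = 1 \<or> t $ 2 $ 2 = - 1"
  using assms by (auto simp: Gamma_inf_iff carrier_SL2Z_iff zmult_eq_1_iff)

lemma inv_Gamma_inf: "t \<in> Gamma_inf \<Longrightarrow> inv\<^bsub>SL2Z\<^esub> t \<in> Gamma_inf"
  by (simp add: Gamma_inf_iff SL2Z_closed)

text \<open>Left multiplication by the stabilizer only changes the sign of the bottom row, and the
  row up to sign determines the coset. This turns equality of cosets into integer
  arithmetic.\<close>

definition same_bottom_row :: "int^2^2 \<Rightarrow> int^2^2 \<Rightarrow> bool" where
  "same_bottom_row \<gamma> \<delta> \<longleftrightarrow>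
    (\<exists>e\<in>{1, - 1}. \<gamma> $ 2 $ 1 = e * \<delta> $ 2 $ 1 \<and> \<gamma> $ 2 $ 2 = e * \<delta> $ 2 $ 2)"

text \<open>The lower left entry of \<gamma> \<delta>^-1 is the determinant of the two bottom rows,
  which vanishes when they are proportional.\<close>

lemma same_bottom_rowD:
  assumes "\<gamma> \<in> carrier SL2Z" "\<delta> \<in> carrier SL2Z" "same_bottom_row \<gamma> \<delta>"
  obtains t where "t \<in> Gamma_inf" "\<gamma> = t ** \<delta>"
proof
  from assms(3) obtain e :: int where e: "e = 1 \<or> e = - 1" "\<gamma> $ 2 $ 1 = e * \<delta> $ 2 $ 1" "\<gamma> $ 2 $ 2 = e * \<delta> $ 2 $ 2"
    unfolding same_bottom_row_def by blast
  let ?t = "\<gamma> ** inv\<^bsub>SL2Z\<^esub> \<delta>"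
  show "?t \<in> Gamma_inf"
    using assms e by (auto simp: Gamma_inf_iff SL2Z_closed)
  have "inv\<^bsub>SL2Z\<^esub> \<delta> ** \<delta> = mat 1"
    using group.l_inv[OF group_SL2Z assms(2)] by (simp add: SL2Z_def)
  then show "\<gamma> = ?t ** \<delta>" by (simp flip: matrix_mul_assoc)
qed

lemma same_bottom_row_mult:
  assumes "t \<in> Gamma_inf"
  shows "same_bottom_row (t ** \<delta>) \<delta>"
  using Gamma_inf_diagonal[OF assms] by (auto simp: same_bottom_row_def)

lemma r_coset_Gamma_inf:
  assumes "\<delta> \<in> carrier SL2Z"
  shows "Gamma_inf #>\<^bsub>SL2Z\<^esub> \<delta> = {\<gamma> \<in> carrier SL2Z. same_bottom_row \<gamma> \<delta>}"
proof (intro equalityI subsetI)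
  fix x assume "x \<in> Gamma_inf #>\<^bsub>SL2Z\<^esub> \<delta>"
  then show "x \<in> {\<gamma> \<in> carrier SL2Z. same_bottom_row \<gamma> \<delta>}"
    using assms by (auto simp: r_coset_def same_bottom_row_mult SL2Z_closed Gamma_inf_carrier)
next
  fix x assume "x \<in> {\<gamma> \<in> carrier SL2Z. same_bottom_row \<gamma> \<delta>}"
  then obtain t where "t \<in> Gamma_inf" "x = t ** \<delta>"
    using assms same_bottom_rowD[of x \<delta>] by blast
  then show "x \<in> Gamma_inf #>\<^bsub>SL2Z\<^esub> \<delta>"
    by (auto simp: r_coset_def)
qed

text \<open>On the right, powers of T are enough: -1 is central and is absorbed by the sign in
  \<open>same_bottom_row\<close>. A power T^m replaces d by d + m c.\<close>

definition same_double_coset :: "int^2^2 \<Rightarrow> int^2^2 \<Rightarrow> bool" where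
  "same_double_coset \<gamma> \<delta> \<longleftrightarrow> (\<exists>m. same_bottom_row \<gamma> (\<delta> ** T_pow m))"

lemma double_coset_Gamma_inf:
  assumes "\<delta> \<in> carrier SL2Z"
  shows "Gamma_inf #>\<^bsub>SL2Z\<^esub> \<delta> <#>\<^bsub>SL2Z\<^esub> Gamma_inf =
    {\<gamma> \<in> carrier SL2Z. same_double_coset \<gamma> \<delta>}"
proof (intro equalityI subsetI)
  fix x assume "x \<in> Gamma_inf #>\<^bsub>SL2Z\<^esub> \<delta> <#>\<^bsub>SL2Z\<^esub> Gamma_inf"
  then obtain \<gamma> t where x: "x = \<gamma> ** t" "\<gamma> \<in> carrier SL2Z" "same_bottom_row \<gamma> \<delta>" "t \<in> Gamma_inf"
    using assms by (auto simp: set_mult_def r_coset_Gamma_inf)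
  from x(3) obtain e :: int where e: "e = 1 \<or> e = - 1" "\<gamma> $ 2 $ 1 = e * \<delta> $ 2 $ 1" "\<gamma> $ 2 $ 2 = e * \<delta> $ 2 $ 2"
    unfolding same_bottom_row_def by blast
  note t = Gamma_inf_diagonal[OF x(4)]
  \<comment> \<open>If t = \<epsilon> T^n with a sign \<epsilon>, then \<open>t $ 2 $ 2\<close> is
    \<epsilon> and \<open>t $ 1 $ 2\<close> is \<epsilon> n, so their product recovers n.\<close>
  have "same_bottom_row x (\<delta> ** T_pow (t $ 1 $ 2 * t $ 2 $ 2))"
    using e t unfolding same_bottom_row_def x
    by (intro bexI[of _ "e * t $ 2 $ 2"]) (auto simp: algebra_simps)
  then show "x \<in> {\<gamma> \<in> carrier SL2Z. same_double_coset \<gamma> \<delta>}"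
    using x by (auto simp: same_double_coset_def SL2Z_closed Gamma_inf_carrier)
next
  fix x assume "x \<in> {\<gamma> \<in> carrier SL2Z. same_double_coset \<gamma> \<delta>}"
  then obtain m where m: "x \<in> carrier SL2Z" "same_bottom_row x (\<delta> ** T_pow m)"
    by (auto simp: same_double_coset_def)
  then obtain t where t: "t \<in> Gamma_inf" "x = t ** (\<delta> ** T_pow m)"
    using assms same_bottom_rowD[of x "\<delta> ** T_pow m"] SL2Z_closed(1)[OF assms T_pow_carrier] by blast
  then have x: "x = (t ** \<delta>) ** T_pow m" by (simp add: matrix_mul_assoc)
  have "t ** \<delta> \<in> Gamma_inf #>\<^bsub>SL2Z\<^esub> \<delta>"
    using t(1) by (auto simp: r_coset_def)
  moreover have "x = (t ** \<delta>) \<otimes>\<^bsub>SL2Z\<^esub> T_pow m" using x by simp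
  ultimately show "x \<in> Gamma_inf #>\<^bsub>SL2Z\<^esub> \<delta> <#>\<^bsub>SL2Z\<^esub> Gamma_inf"
    unfolding set_mult_def using T_pow_Gamma_inf[of m] by blast
qed

lemma rcosetsE:
  assumes "C \<in> rcosets\<^bsub>SL2Z\<^esub> Gamma_inf"
  obtains \<delta> where "\<delta> \<in> carrier SL2Z" "C = Gamma_inf #>\<^bsub>SL2Z\<^esub> \<delta>"
  using assms by (auto simp: RCOSETS_def)

lemma nontrivial_double_cosetsE:
  assumes "D \<in> nontrivial_double_cosets"
  obtains \<delta> where "\<delta> \<in> carrier SL2Z" "\<delta> $ 2 $ 1 \<noteq> 0" "D = {\<gamma> \<in> carrier SL2Z. same_double_coset \<gamma> \<delta>}"
  using assms by (auto simp: nontrivial_double_cosets_def double_coset_Gamma_inf Gamma_inf_iff)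

lemma nontrivial_double_cosetsI:
  "\<delta> \<in> carrier SL2Z \<Longrightarrow> \<delta> $ 2 $ 1 \<noteq> 0 \<Longrightarrow>
    {\<gamma> \<in> carrier SL2Z. same_double_coset \<gamma> \<delta>} \<in> nontrivial_double_cosets"
  unfolding nontrivial_double_cosets_def
  by (intro CollectI exI[of _ \<delta>]) (simp add: double_coset_Gamma_inf Gamma_inf_iff)

lemma same_bottom_row_sym: "same_bottom_row \<gamma> \<delta> \<Longrightarrow> same_bottom_row \<delta> \<gamma>"
  unfolding same_bottom_row_def by (elim bexE) (rule_tac x = e in bexI, auto)

lemma same_bottom_row_trans:
  assumes "same_bottom_row \<gamma> \<delta>" "same_bottom_row \<delta> \<epsilon>"
  shows "same_bottom_row \<gamma> \<epsilon>"
proof -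
  from assms obtain e e' where "e \<in> {1, -1}" "e' \<in> {1, -1}" "\<gamma> $ 2 $ 1 = e * \<delta> $ 2 $ 1" "\<gamma> $ 2 $ 2 = e * \<delta> $ 2 $ 2"
    "\<delta> $ 2 $ 1 = e' * \<epsilon> $ 2 $ 1" "\<delta> $ 2 $ 2 = e' * \<epsilon> $ 2 $ 2"
    unfolding same_bottom_row_def by blast
  then show ?thesis unfolding same_bottom_row_def by (intro bexI[of _ "e * e'"]) auto
qed

lemma same_bottom_row_mult_T_pow:
  "same_bottom_row \<gamma> \<delta> \<Longrightarrow> same_bottom_row (\<gamma> ** T_pow m) (\<delta> ** T_pow m)"
  unfolding same_bottom_row_def by (elim bexE) (rule_tac x = e in bexI, auto simp: algebra_simps)

lemma T_pow_add: "T_pow m ** T_pow n = T_pow (m + n)"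
  by (simp add: matrix_eq_2x2)

lemma T_pow_0: "T_pow 0 = mat 1"
  by (simp add: matrix_eq_2x2 mat_def)

lemma same_double_coset_sym: "same_double_coset \<gamma> \<delta> \<Longrightarrow> same_double_coset \<delta> \<gamma>"
proof -
  assume "same_double_coset \<gamma> \<delta>"
  then obtain m where "same_bottom_row \<gamma> (\<delta> ** T_pow m)" by (auto simp: same_double_coset_def)
  then have "same_bottom_row (\<gamma> ** T_pow (- m)) (\<delta> ** T_pow m ** T_pow (- m))"
    by (rule same_bottom_row_mult_T_pow)
  then have "same_bottom_row (\<gamma> ** T_pow (- m)) \<delta>"
    by (simp flip: matrix_mul_assoc add: T_pow_add T_pow_0)
  then show ?thesis using same_bottom_row_sym by (auto simp: same_double_coset_def)
qed

lemma same_double_coset_trans: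
  assumes "same_double_coset \<gamma> \<delta>" "same_double_coset \<delta> \<epsilon>"
  shows "same_double_coset \<gamma> \<epsilon>"
proof -
  from assms obtain m n where "same_bottom_row \<gamma> (\<delta> ** T_pow m)" "same_bottom_row \<delta> (\<epsilon> ** T_pow n)"
    by (auto simp: same_double_coset_def)
  then have "same_bottom_row \<gamma> (\<epsilon> ** T_pow n ** T_pow m)"
    using same_bottom_row_mult_T_pow same_bottom_row_trans by blast
  then show ?thesis by (auto simp: same_double_coset_def T_pow_add simp flip: matrix_mul_assoc)
qed

lemma nontrivial_double_coset_rep:
  assumes "D \<in> nontrivial_double_cosets" "\<gamma> \<in> D"
  shows "\<gamma> \<in> carrier SL2Z" and "\<gamma> $ 2 $ 1 \<noteq> 0"
    and "D = {\<delta> \<in> carrier SL2Z. same_double_coset \<delta> \<gamma>}"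
proof -
  obtain \<delta> where \<delta>: "\<delta> \<in> carrier SL2Z" "\<delta> $ 2 $ 1 \<noteq> 0" "D = {\<gamma> \<in> carrier SL2Z. same_double_coset \<gamma> \<delta>}"
    using assms(1) by (rule nontrivial_double_cosetsE)
  then have *: "\<gamma> \<in> carrier SL2Z" "same_double_coset \<gamma> \<delta>" using assms(2) by auto
  then show "\<gamma> \<in> carrier SL2Z" "\<gamma> $ 2 $ 1 \<noteq> 0"
    using \<delta> by (auto simp: same_double_coset_def same_bottom_row_def)
  show "D = {\<delta> \<in> carrier SL2Z. same_double_coset \<delta> \<gamma>}"
    unfolding \<delta> using * same_double_coset_trans same_double_coset_sym by blast
qed

text \<open>The exponent m is unique because T^m moves d by m c and c is nonzero off the stabilizer.
  The double coset is recovered by cancelling powers of T on the right.\<close>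

lemma bij_betw_double_cosets_rcosets:
  assumes v: "\<And>D. D \<in> nontrivial_double_cosets \<Longrightarrow> v D \<in> D"
  shows "bij_betw (\<lambda>(D, m). Gamma_inf #>\<^bsub>SL2Z\<^esub> (v D ** T_pow m)) (nontrivial_double_cosets \<times> UNIV)
    (rcosets\<^bsub>SL2Z\<^esub> Gamma_inf - {Gamma_inf})"
  unfolding bij_betw_def
proof
  note rep = nontrivial_double_coset_rep[OF _ v]
  have coset: "Gamma_inf #>\<^bsub>SL2Z\<^esub> (v D ** T_pow m) = {\<gamma> \<in> carrier SL2Z. same_bottom_row \<gamma> (v D ** T_pow m)}"
    if "D \<in> nontrivial_double_cosets" for D m
    using that by (simp add: r_coset_Gamma_inf SL2Z_closed rep)
  have self: "same_bottom_row \<gamma> \<gamma>" for \<gamma> by (auto simp: same_bottom_row_def)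
  show "inj_on (\<lambda>(D, m). Gamma_inf #>\<^bsub>SL2Z\<^esub> (v D ** T_pow m)) (nontrivial_double_cosets \<times> UNIV)"
  proof (rule inj_onI, clarsimp)
    fix D D' m m'
    assume D: "D \<in> nontrivial_double_cosets" "D' \<in> nontrivial_double_cosets"
      and eq: "Gamma_inf #>\<^bsub>SL2Z\<^esub> (v D ** T_pow m) = Gamma_inf #>\<^bsub>SL2Z\<^esub> (v D' ** T_pow m')"
    have "v D ** T_pow m \<in> Gamma_inf #>\<^bsub>SL2Z\<^esub> (v D ** T_pow m)"
      using D by (simp add: coset self SL2Z_closed rep)
    then have *: "same_bottom_row (v D ** T_pow m) (v D' ** T_pow m')"
      unfolding eq coset[OF D(2)] by simp
    then have "same_bottom_row (v D ** T_pow m ** T_pow (- m)) (v D' ** T_pow m' ** T_pow (- m))"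
      by (rule same_bottom_row_mult_T_pow)
    then have sd: "same_double_coset (v D) (v D')"
      by (auto simp: same_double_coset_def T_pow_add T_pow_0 simp flip: matrix_mul_assoc)
    then have "v D \<in> D'" using rep(3)[OF D(2) D(2)] rep(1)[OF D(1) D(1)] by blast
    then have "D = D'"
      using nontrivial_double_coset_rep(3)[OF D(2), of "v D"] rep(3)[OF D(1) D(1)] by simp
    moreover have "m = m'"
      using * rep(2)[OF D(1) D(1)] unfolding \<open>D = D'\<close> by (auto simp: same_bottom_row_def)
    ultimately show "D = D' \<and> m = m'" by simp
  qed
  show "(\<lambda>(D, m). Gamma_inf #>\<^bsub>SL2Z\<^esub> (v D ** T_pow m)) ` (nontrivial_double_cosets \<times> UNIV) =
    rcosets\<^bsub>SL2Z\<^esub> Gamma_inf - {Gamma_inf}"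
  proof (intro equalityI subsetI)
    fix C assume "C \<in> (\<lambda>(D, m). Gamma_inf #>\<^bsub>SL2Z\<^esub> (v D ** T_pow m)) ` (nontrivial_double_cosets \<times> UNIV)"
    then obtain D m where D: "D \<in> nontrivial_double_cosets" and C: "C = Gamma_inf #>\<^bsub>SL2Z\<^esub> (v D ** T_pow m)"
      by auto
    let ?C = "Gamma_inf #>\<^bsub>SL2Z\<^esub> (v D ** T_pow m)"
    have "v D ** T_pow m \<in> ?C" "v D ** T_pow m \<notin> Gamma_inf"
      using D by (simp_all add: coset self SL2Z_closed rep Gamma_inf_iff)
    moreover have "?C \<in> rcosets\<^bsub>SL2Z\<^esub> Gamma_inf"
      using D by (auto simp: RCOSETS_def SL2Z_closed rep)
    ultimately show "C \<in> rcosets\<^bsub>SL2Z\<^esub> Gamma_inf - {Gamma_inf}" unfolding C by blast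
  next
    fix C assume C': "C \<in> rcosets\<^bsub>SL2Z\<^esub> Gamma_inf - {Gamma_inf}"
    then have C: "C \<in> rcosets\<^bsub>SL2Z\<^esub> Gamma_inf" "C \<noteq> Gamma_inf" by auto
    then obtain \<delta> where \<delta>: "\<delta> \<in> carrier SL2Z" "C = Gamma_inf #>\<^bsub>SL2Z\<^esub> \<delta>"
      by (auto elim: rcosetsE)
    \<comment> \<open>All matrices with c = 0 have d = 1 or d = -1, so they form a single coset, the
      removed one.\<close>
    have c: "\<delta> $ 2 $ 1 \<noteq> 0"
    proof
      assume c: "\<delta> $ 2 $ 1 = 0"
      then have d: "\<delta> $ 2 $ 2 = 1 \<or> \<delta> $ 2 $ 2 = - 1"
        using Gamma_inf_diagonal[of \<delta>] \<delta> by (simp add: Gamma_inf_iff)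
      have "same_bottom_row \<gamma> \<delta> \<longleftrightarrow> \<gamma> $ 2 $ 1 = 0" if \<gamma>: "\<gamma> \<in> carrier SL2Z" for \<gamma>
      proof
        assume "\<gamma> $ 2 $ 1 = 0"
        then have "\<gamma> $ 2 $ 2 = 1 \<or> \<gamma> $ 2 $ 2 = - 1"
          using Gamma_inf_diagonal[of \<gamma>] \<gamma> by (simp add: Gamma_inf_iff)
        then show "same_bottom_row \<gamma> \<delta>"
          using \<open>\<gamma> $ 2 $ 1 = 0\<close> c d unfolding same_bottom_row_def
          by (intro bexI[of _ "\<gamma> $ 2 $ 2 * \<delta> $ 2 $ 2"]) auto
      qed (use c in \<open>auto simp: same_bottom_row_def\<close>)
      then have "C = Gamma_inf"
        unfolding \<delta>(2) r_coset_Gamma_inf[OF \<delta>(1)] by (auto simp: Gamma_inf_iff)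
      with C show False by simp
    qed
    define D where "D = {\<gamma> \<in> carrier SL2Z. same_double_coset \<gamma> \<delta>}"
    have D: "D \<in> nontrivial_double_cosets"
      unfolding D_def using \<delta> c by (intro nontrivial_double_cosetsI) auto
    have "same_double_coset \<delta> (v D)"
      using v[OF D] same_double_coset_sym unfolding D_def by auto
    then obtain m where m: "same_bottom_row \<delta> (v D ** T_pow m)" by (auto simp: same_double_coset_def)
    then have "C = Gamma_inf #>\<^bsub>SL2Z\<^esub> (v D ** T_pow m)"
      unfolding \<delta> coset[OF D] r_coset_Gamma_inf[OF \<delta>(1)]
      using same_bottom_row_trans same_bottom_row_sym by blast
    then show "C \<in> (\<lambda>(D, m). Gamma_inf #>\<^bsub>SL2Z\<^esub> (v D ** T_pow m)) ` (nontrivial_double_cosets \<times> UNIV)"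
      using D by (intro image_eqI[of _ _ "(D, m)"]) auto
  qed
qed

lemma Gamma_inf_in_rcosets: "Gamma_inf \<in> rcosets\<^bsub>SL2Z\<^esub> Gamma_inf"
proof -
  have "Gamma_inf = Gamma_inf #>\<^bsub>SL2Z\<^esub> mat 1"
    by (auto simp: r_coset_def)
  moreover have "mat 1 \<in> carrier SL2Z" by (simp add: SL2Z_def)
  ultimately show ?thesis by (auto simp: RCOSETS_def)
qed

text \<open>An injection into pairs (c, e) with e < c bounds the family by the sum of c times 1/c^4.
  Injectivity holds because equal residues of d differ by a multiple of c, that is, by a power of
  T.\<close>

lemma summable_on_nontrivial_double_cosets:
  assumes v: "\<And>D. D \<in> nontrivial_double_cosets \<Longrightarrow> v D \<in> D"
  shows "(\<lambda>D. 1 / \<bar>real_of_int (v D $ 2 $ 1)\<bar> ^ 4) summable_on nontrivial_double_cosets"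
proof -
  note rep = nontrivial_double_coset_rep[OF _ v]
  \<comment> \<open>The factor \<open>sgn\<close> makes the residue independent of the common sign
    of the bottom row.\<close>
  define key where "key = (\<lambda>D. (nat \<bar>v D $ 2 $ 1\<bar>, nat ((sgn (v D $ 2 $ 1) * v D $ 2 $ 2) mod \<bar>v D $ 2 $ 1\<bar>)))"
  let ?S = "Sigma {1..} (\<lambda>c::nat. {..<c})"
  have sS: "(\<lambda>(c, e). 1 / real c ^ 4) summable_on ?S"
  proof (rule summable_on_SigmaI)
    fix c :: nat
    show "((\<lambda>e. case (c, e) of (c, e) \<Rightarrow> 1 / real c ^ 4) has_sum (real c * (1 / real c ^ 4))) {..<c}"
      by (rule has_sum_finiteI) auto
  next
    have "summable (\<lambda>c. 1 / real c ^ 3)" using inverse_power_summable[of 3] by (simp add: divide_inverse)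
    then have "(\<lambda>c. 1 / real c ^ 3) summable_on UNIV"
      by (subst summable_on_UNIV_nonneg_real_iff) auto
    then have "(\<lambda>c. 1 / real c ^ 3) summable_on {1..}"
      by (rule summable_on_subset_banach) auto
    then show "(\<lambda>c. real c * (1 / real c ^ 4)) summable_on {1..}"
      by (rule summable_on_cong[THEN iffD1, rotated]) (auto simp: field_simps power_numeral_reduce)
  qed auto
  have key: "key D \<in> ?S" if D: "D \<in> nontrivial_double_cosets" for D
    using rep(2)[OF D D] by (auto simp: key_def nat_less_iff)
  then have "key ` nontrivial_double_cosets \<subseteq> ?S" by blast
  with sS have *: "(\<lambda>(c, e). 1 / real c ^ 4) summable_on key ` nontrivial_double_cosets"
    by (rule summable_on_subset_banach)
  have "inj_on key nontrivial_double_cosets"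
  proof (rule inj_onI)
    fix D D' assume D: "D \<in> nontrivial_double_cosets" "D' \<in> nontrivial_double_cosets" "key D = key D'"
    note r = rep[OF D(1) D(1)] and r' = rep[OF D(2) D(2)]
    define c d c' d' where "c = v D $ 2 $ 1" "d = v D $ 2 $ 2" "c' = v D' $ 2 $ 1" "d' = v D' $ 2 $ 2"
    note cd = this
    have c: "c \<noteq> 0" "c' \<noteq> 0" using r r' by (auto simp: cd)
    have 1: "\<bar>c\<bar> = \<bar>c'\<bar>" and 2: "(sgn c * d) mod \<bar>c\<bar> = (sgn c' * d') mod \<bar>c'\<bar>"
      using D(3) c by (auto simp: key_def cd [symmetric] eq_nat_nat_iff)
    from 2 have "\<bar>c\<bar> dvd sgn c * d - sgn c' * d'" unfolding 1 using mod_eq_dvd_iff by blast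
    then obtain n where n: "sgn c * d - sgn c' * d' = \<bar>c\<bar> * n" unfolding dvd_def by blast
    \<comment> \<open>The relative sign of the two rows, as \<open>same_bottom_row\<close>
      requires.\<close>
    define e where "e = sgn c * sgn c'"
    have e: "e \<in> {1, - 1}" "c = e * c'" "d = e * (d' + c' * (n * 1))"
      using c 1 n by (auto simp: e_def sgn_if abs_if algebra_simps split: if_splits)
    have "same_bottom_row (v D) (v D' ** T_pow n)"
      unfolding same_bottom_row_def
      by (rule bexI[OF _ e(1)]) (use e(2,3) in \<open>auto simp: cd algebra_simps\<close>)
    then have "v D \<in> D'" using r r' by (auto simp: same_double_coset_def)
    then show "D = D'"
      using nontrivial_double_coset_rep(3)[OF D(2), of "v D"] r by simp
  qed
  then have "((\<lambda>(c, e). 1 / real c ^ 4) \<circ> key) summable_on nontrivial_double_cosets"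
    using * by (subst (asm) summable_on_reindex) auto
  then show ?thesis by (simp add: o_def key_def case_prod_unfold)
qed

section \<open>Fourier expansion of a sum over cosets\<close>

lemma has_sum_finite_sum:
  fixes f :: "'i \<Rightarrow> 'a \<Rightarrow> 'b::{comm_monoid_add, topological_comm_monoid_add}"
  assumes "\<And>i. i \<in> R \<Longrightarrow> (f i has_sum s i) A"
  shows "((\<lambda>x. \<Sum>i\<in>R. f i x) has_sum (\<Sum>i\<in>R. s i)) A"
  using assms by (induction R rule: infinite_finite_induct) (auto intro!: has_sum_add)

lemma summable_on_finite_sum:
  fixes f :: "'i \<Rightarrow> 'a \<Rightarrow> 'b::{comm_monoid_add, topological_comm_monoid_add}"
  assumes "\<And>i. i \<in> R \<Longrightarrow> f i summable_on A"
  shows "(\<lambda>x. \<Sum>i\<in>R. f i x) summable_on A"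
proof -
  have "\<forall>i. \<exists>s. i \<in> R \<longrightarrow> (f i has_sum s) A" using assms by (auto simp: summable_on_def)
  then obtain s where "\<And>i. i \<in> R \<Longrightarrow> (f i has_sum s i) A" by metis
  then have "((\<lambda>x. \<Sum>i\<in>R. f i x) has_sum (\<Sum>i\<in>R. s i)) A"
    by (rule has_sum_finite_sum)
  then show ?thesis by (rule has_sum_imp_summable)
qed

lemma summable_norm_power_times_geometric:
  fixes q :: complex
  assumes "norm q < 1"
  shows "summable (\<lambda>n. norm (of_nat n ^ j * q ^ n))"
proof -
  have "summable (\<lambda>n. complex_of_nat n ^ j * of_real (norm q) ^ n)"
    using assms by (intro summable_power_times_geometric) auto
  also have "(\<lambda>n. complex_of_nat n ^ j * of_real (norm q) ^ n) =
      (\<lambda>n. of_real (norm (complex_of_nat n ^ j * q ^ n)))"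
    by (simp add: norm_mult norm_power)
  finally show ?thesis by (simp only: summable_of_real_iff)
qed

text \<open>For j > 0 the term n = 0 vanishes, so the sum may start at 1 as in a Fourier expansion
  without constant term.\<close>

lemma qseries_has_sum:
  assumes "Im z > 0" "j > 0"
  shows "((\<lambda>n. of_nat n ^ j * ee (of_nat n * z)) has_sum qseries j (ee z)) {1..}"
proof -
  have n: "norm (ee z) < 1" using norm_ee_less_1[OF assms(1)] .
  have "summable (\<lambda>n. norm (complex_of_nat n ^ j * ee z ^ n))"
    using summable_norm_power_times_geometric[OF n] .
  moreover have "(\<lambda>n. of_nat n ^ j * ee z ^ n) sums qseries j (ee z)"
    unfolding qseries_def using summable_power_times_geometric[OF n] by (rule summable_sums)
  ultimately have s: "((\<lambda>n. of_nat n ^ j * ee z ^ n) has_sum qseries j (ee z)) UNIV"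
    by (rule norm_summable_imp_has_sum)
  have "((\<lambda>n. of_nat n ^ j * ee z ^ n) has_sum qseries j (ee z)) {1..}"
    by (rule has_sum_cong_neutral[THEN iffD1, OF _ _ _ s]) (use assms in \<open>auto simp: not_le\<close>)
  then show ?thesis by (simp only: ee_of_nat_mult)
qed

text \<open>This is -\<gamma>^-1(\<infinity>). Being real, it moves \<tau> along a horizontal line
  and gives \<open>ee (of_nat n * row_ratio \<gamma>)\<close> norm 1.\<close>

definition row_ratio :: "int^2^2 \<Rightarrow> complex" where
  "row_ratio \<gamma> = of_int (\<gamma> $ 2 $ 2) / of_int (\<gamma> $ 2 $ 1)"

lemma Im_row_ratio [simp]: "Im (row_ratio \<gamma>) = 0"
  by (simp add: row_ratio_def Im_divide)

text \<open>The contribution of one double coset to the n-th Fourier coefficient: Lipschitz's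
  formula applied to each A_i w^-K summed over m, with the factor
  \<open>ee (of_nat n * \<tau>)\<close> removed.\<close>

definition Fourier_term ::
    "'i set \<Rightarrow> ('i \<Rightarrow> int^2^2 \<Rightarrow> complex) \<Rightarrow> ('i \<Rightarrow> nat) \<Rightarrow> nat \<Rightarrow> int^2^2 \<Rightarrow> complex" where
  "Fourier_term R A K n \<gamma> = ee (of_nat n * row_ratio \<gamma>) *
     (\<Sum>i\<in>R. A i \<gamma> * ((- 2 * of_real pi * \<i>) ^ K i / fact (K i - 1) * of_nat n ^ (K i - 1)))"

text \<open>The analytic core shared by both series. Two double sums converge absolutely, over pairs
  (D, m) on the coset side and over pairs (D, n) on the Fourier side. For each fixed D their inner
  sums agree by the Lipschitz formula.\<close>

theorem rcoset_sum_Fourier_expansion: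
  fixes f :: "int^2^2 \<Rightarrow> complex"
  assumes \<tau>: "Im \<tau> > 0" and R: "finite R" and K: "\<And>i. i \<in> R \<Longrightarrow> K i \<ge> 2"
    and u: "\<And>C. C \<in> rcosets\<^bsub>SL2Z\<^esub> Gamma_inf \<Longrightarrow> u C \<in> C"
    and v: "\<And>D. D \<in> nontrivial_double_cosets \<Longrightarrow> v D \<in> D"
    and f_left: "\<And>t \<gamma>. t \<in> Gamma_inf \<Longrightarrow> \<gamma> \<in> carrier SL2Z \<Longrightarrow> f (t ** \<gamma>) = f \<gamma>"
    and f_zero: "\<And>\<gamma>. \<gamma> \<in> Gamma_inf \<Longrightarrow> f \<gamma> = 0"
    and f_right: "\<And>\<gamma> m. \<gamma> \<in> carrier SL2Z \<Longrightarrow> \<gamma> $ 2 $ 1 \<noteq> 0 \<Longrightarrow>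
      f (\<gamma> ** T_pow m) = (\<Sum>i\<in>R. A i \<gamma> / (\<tau> + row_ratio \<gamma> + of_int m) ^ K i)"
    and A_bound: "\<And>i \<gamma>. i \<in> R \<Longrightarrow> \<gamma> \<in> carrier SL2Z \<Longrightarrow> \<gamma> $ 2 $ 1 \<noteq> 0 \<Longrightarrow>
      norm (A i \<gamma>) \<le> B / \<bar>real_of_int (\<gamma> $ 2 $ 1)\<bar> ^ 4"
  shows "(\<lambda>C. f (u C)) summable_on rcosets\<^bsub>SL2Z\<^esub> Gamma_inf"
    and "n \<ge> 1 \<Longrightarrow> (\<lambda>D. Fourier_term R A K n (v D)) summable_on nontrivial_double_cosets"
    and "(\<lambda>n. (\<Sum>\<^sub>\<infinity>D\<in>nontrivial_double_cosets. Fourier_term R A K n (v D)) * ee (of_nat n * \<tau>))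
      summable_on {1..}"
    and "(\<Sum>\<^sub>\<infinity>C\<in>rcosets\<^bsub>SL2Z\<^esub> Gamma_inf. f (u C)) =
      (\<Sum>\<^sub>\<infinity>n\<in>{1..}. (\<Sum>\<^sub>\<infinity>D\<in>nontrivial_double_cosets. Fourier_term R A K n (v D)) * ee (of_nat n * \<tau>))"
proof -
  let ?N = nontrivial_double_cosets and ?C = "rcosets\<^bsub>SL2Z\<^esub> Gamma_inf"
  let ?a = "\<lambda>D. B / \<bar>real_of_int (v D $ 2 $ 1)\<bar> ^ 4"
  define h where "h = (\<lambda>i D m. A i (v D) / (\<tau> + row_ratio (v D) + of_int m) ^ K i)"
  define \<kappa> where "\<kappa> = (\<lambda>i. (- 2 * of_real pi * \<i>) ^ K i / fact (K i - 1) :: complex)"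
  note rep = nontrivial_double_coset_rep[OF _ v]
  have A: "norm (A i (v D)) \<le> ?a D" if "i \<in> R" "D \<in> ?N" for i D
    using A_bound[OF that(1), of "v D"] rep[OF that(2) that(2)] by simp
  have a_sum: "?a summable_on ?N"
    using summable_on_cmult_right[OF summable_on_nontrivial_double_cosets[of v, OF v], of B] by simp
  \<comment> \<open>B carries no sign assumption; its nonnegativity is read off from the bound on
    some A_i, which requires an index in R.\<close>
  have a_nonneg: "?a D \<ge> 0" if "D \<in> ?N" "R \<noteq> {}" for D
    using A[OF _ that(1)] that(2) by (meson all_not_in_conv norm_ge_zero order_trans)

  \<comment> \<open>The points \<tau> + d/c all have the same imaginary part, so one constant M
    bounds every inner sum over m, and only the summable family \<open>?a\<close> depends on
    D.\<close>
  have h_abs: "(\<lambda>p. norm (case p of (D, m) \<Rightarrow> h i D m)) summable_on ?N \<times> UNIV" if i: "i \<in> R" for i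
  proof -
    obtain M where M: "\<And>z. Im z = Im \<tau> \<Longrightarrow> (\<lambda>m::int. norm (1 / (z + of_int m) ^ K i)) summable_on UNIV"
      "\<And>z. Im z = Im \<tau> \<Longrightarrow> (\<Sum>\<^sub>\<infinity>m::int. norm (1 / (z + of_int m) ^ K i)) \<le> M"
      using lattice_line_sum_bounded[OF \<tau> K[OF i]] by blast
    let ?l = "\<lambda>D m. norm (1 / (\<tau> + row_ratio (v D) + of_int m) ^ K i)"
    have h: "norm (h i D m) = norm (A i (v D)) * ?l D m" for D and m :: int
      by (simp add: h_def norm_divide)
    have l: "?l D summable_on UNIV" "infsum (?l D) UNIV \<le> M" for D
      using M[of "\<tau> + row_ratio (v D)"] by auto
    have "(\<lambda>D. norm (\<Sum>\<^sub>\<infinity>m. norm (h i D m))) summable_on ?N"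
    proof (rule Infinite_Sum.abs_summable_on_comparison_test'[OF summable_on_cmult_right[OF a_sum, of M]])
      fix D assume D: "D \<in> ?N"
      have "norm (\<Sum>\<^sub>\<infinity>m. norm (h i D m)) = norm (A i (v D)) * infsum (?l D) UNIV"
        unfolding h by (subst infsum_cmult_right') (simp add: infsum_nonneg abs_mult)
      also have "\<dots> \<le> ?a D * M"
        using l[of D] A[OF i D] infsum_nonneg[of UNIV "?l D"] a_nonneg[OF D] i
        by (intro mult_mono) auto
      finally show "norm (\<Sum>\<^sub>\<infinity>m. norm (h i D m)) \<le> M * ?a D" by (simp add: mult.commute)
    qed
    moreover have "(\<lambda>m. norm (h i D m)) summable_on UNIV" for D
      unfolding h by (intro summable_on_cmult_right l)
    ultimately show ?thesis by (subst Infinite_Sum.abs_summable_on_Sigma_iff) simp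
  qed
  define F where "F = (\<lambda>(D, m). \<Sum>i\<in>R. h i D m)"
  have F_sum: "F summable_on ?N \<times> UNIV"
    unfolding F_def case_prod_unfold
    using abs_summable_summable[OF h_abs] by (intro summable_on_finite_sum) (simp add: case_prod_unfold)

  have reindex: "((\<lambda>C. f (u C)) has_sum S) ?C \<longleftrightarrow> (F has_sum S) (?N \<times> UNIV)" for S
  proof -
    \<comment> \<open>The chosen element u of the coset differs from v(D) T^m by a stabilizer
      element on the left, which \<open>f_left\<close> removes.\<close>
    have F: "f (u (case p of (D, m) \<Rightarrow> Gamma_inf #>\<^bsub>SL2Z\<^esub> (v D ** T_pow m))) = F p" if p: "p \<in> ?N \<times> UNIV" for p
    proof -
      obtain D m where Dm: "p = (D, m)" "D \<in> ?N" using p by auto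
      let ?g = "v D ** T_pow m"
      have g: "?g \<in> carrier SL2Z" using rep[OF Dm(2) Dm(2)] by (simp add: SL2Z_closed)
      then have "Gamma_inf #>\<^bsub>SL2Z\<^esub> ?g \<in> ?C" by (auto simp: RCOSETS_def)
      from u[OF this] obtain t where "t \<in> Gamma_inf" "u (Gamma_inf #>\<^bsub>SL2Z\<^esub> ?g) = t ** ?g"
        by (auto simp: r_coset_def)
      then have "f (u (Gamma_inf #>\<^bsub>SL2Z\<^esub> ?g)) = f ?g" using f_left g by simp
      also have "\<dots> = F p" using f_right rep[OF Dm(2) Dm(2)] by (simp add: F_def h_def Dm)
      finally show ?thesis by (simp add: Dm)
    qed
    have "((\<lambda>C. f (u C)) has_sum S) ?C \<longleftrightarrow> ((\<lambda>C. f (u C)) has_sum S) (?C - {Gamma_inf})"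
      using u[OF Gamma_inf_in_rcosets] f_zero by (intro has_sum_cong_neutral) auto
    also have "\<dots> \<longleftrightarrow> ((\<lambda>p. f (u (case p of (D, m) \<Rightarrow> Gamma_inf #>\<^bsub>SL2Z\<^esub> (v D ** T_pow m)))) has_sum S) (?N \<times> UNIV)"
      by (rule has_sum_reindex_bij_betw[OF bij_betw_double_cosets_rcosets[of v, OF v], symmetric])
    also have "\<dots> \<longleftrightarrow> (F has_sum S) (?N \<times> UNIV)"
      by (rule has_sum_cong) (use F in auto)
    finally show ?thesis .
  qed
  show "(\<lambda>C. f (u C)) summable_on ?C"
    using F_sum reindex by (auto simp: summable_on_def)

  define G where "G = (\<lambda>D n. Fourier_term R A K n (v D) * ee (of_nat n * \<tau>))"
  have G_eq: "G D n = (\<Sum>i\<in>R. A i (v D) * \<kappa> i * (of_nat n ^ (K i - 1) * ee (of_nat n * (\<tau> + row_ratio (v D)))))" for D n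
    by (simp add: G_def Fourier_term_def \<kappa>_def distrib_left ee_add sum_distrib_left sum_distrib_right mult_ac)
  have G_sums: "((\<lambda>n. G D n) has_sum (\<Sum>\<^sub>\<infinity>m. F (D, m))) {1..}" if D: "D \<in> ?N" for D
  proof -
    let ?z = "\<tau> + row_ratio (v D)"
    have "((\<lambda>n. G D n) has_sum (\<Sum>i\<in>R. A i (v D) * \<kappa> i * qseries (K i - 1) (ee ?z))) {1..}"
      unfolding G_eq
    proof (intro has_sum_finite_sum has_sum_cmult_right qseries_has_sum)
      fix i assume "i \<in> R"
      from K[OF this] show "0 < K i - 1" by simp
    qed (use \<tau> in simp)
    moreover have "((\<lambda>m. F (D, m)) has_sum (\<Sum>i\<in>R. A i (v D) * (\<kappa> i * qseries (K i - 1) (ee ?z)))) UNIV"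
    proof -
      have "((\<lambda>m. A i (v D) * (1 / (?z + of_int m) ^ K i)) has_sum (A i (v D) * (\<kappa> i * qseries (K i - 1) (ee ?z)))) UNIV"
        if "i \<in> R" for i
        unfolding \<kappa>_def using \<tau> K[OF that] by (intro has_sum_cmult_right Lipschitz_formula) auto
      then show ?thesis unfolding F_def h_def split by (intro has_sum_finite_sum) simp
    qed
    ultimately show ?thesis by (simp add: infsumI mult.assoc)
  qed
  have G_abs: "(\<lambda>p. norm (case p of (D, n) \<Rightarrow> G D n)) summable_on ?N \<times> {1..}"
  proof -
    have "(\<lambda>p. norm (case p of (D, n) \<Rightarrow> A i (v D) * \<kappa> i * (of_nat n ^ (K i - 1) * ee (of_nat n * (\<tau> + row_ratio (v D))))))
        summable_on ?N \<times> {1..}" if i: "i \<in> R" for i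
    proof -
      \<comment> \<open>Because d/c is real, the size of the n-th exponential does not depend on D,
        and the majorant is a product of a function of D and a function of n.\<close>
      let ?b = "\<lambda>n. norm (\<kappa> i) * (real n ^ (K i - 1) * norm (ee \<tau>) ^ n)"
      have b: "((\<lambda>n. ?a D * ?b n) has_sum (?a D * infsum ?b {1..})) {1..}" for D
      proof (intro has_sum_cmult_right has_sum_infsum summable_on_cmult_right)
        have "summable (\<lambda>n. real n ^ (K i - 1) * norm (ee \<tau>) ^ n)"
          using summable_norm_power_times_geometric[OF norm_ee_less_1[OF \<tau>], of "K i - 1"]
          by (simp add: norm_mult norm_power)
        then have "(\<lambda>n. real n ^ (K i - 1) * norm (ee \<tau>) ^ n) summable_on UNIV"
          by (subst summable_on_UNIV_nonneg_real_iff) auto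
        then show "(\<lambda>n. real n ^ (K i - 1) * norm (ee \<tau>) ^ n) summable_on {1..}"
          by (rule summable_on_subset_banach) auto
      qed
      have "(\<lambda>(D, n). ?a D * ?b n) summable_on ?N \<times> {1..}"
      proof (rule summable_on_SigmaI[where g = "\<lambda>D. ?a D * infsum ?b {1..}"])
        show "(\<lambda>D. ?a D * infsum ?b {1..}) summable_on ?N"
          by (rule summable_on_cmult_left[OF a_sum])
        show "0 \<le> (case (D, n) of (D, n) \<Rightarrow> ?a D * ?b n)" if "D \<in> ?N" for D n
          unfolding split using a_nonneg[OF that] i by (intro mult_nonneg_nonneg) auto
      qed (use b in simp)
      moreover have "norm (A i (v D) * \<kappa> i * (of_nat n ^ (K i - 1) * ee (of_nat n * (\<tau> + row_ratio (v D))))) \<le> ?a D * ?b n"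
        if D: "D \<in> ?N" for D n
      proof -
        have "norm (ee (of_nat n * (\<tau> + row_ratio (v D)))) = norm (ee \<tau>) ^ n"
          by (simp add: norm_ee exp_of_nat_mult [symmetric] mult_ac)
        then have "norm (A i (v D) * \<kappa> i * (of_nat n ^ (K i - 1) * ee (of_nat n * (\<tau> + row_ratio (v D))))) =
            norm (A i (v D)) * ?b n"
          by (simp add: norm_mult norm_power mult.assoc)
        also have "\<dots> \<le> ?a D * ?b n"
          using A[OF i D] by (intro mult_right_mono mult_nonneg_nonneg) auto
        finally show ?thesis .
      qed
      ultimately show ?thesis
        by (intro Infinite_Sum.abs_summable_on_comparison_test'[of "\<lambda>(D, n). ?a D * ?b n"]) auto
    qed
    then have *: "(\<lambda>p. \<Sum>i\<in>R. norm (case p of (D, n) \<Rightarrow> A i (v D) * \<kappa> i * (of_nat n ^ (K i - 1) * ee (of_nat n * (\<tau> + row_ratio (v D))))))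
        summable_on ?N \<times> {1..}"
      by (rule summable_on_finite_sum)
    show ?thesis
      by (rule Infinite_Sum.abs_summable_on_comparison_test'[OF *]) (auto simp: G_eq intro!: norm_sum)
  qed
  then have G_sum: "(\<lambda>(D, n). G D n) summable_on ?N \<times> {1..}"
    by (rule abs_summable_summable)
  then have G_swap: "(\<lambda>(n, D). G D n) summable_on {1..} \<times> ?N"
    by (subst (asm) summable_on_swap) (simp add: case_prod_unfold)
  have G_D: "(\<lambda>D. G D n) summable_on ?N" if "n \<ge> 1" for n
    using summable_on_SigmaD1[OF G_swap, of n] that by simp
  have "(\<lambda>D. Fourier_term R A K n (v D)) summable_on ?N" if "n \<ge> 1" for n
    using summable_on_cmult_left[OF G_D[OF that], of "inverse (ee (of_nat n * \<tau>))"]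
    by (simp add: G_def mult.assoc ee_def)
  then show "n \<ge> 1 \<Longrightarrow> (\<lambda>D. Fourier_term R A K n (v D)) summable_on ?N" .
  have G_inf: "(\<Sum>\<^sub>\<infinity>D\<in>?N. G D n) = (\<Sum>\<^sub>\<infinity>D\<in>?N. Fourier_term R A K n (v D)) * ee (of_nat n * \<tau>)" for n
    unfolding G_def by (rule infsum_cmult_left')
  have "(\<lambda>n. \<Sum>\<^sub>\<infinity>D\<in>?N. G D n) summable_on {1..}"
    using summable_on_Sigma_banach[OF G_swap] by simp
  then show "(\<lambda>n. (\<Sum>\<^sub>\<infinity>D\<in>?N. Fourier_term R A K n (v D)) * ee (of_nat n * \<tau>)) summable_on {1..}"
    by (simp add: G_inf)
  have "(\<Sum>\<^sub>\<infinity>C\<in>?C. f (u C)) = infsum F (?N \<times> UNIV)"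
    using F_sum reindex by (intro infsumI) auto
  also have "\<dots> = (\<Sum>\<^sub>\<infinity>D\<in>?N. \<Sum>\<^sub>\<infinity>m. F (D, m))"
    by (rule infsum_Sigma_banach[OF F_sum, symmetric])
  also have "\<dots> = (\<Sum>\<^sub>\<infinity>D\<in>?N. \<Sum>\<^sub>\<infinity>n\<in>{1..}. G D n)"
    by (intro infsum_cong infsumI[OF G_sums, symmetric])
  also have "\<dots> = (\<Sum>\<^sub>\<infinity>n\<in>{1..}. \<Sum>\<^sub>\<infinity>D\<in>?N. G D n)"
    by (rule infsum_swap_banach[OF G_sum])
  finally show "(\<Sum>\<^sub>\<infinity>C\<in>?C. f (u C)) =
      (\<Sum>\<^sub>\<infinity>n\<in>{1..}. (\<Sum>\<^sub>\<infinity>D\<in>?N. Fourier_term R A K n (v D)) * ee (of_nat n * \<tau>))"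
    by (simp add: G_inf)
qed

section \<open>Growth of parabolic cocycles\<close>

text \<open>Multiplying p - q by the nonzero linear polynomial a X + b covers the excluded point, so
  the product vanishes everywhere and hence is the zero polynomial.\<close>

lemma poly_eqI_away_from_root:
  fixes p q :: "'a::{idom, ring_char_0} poly"
  assumes "a \<noteq> 0 \<or> b \<noteq> 0" and eq: "\<And>x. a * x + b \<noteq> 0 \<Longrightarrow> poly p x = poly q x"
  shows "p = q"
proof -
  have "poly ((p - q) * [:b, a:]) x = poly 0 x" for x
  proof -
    have "poly ((p - q) * [:b, a:]) x = (poly p x - poly q x) * (a * x + b)"
      by (simp add: algebra_simps)
    also have "\<dots> = 0" using eq[of x] by (cases "a * x + b = 0") auto
    finally show ?thesis by simp
  qed
  then have "(p - q) * [:b, a:] = 0" by (intro poly_eq_poly_eq_iff[THEN iffD1]) auto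
  moreover have "[:b, a:] \<noteq> 0" using assms(1) by auto
  ultimately have "p - q = 0" by (metis mult_eq_0_iff)
  then show ?thesis by simp
qed

lemma poly_sym_inv:
  assumes "\<gamma> \<in> carrier SL2Z" "degree p \<le> d" "of_int (\<gamma> $ 2 $ 1) * x + of_int (\<gamma> $ 2 $ 2) \<noteq> 0"
  shows "poly (sym_inv d \<gamma> p) x =
    (of_int (\<gamma> $ 2 $ 1) * x + of_int (\<gamma> $ 2 $ 2)) ^ d * poly p (moebius_act \<gamma> x)"
  using poly_sym_rep_inv[of \<gamma> p d x] assms by (simp add: sym_rep_def sym_space_def)

text \<open>Allows computing with the fractional form of the action, which makes sense only away
  from the zero of c X + d.\<close>

lemma sym_inv_eqI:
  assumes \<gamma>: "\<gamma> \<in> carrier SL2Z" and "degree p \<le> d"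
    and eq: "\<And>x. of_int (\<gamma> $ 2 $ 1) * x + of_int (\<gamma> $ 2 $ 2) \<noteq> 0 \<Longrightarrow>
      (of_int (\<gamma> $ 2 $ 1) * x + of_int (\<gamma> $ 2 $ 2)) ^ d * poly p (moebius_act \<gamma> x) = poly q x"
  shows "sym_inv d \<gamma> p = q"
proof (rule poly_eqI_away_from_root)
  show "complex_of_int (\<gamma> $ 2 $ 1) \<noteq> 0 \<or> complex_of_int (\<gamma> $ 2 $ 2) \<noteq> 0"
    using \<gamma> by (auto simp: carrier_SL2Z_iff)
qed (use assms poly_sym_inv in simp)

lemma sym_inv_T_pow:
  assumes "degree p \<le> d"
  shows "sym_inv d (T_pow m) p = pcompose p [:of_int m, 1:]"
  by (rule sym_inv_eqI) (simp_all add: assms moebius_act_def poly_pcompose add.commute)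

lemma degree_linear_power_le: "degree ([:a, b:] ^ n) \<le> n"
proof -
  have "degree ([:a, b:] ^ n) \<le> degree [:a, b:] * n" by (rule degree_power_le)
  also have "\<dots> \<le> 1 * n" by (intro mult_right_mono) auto
  finally show ?thesis by simp
qed

lemma degree_linear_powers_le: "degree ([:a, b:] ^ m * [:a', b':] ^ n) \<le> m + n"
  using degree_mult_le[of "[:a, b:] ^ m" "[:a', b':] ^ n"] degree_linear_power_le[of a b m]
    degree_linear_power_le[of a' b' n] by simp

lemma sym_inv_in_sym_space: "sym_inv d \<gamma> p \<in> sym_space d"
proof -
  have "degree ([:a, b:] ^ i * [:a', b':] ^ (d - i)) \<le> d" if "i \<le> d" for a b a' b' :: complex and i
    using degree_linear_powers_le[of a b i a' b' "d - i"] that by simp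
  then show ?thesis
    unfolding sym_space_def sym_inv_def mem_Collect_eq
    by (intro degree_sum_le) (auto intro: order_trans[OF degree_smult_le])
qed

lemma sym_inv_0 [simp]: "sym_inv d \<gamma> 0 = 0"
  by (simp add: sym_inv_def)

lemma sym_rep_0 [simp]: "sym_rep d \<gamma> 0 = 0"
  by (simp add: sym_rep_def)

section \<open>Coefficient bounds for products of linear factors\<close>

lemma norm_coeff_linear_mult_le:
  fixes p :: "complex poly"
  assumes "norm a \<le> N" "norm b \<le> N" "\<And>n. norm (coeff p n) \<le> B"
  shows "norm (coeff ([:a, b:] * p) n) \<le> 2 * N * B"
proof -
  have *: "norm (x * coeff p i) \<le> N * B" if "norm x \<le> N" for x i
    unfolding norm_mult using that assms(3)[of i] by (meson mult_mono norm_ge_zero order_trans)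
  have "coeff ([:a, b:] * p) n = a * coeff p n + (case n of 0 \<Rightarrow> 0 | Suc m \<Rightarrow> b * coeff p m)"
    by (cases n) auto
  also have "norm \<dots> \<le> N * B + N * B"
    using *[OF assms(1), of n] *[OF assms(2)] *[OF assms(2), THEN order_trans[OF norm_ge_zero]]
    by (intro norm_triangle_mono) (auto split: nat.split)
  finally show ?thesis by (simp only: mult_2 distrib_right)
qed

lemma norm_coeff_linear_power_mult_le:
  fixes p :: "complex poly"
  assumes "norm a \<le> N" "norm b \<le> N" "\<And>n. norm (coeff p n) \<le> B"
  shows "norm (coeff ([:a, b:] ^ i * p) n) \<le> (2 * N) ^ i * B"
proof (induction i arbitrary: n)
  case 0
  then show ?case using assms(3) by simp
next
  case (Suc i)
  have "norm (coeff ([:a, b:] * ([:a, b:] ^ i * p)) n) \<le> 2 * N * ((2 * N) ^ i * B)"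
    by (rule norm_coeff_linear_mult_le[OF assms(1,2) Suc.IH])
  then show ?case by (simp only: mult.assoc power_Suc)
qed

lemma norm_coeff_linear_power_le:
  assumes "norm (a::complex) \<le> N" "norm b \<le> N"
  shows "norm (coeff ([:a, b:] ^ i) n) \<le> (2 * N) ^ i"
  using norm_coeff_linear_power_mult_le[OF assms, of 1 1 i n] by (simp add: one_pCons coeff_pCons split: nat.split)

text \<open>Each basis polynomial X^i is sent to a product of d linear factors with coefficients at
  most N, and each factor enlarges the maximal coefficient by at most 2N.\<close>

lemma norm_coeff_sym_inv_le:
  assumes "\<And>i l. \<bar>real_of_int (\<gamma> $ i $ l)\<bar> \<le> N"
  shows "norm (coeff (sym_inv d \<gamma> p) n) \<le> (\<Sum>i\<le>d. norm (coeff p i)) * (2 * N) ^ d"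
proof -
  have N: "norm (complex_of_int (\<gamma> $ i $ l)) \<le> N" for i l using assms by simp
  have "norm (coeff (sym_inv d \<gamma> p) n) \<le> (\<Sum>i\<le>d. norm (coeff p i) * (2 * N) ^ d)"
    unfolding sym_inv_def coeff_sum
  proof (rule order_trans[OF norm_sum sum_mono])
    fix i assume "i \<in> {..d}"
    then have "(2 * N) ^ d = (2 * N) ^ i * (2 * N) ^ (d - i)"
      by (simp only: power_add [symmetric] le_add_diff_inverse atMost_iff)
    then show "norm (coeff (smult (coeff p i) ([:of_int (\<gamma>$1$2), of_int (\<gamma>$1$1):] ^ i *
        [:of_int (\<gamma>$2$2), of_int (\<gamma>$2$1):] ^ (d - i))) n) \<le> norm (coeff p i) * (2 * N) ^ d"
      unfolding coeff_smult norm_mult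
      using norm_coeff_linear_power_mult_le[OF N N norm_coeff_linear_power_le[OF N N]]
      by (intro mult_left_mono) auto
  qed
  then show ?thesis by (simp add: sum_distrib_right)
qed

definition S_mat :: "int^2^2" where
  "S_mat = vector [vector [0, - 1], vector [1, 0]]"

lemma S_mat_nth [simp]:
  "S_mat $ 1 $ 1 = 0" "S_mat $ 1 $ 2 = - 1" "S_mat $ 2 $ 1 = 1" "S_mat $ 2 $ 2 = 0"
  by (simp_all add: S_mat_def)

lemma S_mat_carrier [simp]: "S_mat \<in> carrier SL2Z"
  by (simp add: carrier_SL2Z_iff)

text \<open>
  The Euclidean algorithm on the first column: right multiplication by a power of \<open>T\<close> makes the
  lower right entry smaller than the lower left one, and \<open>S\<close> then exchanges the columns. All
  matrices on the way have entries bounded by those of the first column.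
\<close>

lemma polynomial_growth:
  fixes F :: "int^2^2 \<Rightarrow> real" and C N :: real
  assumes C: "C \<ge> 0"
    and F_zero: "\<And>\<gamma>. \<gamma> \<in> Gamma_inf \<Longrightarrow> F \<gamma> = 0"
    and F_T: "\<And>\<gamma> m. \<gamma> \<in> carrier SL2Z \<Longrightarrow> F (\<gamma> ** T_pow m) = F \<gamma>"
    and F_S: "\<And>\<gamma>. \<gamma> \<in> carrier SL2Z \<Longrightarrow> (\<And>i l. \<bar>real_of_int (\<gamma> $ i $ l)\<bar> \<le> N) \<Longrightarrow>
      F (\<gamma> ** S_mat) \<le> F \<gamma> + C * N ^ d"
    and "\<gamma> \<in> carrier SL2Z" "\<bar>real_of_int (\<gamma> $ 1 $ 1)\<bar> \<le> N" "\<bar>real_of_int (\<gamma> $ 2 $ 1)\<bar> \<le> N"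
  shows "F \<gamma> \<le> C * \<bar>real_of_int (\<gamma> $ 2 $ 1)\<bar> * N ^ d"
  using assms(5-7)
proof (induction "nat \<bar>\<gamma> $ 2 $ 1\<bar>" arbitrary: \<gamma> rule: less_induct)
  case less
  define p q where "p = \<gamma> $ 1 $ 1" and "q = \<gamma> $ 2 $ 1"
  show ?case
  proof (cases "q = 0")
    case True
    then have "\<gamma> \<in> Gamma_inf" using less.prems by (simp add: Gamma_inf_iff q_def)
    then show ?thesis using True F_zero by (simp add: q_def)
  next
    case False
    \<comment> \<open>The residue modulo |q| is nonnegative whatever the sign of q, and it becomes,
      up to sign, the lower left entry of the next matrix.\<close>
    define s where "s = (\<gamma> $ 2 $ 2) mod \<bar>q\<bar>"
    have s: "0 \<le> s" "s < \<bar>q\<bar>" using False by (auto simp: s_def)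
    have "\<bar>q\<bar> dvd s - \<gamma> $ 2 $ 2" unfolding s_def by (metis mod_eq_dvd_iff mod_mod_trivial)
    then have "q dvd s - \<gamma> $ 2 $ 2" by simp
    then obtain m where m: "s - \<gamma> $ 2 $ 2 = q * m" unfolding dvd_def by blast
    define r where "r = p * m + \<gamma> $ 1 $ 2"
    define \<delta> :: "int^2^2" where "\<delta> = vector [vector [- r, p], vector [- s, q]]"
    have \<delta>_nth: "\<delta> $ 1 $ 1 = - r" "\<delta> $ 1 $ 2 = p" "\<delta> $ 2 $ 1 = - s" "\<delta> $ 2 $ 2 = q"
      by (simp_all add: \<delta>_def)
    have eq: "\<gamma> ** T_pow m = \<delta> ** S_mat"
      using m by (simp add: matrix_eq_2x2 \<delta>_nth p_def q_def r_def algebra_simps)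
    have det: "p * s - r * q = 1"
    proof -
      have "\<gamma> ** T_pow m \<in> carrier SL2Z" using less.prems by (simp add: SL2Z_closed)
      then show ?thesis unfolding eq by (simp add: carrier_SL2Z_iff \<delta>_nth algebra_simps)
    qed
    then have \<delta>: "\<delta> \<in> carrier SL2Z" by (simp add: carrier_SL2Z_iff \<delta>_nth algebra_simps)
    \<comment> \<open>The new upper entry must stay below the fixed N. The determinant gives |r||q|
      \<le> |p|(|q| - 1) + 1 \<le> |p||q| for p \<noteq> 0, and p = 0 forces |r| = 1.\<close>
    have r: "\<bar>r\<bar> \<le> max \<bar>p\<bar> \<bar>q\<bar>"
    proof (cases "p = 0")
      case True
      then have "r dvd 1" using det by (metis dvdI minus_mult_minus mult_minus_right mult_zero_left diff_0)
      then show ?thesis using False by auto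
    next
      case p: False
      have "\<bar>r\<bar> * \<bar>q\<bar> = \<bar>p * s - 1\<bar>" using det by (simp flip: abs_mult add: algebra_simps)
      also have "\<dots> \<le> \<bar>p\<bar> * s + 1" using s by (simp add: abs_mult order_trans[OF abs_triangle_ineq4])
      also have "\<dots> \<le> \<bar>p\<bar> * (\<bar>q\<bar> - 1) + 1" using s by (simp add: mult_left_mono)
      also have "\<dots> \<le> \<bar>p\<bar> * \<bar>q\<bar>" using p by (simp add: algebra_simps)
      finally have "\<bar>r\<bar> \<le> \<bar>p\<bar>" using False by simp
      then show ?thesis by simp
    qed
    have N: "\<bar>real_of_int p\<bar> \<le> N" "\<bar>real_of_int q\<bar> \<le> N" using less.prems by (auto simp: p_def q_def)
    have rN: "\<bar>real_of_int r\<bar> \<le> N"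
    proof -
      have "real_of_int \<bar>r\<bar> \<le> real_of_int (max \<bar>p\<bar> \<bar>q\<bar>)" using r by (simp only: of_int_le_iff)
      then show ?thesis using N by (simp add: max_def split: if_splits)
    qed
    have sN: "\<bar>real_of_int s\<bar> \<le> N"
    proof -
      have "real_of_int s \<le> real_of_int \<bar>q\<bar>" using s by (simp only: of_int_le_iff)
      then show ?thesis using N s by simp
    qed
    have "\<bar>real_of_int (\<delta> $ i $ l)\<bar> \<le> N" for i l
      using exhaust_2[of i] exhaust_2[of l] N rN sN by (auto simp: \<delta>_nth)
    then have "F \<gamma> \<le> F \<delta> + C * N ^ d"
      using F_S[OF \<delta>] F_T[OF less.prems(1), of m] by (simp add: eq)
    also have "F \<delta> \<le> C * \<bar>real_of_int (\<delta> $ 2 $ 1)\<bar> * N ^ d"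
      by (rule less.hyps) (use \<delta> s rN sN in \<open>auto simp: \<delta>_nth q_def [symmetric]\<close>)
    \<comment> \<open>The induction hypothesis pays for s steps and the present one adds one more; s
      + 1 \<le> |q| closes the count.\<close>
    also have "C * \<bar>real_of_int (\<delta> $ 2 $ 1)\<bar> * N ^ d + C * N ^ d = (real_of_int s + 1) * (C * N ^ d)"
      using s by (simp add: \<delta>_nth algebra_simps)
    also have "\<dots> \<le> \<bar>real_of_int q\<bar> * (C * N ^ d)"
    proof (rule mult_right_mono)
      have "real_of_int (s + 1) \<le> real_of_int \<bar>q\<bar>" using s by (simp only: of_int_le_iff)
      then show "real_of_int s + 1 \<le> \<bar>real_of_int q\<bar>" by simp
      show "0 \<le> C * N ^ d" using C N by (intro mult_nonneg_nonneg zero_le_power) auto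
    qed
    finally show ?thesis by (simp add: q_def mult_ac)
  qed
qed

section \<open>Consequences of the cocycle relation and parabolicity\<close>

lemma parabolic_cocycle_mult:
  assumes "\<phi> \<in> parabolic_cocycles V \<rho>" "\<gamma> \<in> carrier SL2Z" "\<delta> \<in> carrier SL2Z"
  shows "\<phi> (\<gamma> ** \<delta>) = \<rho> \<gamma> (\<phi> \<delta>) + \<phi> \<gamma>"
  using assms by (auto simp: parabolic_cocycles_def cocycles_def)

lemma parabolic_cocycle_Gamma_inf:
  "\<phi> \<in> parabolic_cocycles V \<rho> \<Longrightarrow> \<gamma> \<in> Gamma_inf \<Longrightarrow> \<phi> \<gamma> = 0"
  by (simp add: parabolic_cocycles_def)

lemma parabolic_cocycle_in:
  "\<phi> \<in> parabolic_cocycles V \<rho> \<Longrightarrow> \<gamma> \<in> carrier SL2Z \<Longrightarrow> \<phi> \<gamma> \<in> V"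
  by (simp add: parabolic_cocycles_def cocycles_def)

lemma parabolic_cocycle_mult_Gamma_inf:
  assumes \<phi>: "\<phi> \<in> parabolic_cocycles V \<rho>" and "\<rho> \<gamma> 0 = 0" "\<gamma> \<in> carrier SL2Z" "t \<in> Gamma_inf"
  shows "\<phi> (\<gamma> ** t) = \<phi> \<gamma>"
  using parabolic_cocycle_mult[OF \<phi> assms(3) Gamma_inf_carrier[OF assms(4)]]
    parabolic_cocycle_Gamma_inf[OF \<phi> assms(4)] assms(2) by simp

lemma parabolic_cocycle_inv_Gamma_inf_mult:
  assumes \<phi>: "\<phi> \<in> parabolic_cocycles V \<rho>" and "\<rho> (inv\<^bsub>SL2Z\<^esub> \<gamma>) 0 = 0"
    and "\<gamma> \<in> carrier SL2Z" "t \<in> Gamma_inf"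
  shows "\<phi> (inv\<^bsub>SL2Z\<^esub> (t ** \<gamma>)) = \<phi> (inv\<^bsub>SL2Z\<^esub> \<gamma>)"
  using assms by (simp add: inv_SL2Z_mult Gamma_inf_carrier parabolic_cocycle_mult_Gamma_inf[OF \<phi>]
      SL2Z_closed inv_Gamma_inf)

text \<open>Inversion moves T^m to the left, where the inhomogeneous term of the cocycle relation is
  \<phi>(T^-m) = 0; only the linear action remains.\<close>

lemma parabolic_cocycle_inv_mult_T_pow:
  assumes \<phi>: "\<phi> \<in> parabolic_cocycles V \<rho>" and "\<gamma> \<in> carrier SL2Z"
  shows "\<phi> (inv\<^bsub>SL2Z\<^esub> (\<gamma> ** T_pow m)) = \<rho> (T_pow (- m)) (\<phi> (inv\<^bsub>SL2Z\<^esub> \<gamma>))"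
  using assms by (simp add: inv_SL2Z_mult parabolic_cocycle_mult[OF \<phi>] SL2Z_closed
      parabolic_cocycle_Gamma_inf[OF \<phi>])

text \<open>The increment \<phi>(\<gamma> S) - \<phi>(\<gamma>) is \<gamma> acting on the fixed
  vector \<phi>(S), so its coefficients are at most a constant times N^d. The 2^d in the constant
  comes from the factors 2N of the action.\<close>

lemma sym_cocycle_growth:
  assumes \<phi>: "\<phi> \<in> parabolic_cocycles (sym_space d) (sym_rep d)"
  obtains C :: real where "C \<ge> 0"
    "\<And>\<gamma> N n. \<gamma> \<in> carrier SL2Z \<Longrightarrow> \<bar>real_of_int (\<gamma> $ 1 $ 1)\<bar> \<le> N \<Longrightarrow> \<bar>real_of_int (\<gamma> $ 2 $ 1)\<bar> \<le> N \<Longrightarrow>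
      norm (coeff (\<phi> \<gamma>) n) \<le> C * \<bar>real_of_int (\<gamma> $ 2 $ 1)\<bar> * N ^ d"
proof
  let ?C = "2 ^ d * (\<Sum>i\<le>d. norm (coeff (\<phi> S_mat) i))"
  show C: "?C \<ge> 0" by (intro mult_nonneg_nonneg sum_nonneg) auto
  fix \<gamma> :: "int^2^2" and N :: real and n :: nat
  assume \<gamma>: "\<gamma> \<in> carrier SL2Z" "\<bar>real_of_int (\<gamma> $ 1 $ 1)\<bar> \<le> N" "\<bar>real_of_int (\<gamma> $ 2 $ 1)\<bar> \<le> N"
  show "norm (coeff (\<phi> \<gamma>) n) \<le> ?C * \<bar>real_of_int (\<gamma> $ 2 $ 1)\<bar> * N ^ d"
  proof (rule polynomial_growth[where F = "\<lambda>\<gamma>. norm (coeff (\<phi> \<gamma>) n)", OF C _ _ _ \<gamma>])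
    fix \<delta> :: "int^2^2" assume \<delta>: "\<delta> \<in> carrier SL2Z" and N: "\<And>i l. \<bar>real_of_int (\<delta> $ i $ l)\<bar> \<le> N"
    have "norm (coeff (sym_inv d (inv\<^bsub>SL2Z\<^esub> \<delta>) (\<phi> S_mat)) n) \<le> (\<Sum>i\<le>d. norm (coeff (\<phi> S_mat) i)) * (2 * N) ^ d"
    proof (rule norm_coeff_sym_inv_le)
      show "\<bar>real_of_int ((inv\<^bsub>SL2Z\<^esub> \<delta>) $ i $ l)\<bar> \<le> N" for i l
        using exhaust_2[of i] exhaust_2[of l] N \<delta> by auto
    qed
    also have "\<dots> = ?C * N ^ d" by (simp add: power_mult_distrib)
    finally show "norm (coeff (\<phi> (\<delta> ** S_mat)) n) \<le> norm (coeff (\<phi> \<delta>) n) + ?C * N ^ d"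
      using norm_triangle_ineq[of "coeff (sym_rep d \<delta> (\<phi> S_mat)) n" "coeff (\<phi> \<delta>) n"]
      by (simp add: parabolic_cocycle_mult[OF \<phi> \<delta>] sym_rep_def)
  qed (simp_all add: parabolic_cocycle_Gamma_inf[OF \<phi>] parabolic_cocycle_mult_Gamma_inf[OF \<phi>])
qed

section \<open>Linear functionals on polynomials of bounded degree\<close>

lemma dual_spaceD:
  assumes "L \<in> dual_space (sym_space d)"
  shows "degree p \<le> d \<Longrightarrow> degree q \<le> d \<Longrightarrow> L (p + q) = L p + L q"
    and "degree p \<le> d \<Longrightarrow> L (smult a p) = a * L p"
  using assms by (auto simp: dual_space_def sym_space_def)

lemma dual_space_sum:
  assumes L: "L \<in> dual_space (sym_space d)" and "finite I" "\<And>i. i \<in> I \<Longrightarrow> degree (p i) \<le> d"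
  shows "L (\<Sum>i\<in>I. smult (a i) (p i)) = (\<Sum>i\<in>I. a i * L (p i))"
  using assms(2,3)
proof (induction I)
  case empty
  have "L (smult 0 0) = 0 * L 0" by (rule dual_spaceD[OF L]) simp
  then show ?case by simp
next
  case (insert i I)
  have "degree (\<Sum>i\<in>I. smult (a i) (p i)) \<le> d"
    using insert by (intro degree_sum_le) (auto intro: order_trans[OF degree_smult_le])
  then show ?case
    using insert by (simp add: dual_spaceD[OF L] order_trans[OF degree_smult_le])
qed

lemma dual_space_expand:
  assumes L: "L \<in> dual_space (sym_space d)" and "degree p \<le> d"
  shows "L p = (\<Sum>i\<le>d. coeff p i * L (monom 1 i))"
proof -
  have "p = (\<Sum>i\<le>d. smult (coeff p i) (monom 1 i))"
    using poly_as_sum_of_monoms'[OF assms(2)] by (simp add: smult_monom)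
  then have "L p = L (\<Sum>i\<le>d. smult (coeff p i) (monom 1 i))" by simp
  also have "\<dots> = (\<Sum>i\<le>d. coeff p i * L (monom 1 i))"
    by (rule dual_space_sum[OF L]) (auto simp: degree_monom_eq)
  finally show ?thesis .
qed

lemma norm_dual_le:
  assumes L: "L \<in> dual_space (sym_space d)" and "degree p \<le> d" "\<And>i. norm (coeff p i) \<le> B"
  shows "norm (L p) \<le> B * (\<Sum>i\<le>d. norm (L (monom 1 i)))"
  unfolding dual_space_expand[OF L assms(2)] sum_distrib_left
  by (intro order_trans[OF norm_sum sum_mono]) (auto simp: norm_mult intro: mult_right_mono assms(3))

lemma dual_rep_0 [simp]: "dual_rep V \<rho> \<gamma> 0 = 0"
  by (simp add: dual_rep_def fun_eq_iff zero_fun_def)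

text \<open>A functional is measured by its values on monomials. The dual action of \<gamma> feeds
  the image of a monomial under \<gamma>^-1 into \<psi>(S), so the same Euclidean recursion
  applies.\<close>

lemma dual_cocycle_growth:
  assumes \<psi>: "\<psi> \<in> parabolic_cocycles (dual_space (sym_space d)) (dual_rep (sym_space d) (sym_rep d))"
  obtains C :: real where "C \<ge> 0"
    "\<And>\<gamma> N n. \<gamma> \<in> carrier SL2Z \<Longrightarrow> \<bar>real_of_int (\<gamma> $ 1 $ 1)\<bar> \<le> N \<Longrightarrow> \<bar>real_of_int (\<gamma> $ 2 $ 1)\<bar> \<le> N \<Longrightarrow>
      n \<le> d \<Longrightarrow> norm (\<psi> \<gamma> (monom 1 n)) \<le> C * \<bar>real_of_int (\<gamma> $ 2 $ 1)\<bar> * N ^ d"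
proof
  let ?C = "2 ^ d * (\<Sum>i\<le>d. norm (\<psi> S_mat (monom 1 i)))"
  show C: "?C \<ge> 0" by (intro mult_nonneg_nonneg sum_nonneg) auto
  fix \<gamma> :: "int^2^2" and N :: real and n :: nat
  assume \<gamma>: "\<gamma> \<in> carrier SL2Z" "\<bar>real_of_int (\<gamma> $ 1 $ 1)\<bar> \<le> N" "\<bar>real_of_int (\<gamma> $ 2 $ 1)\<bar> \<le> N" and n: "n \<le> d"
  show "norm (\<psi> \<gamma> (monom 1 n)) \<le> ?C * \<bar>real_of_int (\<gamma> $ 2 $ 1)\<bar> * N ^ d"
  proof (rule polynomial_growth[where F = "\<lambda>\<gamma>. norm (\<psi> \<gamma> (monom 1 n))", OF C _ _ _ \<gamma>])
    fix \<delta> :: "int^2^2" assume \<delta>: "\<delta> \<in> carrier SL2Z" and N: "\<And>i l. \<bar>real_of_int (\<delta> $ i $ l)\<bar> \<le> N"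
    let ?p = "sym_inv d \<delta> (monom 1 n)"
    have "norm (coeff ?p i) \<le> (2 * N) ^ d" for i
    proof -
      have "(\<Sum>i\<le>d. norm (coeff (monom (1::complex) n) i)) = 1"
        using n by (simp add: sum.delta if_distrib[of norm] cong: if_cong)
      then show ?thesis using norm_coeff_sym_inv_le[OF N, where d = d and p = "monom 1 n" and n = i] by simp
    qed
    moreover have "degree ?p \<le> d" using sym_inv_in_sym_space by (auto simp: sym_space_def)
    ultimately have "norm (\<psi> S_mat ?p) \<le> (2 * N) ^ d * (\<Sum>i\<le>d. norm (\<psi> S_mat (monom 1 i)))"
      by (intro norm_dual_le[OF parabolic_cocycle_in[OF \<psi>]]) auto
    also have "\<dots> = ?C * N ^ d" by (simp add: power_mult_distrib)
    finally have "norm (\<psi> S_mat ?p) \<le> ?C * N ^ d" .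
    moreover have "\<psi> (\<delta> ** S_mat) (monom 1 n) = \<psi> S_mat ?p + \<psi> \<delta> (monom 1 n)"
      using n \<delta> by (simp add: parabolic_cocycle_mult[OF \<psi> \<delta>] plus_fun_def dual_rep_def sym_rep_def
          sym_space_def degree_monom_eq)
    ultimately show "norm (\<psi> (\<delta> ** S_mat) (monom 1 n)) \<le> norm (\<psi> \<delta> (monom 1 n)) + ?C * N ^ d"
      using norm_triangle_ineq[of "\<psi> S_mat ?p" "\<psi> \<delta> (monom 1 n)"] by simp
  qed (simp_all add: parabolic_cocycle_Gamma_inf[OF \<psi>] parabolic_cocycle_mult_Gamma_inf[OF \<psi>])
qed

section \<open>Symmetric powers\<close>

lemma pcompose_monom: "pcompose (monom c n) q = smult c (q ^ n)"
  for c :: "'a::comm_semiring_1"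
  by (induction n) (simp_all add: monom_Suc pcompose_pCons monom_0 mult_smult_right)

lemma coeff_pcompose_shift:
  fixes q :: "'a::comm_ring_1 poly"
  assumes "degree q \<le> d"
  shows "coeff (pcompose q [:w, 1:]) r = (\<Sum>t=r..d. coeff q t * of_nat (t choose r) * w ^ (t - r))"
proof -
  have "pcompose q [:w, 1:] = (\<Sum>t\<le>d. smult (coeff q t) ([:w, 1:] ^ t))"
    by (subst poly_as_sum_of_monoms'[OF assms, symmetric]) (simp add: pcompose_sum pcompose_monom)
  then have "coeff (pcompose q [:w, 1:]) r = (\<Sum>t\<le>d. coeff q t * coeff ([:w, 1:] ^ t) r)"
    by (simp add: coeff_sum)
  also have "\<dots> = (\<Sum>t=r..d. coeff q t * coeff ([:w, 1:] ^ t) r)"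
  proof (rule sum.mono_neutral_right)
    show "\<forall>t\<in>{..d} - {r..d}. coeff q t * coeff ([:w, 1:] ^ t) r = 0"
    proof
      fix t assume "t \<in> {..d} - {r..d}"
      then have "degree ([:w, 1:] ^ t) < r"
        using le_less_trans[OF degree_power_le[of "[:w, 1:]" t], of r] by auto
      then show "coeff q t * coeff ([:w, 1:] ^ t) r = 0" by (simp add: coeff_eq_0)
    qed
  qed auto
  also have "\<dots> = (\<Sum>t=r..d. coeff q t * of_nat (t choose r) * w ^ (t - r))"
    by (rule sum.cong) (simp_all add: coeff_linear_poly_power mult.assoc)
  finally show ?thesis .
qed

lemma binomial_le_two_power:
  assumes "n \<le> d"
  shows "real (n choose r) \<le> 2 ^ d"
proof -
  have "n choose r \<le> 2 ^ n" by (rule binomial_le_pow2)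
  also have "(2::nat) ^ n \<le> 2 ^ d" using assms by simp
  finally have "real (n choose r) \<le> real (2 ^ d)" by (simp only: of_nat_le_iff)
  then show ?thesis by simp
qed

text \<open>Both products equal (s choose r) times (s - r choose l - r). The form is dictated by the
  substitution t = s + r - l that matches the stated coefficient formula.\<close>

lemma choose_mult_reflect:
  assumes "r \<le> l" "l \<le> s"
  shows "(s choose (s + r - l)) * ((s + r - l) choose r) = (s choose l) * (l choose r)"
proof -
  have "(s choose (s + r - l)) * ((s + r - l) choose r) = (s choose r) * ((s - r) choose (s - l))"
    using assms choose_mult[of r "s + r - l" s] by simp
  also have "(s - r) choose (s - l) = (s - r) choose (l - r)"
    using assms binomial_symmetric[of "s - l" "s - r"] by simp
  also have "(s choose r) * ((s - r) choose (l - r)) = (s choose l) * (l choose r)"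
    using assms choose_mult[of r l s] by simp
  finally show ?thesis .
qed

section \<open>The bottom row under translation\<close>

lemma row_ratio_mult_T_pow:
  assumes "\<gamma> $ 2 $ 1 \<noteq> 0"
  shows "row_ratio (\<gamma> ** T_pow m) = row_ratio \<gamma> + of_int m"
  using assms by (simp add: row_ratio_def field_simps)

lemma automorphy_factor_mult_T_pow:
  assumes "\<gamma> $ 2 $ 1 \<noteq> 0"
  shows "of_int ((\<gamma> ** T_pow m) $ 2 $ 1) * \<tau> + of_int ((\<gamma> ** T_pow m) $ 2 $ 2) =
    of_int (\<gamma> $ 2 $ 1) * (\<tau> + row_ratio \<gamma> + of_int m)"
  using assms by (simp add: row_ratio_def field_simps)

lemma nonreal_shift_nonzero: "Im \<tau> > 0 \<Longrightarrow> \<tau> + row_ratio \<gamma> + of_int m \<noteq> 0"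
  by (auto simp: complex_eq_iff)

lemma exists_T_pow_reduce:
  assumes "c \<noteq> (0::int)"
  obtains m where "\<bar>d + m * c\<bar> \<le> \<bar>c\<bar>"
proof
  let ?m = "- (d div c)"
  have "d + ?m * c = d mod c" by (simp add: minus_div_mult_eq_mod)
  then show "\<bar>d + ?m * c\<bar> \<le> \<bar>c\<bar>" using abs_mod_less[OF assms, of d] by simp
qed

text \<open>
  The polynomial \<open>\<phi>(\<gamma>\<^sup>-\<^sup>1)(X - d/c)\<close> does not change when \<open>\<gamma>\<close> is multiplied by a power of \<open>T\<close> from
  the right, so it can be estimated on a representative with \<open>\<bar>d\<bar> \<le> \<bar>c\<bar>\<close>.
\<close>

definition centered :: "(int^2^2 \<Rightarrow> complex poly) \<Rightarrow> int^2^2 \<Rightarrow> complex poly" where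
  "centered \<phi> \<gamma> = pcompose (\<phi> (inv\<^bsub>SL2Z\<^esub> \<gamma>)) [:- row_ratio \<gamma>, 1:]"

context
  fixes d :: nat and \<phi> :: "int^2^2 \<Rightarrow> complex poly"
  assumes \<phi>: "\<phi> \<in> parabolic_cocycles (sym_space d) (sym_rep d)"
begin

lemma degree_sym_cocycle: "\<gamma> \<in> carrier SL2Z \<Longrightarrow> degree (\<phi> \<gamma>) \<le> d"
  using parabolic_cocycle_in[OF \<phi>] by (auto simp: sym_space_def)

lemma sym_cocycle_inv_mult_T_pow:
  assumes "\<gamma> \<in> carrier SL2Z"
  shows "\<phi> (inv\<^bsub>SL2Z\<^esub> (\<gamma> ** T_pow m)) = pcompose (\<phi> (inv\<^bsub>SL2Z\<^esub> \<gamma>)) [:of_int m, 1:]"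
  using assms by (simp add: parabolic_cocycle_inv_mult_T_pow[OF \<phi>] sym_rep_def sym_inv_T_pow
      degree_sym_cocycle SL2Z_closed)

lemma centered_mult_T_pow:
  assumes "\<gamma> \<in> carrier SL2Z" "\<gamma> $ 2 $ 1 \<noteq> 0"
  shows "centered \<phi> (\<gamma> ** T_pow m) = centered \<phi> \<gamma>"
  using assms by (simp add: centered_def sym_cocycle_inv_mult_T_pow row_ratio_mult_T_pow
      pcompose_pCons flip: pcompose_assoc)

lemma degree_centered: "\<gamma> \<in> carrier SL2Z \<Longrightarrow> degree (centered \<phi> \<gamma>) \<le> d"
  by (simp add: centered_def degree_pcompose degree_sym_cocycle SL2Z_closed)

text \<open>On the translate with |d| \<le> |c| the first column of the inverse is (d, -c), so N =
  |c| is admissible and gives |c| times |c|^d. The recentering shift then has norm at most 1 and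
  costs only binomial factors.\<close>

lemma centered_growth:
  obtains C :: real where "C \<ge> 0"
    "\<And>\<gamma> t. \<gamma> \<in> carrier SL2Z \<Longrightarrow> \<gamma> $ 2 $ 1 \<noteq> 0 \<Longrightarrow>
      norm (coeff (centered \<phi> \<gamma>) t) \<le> C * \<bar>real_of_int (\<gamma> $ 2 $ 1)\<bar> ^ (d + 1)"
proof -
  obtain C :: real where C: "C \<ge> 0" and growth:
    "\<And>\<gamma> N n. \<gamma> \<in> carrier SL2Z \<Longrightarrow> \<bar>real_of_int (\<gamma> $ 1 $ 1)\<bar> \<le> N \<Longrightarrow> \<bar>real_of_int (\<gamma> $ 2 $ 1)\<bar> \<le> N \<Longrightarrow>
      norm (coeff (\<phi> \<gamma>) n) \<le> C * \<bar>real_of_int (\<gamma> $ 2 $ 1)\<bar> * N ^ d"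
    using sym_cocycle_growth[OF \<phi>] by blast
  define C' where "C' = (\<Sum>s\<le>d. C * 2 ^ d)"
  have "norm (coeff (centered \<phi> \<gamma>) t) \<le> C' * \<bar>real_of_int (\<gamma> $ 2 $ 1)\<bar> ^ (d + 1)"
    if \<gamma>: "\<gamma> \<in> carrier SL2Z" "\<gamma> $ 2 $ 1 \<noteq> 0" for \<gamma> t
  proof -
    define c where "c = \<bar>real_of_int (\<gamma> $ 2 $ 1)\<bar>"
    obtain m where m: "\<bar>\<gamma> $ 2 $ 2 + m * \<gamma> $ 2 $ 1\<bar> \<le> \<bar>\<gamma> $ 2 $ 1\<bar>"
      using exists_T_pow_reduce[OF \<gamma>(2)] .
    define \<delta> where "\<delta> = \<gamma> ** T_pow m"
    have \<delta>: "\<delta> \<in> carrier SL2Z" "\<delta> $ 2 $ 1 = \<gamma> $ 2 $ 1" "\<bar>\<delta> $ 2 $ 2\<bar> \<le> \<bar>\<gamma> $ 2 $ 1\<bar>"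
      using \<gamma> m by (simp_all add: \<delta>_def SL2Z_closed algebra_simps)
    have d2: "\<bar>real_of_int (\<delta> $ 2 $ 2)\<bar> \<le> c"
      using \<delta>(3) unfolding c_def by (metis of_int_abs of_int_le_iff)
    have p: "norm (coeff (\<phi> (inv\<^bsub>SL2Z\<^esub> \<delta>)) s) \<le> C * c ^ (d + 1)" for s
      using growth[of "inv\<^bsub>SL2Z\<^esub> \<delta>" c s] \<delta> d2 by (simp add: SL2Z_closed c_def mult.assoc)
    have x: "norm (row_ratio \<delta>) \<le> 1"
      using \<delta> d2 \<gamma> by (simp add: row_ratio_def norm_divide c_def)
    have "norm (coeff (centered \<phi> \<delta>) t) \<le> (\<Sum>s=t..d. C * 2 ^ d * c ^ (d + 1))"
      unfolding centered_def coeff_pcompose_shift[OF degree_sym_cocycle[OF SL2Z_closed(2)[OF \<delta>(1)]]]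
    proof (rule order_trans[OF norm_sum sum_mono])
      fix s assume "s \<in> {t..d}"
      then have b: "real (s choose t) \<le> 2 ^ d" by (intro binomial_le_two_power) simp
      have "norm (coeff (\<phi> (inv\<^bsub>SL2Z\<^esub> \<delta>)) s * of_nat (s choose t) * (- row_ratio \<delta>) ^ (s - t)) =
          norm (coeff (\<phi> (inv\<^bsub>SL2Z\<^esub> \<delta>)) s) * real (s choose t) * norm (row_ratio \<delta>) ^ (s - t)"
        by (simp add: norm_mult norm_power)
      also have "\<dots> \<le> C * c ^ (d + 1) * 2 ^ d * 1"
        using p[of s] b x by (intro mult_mono power_le_one) (auto simp: C c_def)
      finally show "norm (coeff (\<phi> (inv\<^bsub>SL2Z\<^esub> \<delta>)) s * of_nat (s choose t) * (- row_ratio \<delta>) ^ (s - t))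
          \<le> C * 2 ^ d * c ^ (d + 1)" by (simp add: mult_ac)
    qed
    also have "\<dots> \<le> (\<Sum>s\<le>d. C * 2 ^ d * c ^ (d + 1))"
      by (rule sum_mono2) (auto simp: C c_def)
    finally show ?thesis
      using centered_mult_T_pow[OF \<gamma>, of m] by (simp add: \<delta>_def C'_def c_def mult_ac sum_distrib_right)
  qed
  moreover have "C' \<ge> 0" unfolding C'_def using C by (intro sum_nonneg) auto
  ultimately show ?thesis using that by blast
qed

text \<open>The coefficient of (X - \<tau>)^r in a term of the series.\<close>

definition recentered_coeff :: "nat \<Rightarrow> complex \<Rightarrow> nat \<Rightarrow> int^2^2 \<Rightarrow> complex" where
  "recentered_coeff k \<tau> r \<gamma> = coeff (pcompose (eis_term k \<phi> \<tau> \<gamma>) [:\<tau>, 1:]) r"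

definition centered_term :: "nat \<Rightarrow> nat \<Rightarrow> nat \<Rightarrow> int^2^2 \<Rightarrow> complex" where
  "centered_term k r t \<gamma> = coeff (centered \<phi> \<gamma>) t * of_nat (t choose r) / of_int (\<gamma> $ 2 $ 1) ^ k"

text \<open>A stabilizer element multiplies c \<tau> + d by a sign, which disappears in an even
  power, and leaves \<phi>(\<gamma>^-1) unchanged.\<close>

lemma recentered_coeff_left:
  assumes "even k" "t \<in> Gamma_inf" "\<gamma> \<in> carrier SL2Z"
  shows "recentered_coeff k \<tau> r (t ** \<gamma>) = recentered_coeff k \<tau> r \<gamma>"
proof -
  have \<phi>t: "\<phi> (inv\<^bsub>SL2Z\<^esub> (t ** \<gamma>)) = \<phi> (inv\<^bsub>SL2Z\<^esub> \<gamma>)"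
    using assms by (intro parabolic_cocycle_inv_Gamma_inf_mult[OF \<phi>]) auto
  have e: "of_int ((t ** \<gamma>) $ 2 $ 1) * \<tau> + of_int ((t ** \<gamma>) $ 2 $ 2) =
      of_int (t $ 2 $ 2) * (of_int (\<gamma> $ 2 $ 1) * \<tau> + of_int (\<gamma> $ 2 $ 2))"
    using Gamma_inf_diagonal[OF assms(2)] by (simp add: algebra_simps)
  have one: "complex_of_int (t $ 2 $ 2) powi (- int k) = 1"
    using Gamma_inf_diagonal(3)[OF assms(2)] assms(1) by (auto simp: power_int_minus)
  show ?thesis
    unfolding recentered_coeff_def eis_term_def \<phi>t e power_int_mult_distrib one by simp
qed

text \<open>With w = \<tau> + d/c + m, evaluating \<phi>(\<gamma>^-1) at X + m + \<tau> is
  evaluating the centered polynomial at X + w. Its Taylor coefficients bring w^(t-r), and the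
  automorphy factor is (c w)^-k.\<close>

lemma recentered_coeff_right:
  assumes "k \<ge> d" "Im \<tau> > 0" "\<gamma> \<in> carrier SL2Z" "\<gamma> $ 2 $ 1 \<noteq> 0"
  shows "recentered_coeff k \<tau> r (\<gamma> ** T_pow m) =
    (\<Sum>t=r..d. centered_term k r t \<gamma> / (\<tau> + row_ratio \<gamma> + of_int m) ^ (k - (t - r)))"
proof -
  let ?c = "complex_of_int (\<gamma> $ 2 $ 1)" and ?w = "\<tau> + row_ratio \<gamma> + of_int m"
  have w: "?w \<noteq> 0" by (rule nonreal_shift_nonzero[OF assms(2)])
  have "pcompose (\<phi> (inv\<^bsub>SL2Z\<^esub> (\<gamma> ** T_pow m))) [:\<tau>, 1:] = pcompose (centered \<phi> \<gamma>) [:?w, 1:]"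
    by (simp add: centered_def sym_cocycle_inv_mult_T_pow[OF assms(3)] pcompose_pCons add_ac flip: pcompose_assoc)
  then have "recentered_coeff k \<tau> r (\<gamma> ** T_pow m) =
      (?c * ?w) powi (- int k) * coeff (pcompose (centered \<phi> \<gamma>) [:?w, 1:]) r"
    unfolding recentered_coeff_def eis_term_def pcompose_smult coeff_smult
      automorphy_factor_mult_T_pow[OF assms(4)] by simp
  also have "coeff (pcompose (centered \<phi> \<gamma>) [:?w, 1:]) r =
      (\<Sum>t=r..d. coeff (centered \<phi> \<gamma>) t * of_nat (t choose r) * ?w ^ (t - r))"
    by (rule coeff_pcompose_shift[OF degree_centered[OF assms(3)]])
  also have "(?c * ?w) powi (- int k) * \<dots> =
      (\<Sum>t=r..d. centered_term k r t \<gamma> / ?w ^ (k - (t - r)))"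
    unfolding sum_distrib_left
  proof (rule sum.cong[OF refl])
    fix t assume "t \<in> {r..d}"
    then have "?w ^ k = ?w ^ (k - (t - r)) * ?w ^ (t - r)" using assms(1) by (simp flip: power_add)
    then show "(?c * ?w) powi (- int k) * (coeff (centered \<phi> \<gamma>) t * of_nat (t choose r) * ?w ^ (t - r)) =
        centered_term k r t \<gamma> / ?w ^ (k - (t - r))"
      using w by (simp add: centered_term_def power_int_minus power_mult_distrib divide_simps)
  qed
  finally show ?thesis .
qed

text \<open>The growth |c|^(d+1) of the centered polynomial meets the denominator |c|^k, where k
  \<ge> 5 + d leaves four powers of |c|.\<close>

lemma centered_term_bound:
  assumes "k \<ge> 5 + d"
  obtains B where "\<And>t \<gamma>. t \<in> {r..d} \<Longrightarrow> \<gamma> \<in> carrier SL2Z \<Longrightarrow> \<gamma> $ 2 $ 1 \<noteq> 0 \<Longrightarrow>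
    norm (centered_term k r t \<gamma>) \<le> B / \<bar>real_of_int (\<gamma> $ 2 $ 1)\<bar> ^ 4"
proof -
  obtain C where C: "C \<ge> 0" "\<And>\<gamma> t. \<gamma> \<in> carrier SL2Z \<Longrightarrow> \<gamma> $ 2 $ 1 \<noteq> 0 \<Longrightarrow>
      norm (coeff (centered \<phi> \<gamma>) t) \<le> C * \<bar>real_of_int (\<gamma> $ 2 $ 1)\<bar> ^ (d + 1)"
    using centered_growth by blast
  have "norm (centered_term k r t \<gamma>) \<le> C * 2 ^ d / \<bar>real_of_int (\<gamma> $ 2 $ 1)\<bar> ^ 4"
    if t: "t \<in> {r..d}" and \<gamma>: "\<gamma> \<in> carrier SL2Z" "\<gamma> $ 2 $ 1 \<noteq> 0" for t \<gamma>
  proof -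
    define c where "c = \<bar>real_of_int (\<gamma> $ 2 $ 1)\<bar>"
    have c: "c \<ge> 1" using \<gamma>(2) by (simp add: c_def flip: of_int_abs)
    have b: "real (t choose r) \<le> 2 ^ d" using t by (intro binomial_le_two_power) simp
    have "norm (centered_term k r t \<gamma>) = norm (coeff (centered \<phi> \<gamma>) t) * real (t choose r) / c ^ k"
      by (simp add: centered_term_def norm_mult norm_divide norm_power c_def)
    also have "\<dots> \<le> C * c ^ (d + 1) * 2 ^ d / c ^ k"
      using C(2)[OF \<gamma>, of t] b C(1) c by (intro divide_right_mono mult_mono) (auto simp: c_def)
    also have "\<dots> \<le> C * 2 ^ d / c ^ 4"
    proof -
      have "c ^ (d + 1) * c ^ 4 \<le> c ^ k"
        using c assms by (subst power_add [symmetric]) (intro power_increasing, auto)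
      then have "C * 2 ^ d * (c ^ (d + 1) * c ^ 4) \<le> C * 2 ^ d * c ^ k"
        using C(1) by (intro mult_left_mono) auto
      then show ?thesis using c by (simp add: divide_simps mult_ac)
    qed
    finally show ?thesis by (simp add: c_def)
  qed
  then show ?thesis using that by blast
qed

text \<open>Expanding the centered polynomial in the coefficients of \<phi>(\<gamma>^-1) gives a
  double sum over r \<le> t \<le> s. Exchanging the sums and reversing the inner one by t = s + r -
  l gives the stated formula.\<close>

lemma Fourier_term_centered:
  assumes "k \<ge> 5 + d" "\<gamma> \<in> carrier SL2Z"
  shows "Fourier_term {r..d} (centered_term k r) (\<lambda>t. k - (t - r)) n \<gamma> = fc_term d k \<phi> n r \<gamma>"
proof -
  define p where "p = \<phi> (inv\<^bsub>SL2Z\<^esub> \<gamma>)"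
  define x where "x = - row_ratio \<gamma>"
  define \<alpha> :: "nat \<Rightarrow> complex" where
    "\<alpha> = (\<lambda>h. (- 2 * of_real pi * \<i>) ^ (k - h) / fact (k - h - 1) * of_nat n ^ (k - h - 1))"
  have deg: "degree p \<le> d" using assms by (simp add: p_def degree_sym_cocycle SL2Z_closed)
  have "(\<Sum>t=r..d. coeff (centered \<phi> \<gamma>) t * of_nat (t choose r) * \<alpha> (t - r)) =
      (\<Sum>t=r..d. \<Sum>s=t..d. coeff p s * of_nat (s choose t) * x ^ (s - t) * of_nat (t choose r) * \<alpha> (t - r))"
    by (simp add: centered_def coeff_pcompose_shift[OF deg] flip: p_def x_def add: sum_distrib_right)
  also have "\<dots> = (\<Sum>s=r..d. \<Sum>t=r..s. coeff p s * of_nat (s choose t) * x ^ (s - t) * of_nat (t choose r) * \<alpha> (t - r))"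
    unfolding sum.Sigma[OF finite_atLeastAtMost ballI[OF finite_atLeastAtMost]]
    by (rule sum.reindex_bij_witness[of _ "\<lambda>(s, t). (t, s)" "\<lambda>(t, s). (s, t)"]) auto
  also have "\<dots> = (\<Sum>s=r..d. coeff p s * (\<Sum>l=r..s. of_nat (l choose r) * of_nat (s choose l) * x ^ (l - r) * \<alpha> (s - l)))"
  proof (rule sum.cong[OF refl])
    fix s assume s: "s \<in> {r..d}"
    have "(\<Sum>t=r..s. coeff p s * of_nat (s choose t) * x ^ (s - t) * of_nat (t choose r) * \<alpha> (t - r)) =
        (\<Sum>l=r..s. coeff p s * of_nat (s choose (s + r - l)) * x ^ (s - (s + r - l)) *
          of_nat ((s + r - l) choose r) * \<alpha> ((s + r - l) - r))"
      by (rule sum.atLeastAtMost_rev)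
    also have "\<dots> = (\<Sum>l=r..s. coeff p s * (of_nat (l choose r) * of_nat (s choose l) * x ^ (l - r) * \<alpha> (s - l)))"
    proof (rule sum.cong[OF refl])
      fix l assume l: "l \<in> {r..s}"
      have "complex_of_nat (s choose (s + r - l)) * of_nat ((s + r - l) choose r) = of_nat (s choose l) * of_nat (l choose r)"
        using choose_mult_reflect[of r l s] l by (simp only: of_nat_mult [symmetric] atLeastAtMost_iff)
      moreover have "s - (s + r - l) = l - r" "s + r - l - r = s - l" using l by auto
      ultimately show "coeff p s * of_nat (s choose (s + r - l)) * x ^ (s - (s + r - l)) *
          of_nat ((s + r - l) choose r) * \<alpha> ((s + r - l) - r) =
          coeff p s * (of_nat (l choose r) * of_nat (s choose l) * x ^ (l - r) * \<alpha> (s - l))"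
        by (simp add: algebra_simps)
    qed
    finally show "(\<Sum>t=r..s. coeff p s * of_nat (s choose t) * x ^ (s - t) * of_nat (t choose r) * \<alpha> (t - r)) =
        coeff p s * (\<Sum>l=r..s. of_nat (l choose r) * of_nat (s choose l) * x ^ (l - r) * \<alpha> (s - l))"
      by (simp add: sum_distrib_left)
  qed
  finally have 1: "(\<Sum>t=r..d. coeff (centered \<phi> \<gamma>) t * of_nat (t choose r) * \<alpha> (t - r)) =
    (\<Sum>s=r..d. coeff p s * (\<Sum>l=r..s. of_nat (l choose r) * of_nat (s choose l) * x ^ (l - r) * \<alpha> (s - l)))" .
  have "Fourier_term {r..d} (centered_term k r) (\<lambda>t. k - (t - r)) n \<gamma> =
      ee (of_nat n * row_ratio \<gamma>) / of_int (\<gamma> $ 2 $ 1) ^ k *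
      (\<Sum>t=r..d. coeff (centered \<phi> \<gamma>) t * of_nat (t choose r) * \<alpha> (t - r))"
    by (simp add: Fourier_term_def centered_term_def \<alpha>_def sum_distrib_left mult_ac)
  also have "\<dots> = fc_term d k \<phi> n r \<gamma>"
  proof -
    have eq: "of_nat (l choose r) * of_nat (s choose l) * x ^ (l - r) * \<alpha> (s - l) =
      (- 2 * of_real pi * \<i>) ^ (k - s + l) / fact (k - s + l - 1) *
           of_nat (l choose r) * of_nat (s choose l) * (- of_int (\<gamma>$2$2) / of_int (\<gamma>$2$1)) ^ (l - r) *
           of_nat n ^ (k - s + l - 1)" if "l \<in> {r..s}" "s \<in> {r..d}" for l s
    proof -
      define e where "e = k - s + l"
      \<comment> \<open>For naturals this needs l \<le> s \<le> k, which holds since s \<le> d \<le>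
        k.\<close>
      have e: "k - (s - l) = e" using that assms by (auto simp: e_def)
      show ?thesis
        unfolding \<alpha>_def x_def row_ratio_def e e_def [symmetric] by (simp add: mult_ac)
    qed
    show ?thesis
      unfolding 1 fc_term_def Let_def p_def row_ratio_def
      by (rule arg_cong[of _ _ "(*) _"], rule sum.cong[OF refl], rule arg_cong[of _ _ "(*) _"],
          rule sum.cong[OF refl], rule eq)
  qed
  finally show ?thesis .
qed

text \<open>The core theorem applies to each coefficient in powers of X - \<tau>, whereas
  \<open>eis\<close> sums coefficients of powers of X; the two are related by a finite linear change
  of basis independent of the coset.\<close>

theorem eis_Fourier_expansion:
  assumes k: "even k" "k \<ge> 5 + d" and \<tau>: "Im \<tau> > 0"
    and u: "\<And>C. C \<in> rcosets\<^bsub>SL2Z\<^esub> Gamma_inf \<Longrightarrow> u C \<in> C"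
    and v: "\<And>D. D \<in> nontrivial_double_cosets \<Longrightarrow> v D \<in> D"
  shows "(\<lambda>C. coeff (eis_term k \<phi> \<tau> (u C)) i) summable_on rcosets\<^bsub>SL2Z\<^esub> Gamma_inf"
    and "n \<ge> 1 \<Longrightarrow> (\<lambda>D. fc_term d k \<phi> n r (v D)) summable_on nontrivial_double_cosets"
    and "(\<lambda>n. fc v d k \<phi> n r * ee (of_nat n * \<tau>)) summable_on {1..}"
    and "eis u d k \<phi> \<tau> =
      (\<Sum>r=0..d. [:- \<tau>, 1:] ^ r * [:\<Sum>\<^sub>\<infinity>n\<in>{1..}. fc v d k \<phi> n r * ee (of_nat n * \<tau>):])"
proof -
  let ?C = "rcosets\<^bsub>SL2Z\<^esub> Gamma_inf"
  obtain B where B: "\<And>r t \<gamma>. t \<in> {r..d} \<Longrightarrow> \<gamma> \<in> carrier SL2Z \<Longrightarrow> \<gamma> $ 2 $ 1 \<noteq> 0 \<Longrightarrow>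
      norm (centered_term k r t \<gamma>) \<le> B r / \<bar>real_of_int (\<gamma> $ 2 $ 1)\<bar> ^ 4"
  proof -
    have "\<exists>B. \<forall>t \<gamma>. t \<in> {r..d} \<longrightarrow> \<gamma> \<in> carrier SL2Z \<longrightarrow> \<gamma> $ 2 $ 1 \<noteq> 0 \<longrightarrow>
        norm (centered_term k r t \<gamma>) \<le> B / \<bar>real_of_int (\<gamma> $ 2 $ 1)\<bar> ^ 4" for r
      by (rule centered_term_bound[OF k(2), of r]) blast
    then show ?thesis using that by metis
  qed
  note main = rcoset_sum_Fourier_expansion[where f = "recentered_coeff k \<tau> r" and R = "{r..d}"
      and A = "centered_term k r" and K = "\<lambda>t. k - (t - r)" and B = "B r" and u = u and v = v and \<tau> = \<tau> for r]
  have zero: "recentered_coeff k \<tau> r \<gamma> = 0" if "\<gamma> \<in> Gamma_inf" for r \<gamma>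
    using that by (simp add: recentered_coeff_def eis_term_def parabolic_cocycle_Gamma_inf[OF \<phi>] inv_Gamma_inf)
  have K: "2 \<le> k - (t - r)" if "t \<in> {r..d}" for t r using k that by auto
  have kd: "k \<ge> d" using k by simp
  note main' = main[OF \<tau> finite_atLeastAtMost K u v recentered_coeff_left[OF k(1)] zero
      recentered_coeff_right[OF kd \<tau>] B]
  have F: "Fourier_term {r..d} (centered_term k r) (\<lambda>t. k - (t - r)) n (v D) = fc_term d k \<phi> n r (v D)"
    if "D \<in> nontrivial_double_cosets" for D n r
    using Fourier_term_centered[OF k(2)] nontrivial_double_coset_rep(1)[OF that v[OF that]] by simp
  have fc: "(\<Sum>\<^sub>\<infinity>D\<in>nontrivial_double_cosets. Fourier_term {r..d} (centered_term k r) (\<lambda>t. k - (t - r)) n (v D)) =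
      fc v d k \<phi> n r" for n r
    unfolding fc_def by (intro infsum_cong F)
  show "n \<ge> 1 \<Longrightarrow> (\<lambda>D. fc_term d k \<phi> n r (v D)) summable_on nontrivial_double_cosets"
    using main'(2)[of r n] F by (simp cong: summable_on_cong)
  show "(\<lambda>n. fc v d k \<phi> n r * ee (of_nat n * \<tau>)) summable_on {1..}"
    using main'(3)[of r] unfolding fc .
  have sum: "(\<lambda>C. recentered_coeff k \<tau> r (u C)) summable_on ?C" for r by (rule main'(1))
  have inf: "(\<Sum>\<^sub>\<infinity>C\<in>?C. recentered_coeff k \<tau> r (u C)) = (\<Sum>\<^sub>\<infinity>n\<in>{1..}. fc v d k \<phi> n r * ee (of_nat n * \<tau>))" for r
    using main'(4)[of r] unfolding fc .
  have eis: "eis_term k \<phi> \<tau> (u C) = (\<Sum>r\<le>d. smult (recentered_coeff k \<tau> r (u C)) ([:- \<tau>, 1:] ^ r))"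
    if C: "C \<in> ?C" for C
  proof -
    let ?p = "eis_term k \<phi> \<tau> (u C)"
    have "u C \<in> carrier SL2Z"
      using C u[OF C] by (auto elim!: rcosetsE simp: r_coset_Gamma_inf)
    then have "degree (\<phi> (inv\<^bsub>SL2Z\<^esub> (u C))) \<le> d" by (simp add: degree_sym_cocycle SL2Z_closed)
    then have "degree ?p \<le> d"
      unfolding eis_term_def by (rule order_trans[OF degree_smult_le])
    then have deg: "degree (pcompose ?p [:\<tau>, 1:]) \<le> d" by (simp add: degree_pcompose)
    have "?p = pcompose (pcompose ?p [:\<tau>, 1:]) [:- \<tau>, 1:]"
      by (simp add: pcompose_pCons flip: pcompose_assoc)
    also have "\<dots> = pcompose (\<Sum>r\<le>d. monom (coeff (pcompose ?p [:\<tau>, 1:]) r) r) [:- \<tau>, 1:]"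
      by (subst poly_as_sum_of_monoms'[OF deg]) simp
    also have "\<dots> = (\<Sum>r\<le>d. smult (coeff (pcompose ?p [:\<tau>, 1:]) r) ([:- \<tau>, 1:] ^ r))"
      by (simp add: pcompose_sum pcompose_monom)
    finally show ?thesis by (simp add: recentered_coeff_def)
  qed
  have coeff_has_sum: "((\<lambda>C. coeff (eis_term k \<phi> \<tau> (u C)) i) has_sum
      (\<Sum>r\<le>d. (\<Sum>\<^sub>\<infinity>C\<in>?C. recentered_coeff k \<tau> r (u C)) * coeff ([:- \<tau>, 1:] ^ r) i)) ?C" for i
  proof -
    have "((\<lambda>C. \<Sum>r\<le>d. recentered_coeff k \<tau> r (u C) * coeff ([:- \<tau>, 1:] ^ r) i) has_sum
      (\<Sum>r\<le>d. (\<Sum>\<^sub>\<infinity>C\<in>?C. recentered_coeff k \<tau> r (u C)) * coeff ([:- \<tau>, 1:] ^ r) i)) ?C"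
      by (intro has_sum_finite_sum has_sum_cmult_left has_sum_infsum sum)
    then show ?thesis
      by (rule has_sum_cong[THEN iffD1, rotated]) (simp add: eis coeff_sum)
  qed
  from this[of i] show "(\<lambda>C. coeff (eis_term k \<phi> \<tau> (u C)) i) summable_on ?C"
    by (rule has_sum_imp_summable)
  define P where "P = (\<Sum>r\<le>d. smult (\<Sum>\<^sub>\<infinity>C\<in>?C. recentered_coeff k \<tau> r (u C)) ([:- \<tau>, 1:] ^ r))"
  have "degree P \<le> d" unfolding P_def
    by (intro degree_sum_le) (auto intro: order_trans[OF degree_smult_le] order_trans[OF degree_linear_power_le])
  have "eis u d k \<phi> \<tau> = (\<Sum>i\<le>d. monom (coeff P i) i)"
    unfolding eis_def infsumI[OF coeff_has_sum] P_def by (simp add: coeff_sum)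
  also have "\<dots> = P" by (rule poly_as_sum_of_monoms'[OF \<open>degree P \<le> d\<close>])
  also have "\<dots> = (\<Sum>r=0..d. [:- \<tau>, 1:] ^ r * [:\<Sum>\<^sub>\<infinity>n\<in>{1..}. fc v d k \<phi> n r * ee (of_nat n * \<tau>):])"
    unfolding P_def inf by (simp add: atLeast0AtMost)
  finally show "eis u d k \<phi> \<tau> =
      (\<Sum>r=0..d. [:- \<tau>, 1:] ^ r * [:\<Sum>\<^sub>\<infinity>n\<in>{1..}. fc v d k \<phi> n r * ee (of_nat n * \<tau>):])" .
qed

end

section \<open>Duals of symmetric powers\<close>

lemma pcompose_linear_power: "pcompose ([:a, b:] ^ n) [:c, 1:] = [:a + b * c, b:] ^ n"
  for a b c :: "'a::comm_ring_1"
proof (induction n)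
  case (Suc n)
  have "pcompose [:a, b:] [:c, 1:] = [:a + b * c, b:]" by (simp add: pcompose_pCons algebra_simps)
  with Suc show ?case by (simp only: power_Suc pcompose_mult)
qed (simp add: pcompose_1)

lemma linear_power_smult: "[:c * a, c * b:] ^ n = smult (c ^ n) ([:a, b:] ^ n)"
  for a b c :: "'a::comm_ring_1"
  by (simp flip: smult_power)

context
  fixes d :: nat and \<psi> :: "int^2^2 \<Rightarrow> complex poly \<Rightarrow> complex"
  assumes \<psi>: "\<psi> \<in> parabolic_cocycles (dual_space (sym_space d)) (dual_rep (sym_space d) (sym_rep d))"
begin

lemma dual_cocycle_in: "\<gamma> \<in> carrier SL2Z \<Longrightarrow> \<psi> \<gamma> \<in> dual_space (sym_space d)"
  by (rule parabolic_cocycle_in[OF \<psi>])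

lemma dual_cocycle_inv_Gamma_inf_mult:
  "\<gamma> \<in> carrier SL2Z \<Longrightarrow> t \<in> Gamma_inf \<Longrightarrow> \<psi> (inv\<^bsub>SL2Z\<^esub> (t ** \<gamma>)) = \<psi> (inv\<^bsub>SL2Z\<^esub> \<gamma>)"
  by (rule parabolic_cocycle_inv_Gamma_inf_mult[OF \<psi>]) simp_all

text \<open>The cocycle relation leaves the dual action of T^-m, which pairs with T^m on
  polynomials; in this convention T^m acts by X -> X - m.\<close>

lemma dual_cocycle_inv_mult_T_pow:
  assumes "\<gamma> \<in> carrier SL2Z" "degree p \<le> d"
  shows "\<psi> (inv\<^bsub>SL2Z\<^esub> (\<gamma> ** T_pow m)) p = \<psi> (inv\<^bsub>SL2Z\<^esub> \<gamma>) (pcompose p [:- of_int m, 1:])"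
  using assms sym_inv_T_pow[OF assms(2), of "- m"]
  by (simp add: parabolic_cocycle_inv_mult_T_pow[OF \<psi>] dual_rep_def sym_rep_def sym_space_def)

text \<open>The cocycle relation for \<gamma>^-1 \<gamma> = 1 together with \<psi>(1) = 0. It trades
  \<gamma>^-1 for \<gamma> in the growth estimate.\<close>

lemma dual_cocycle_inv:
  assumes "\<gamma> \<in> carrier SL2Z" "degree p \<le> d"
  shows "\<psi> (inv\<^bsub>SL2Z\<^esub> \<gamma>) p = - \<psi> \<gamma> (sym_inv d (inv\<^bsub>SL2Z\<^esub> \<gamma>) p)"
proof -
  have "inv\<^bsub>SL2Z\<^esub> \<gamma> ** \<gamma> = mat 1"
    using group.l_inv[OF group_SL2Z assms(1)] by (simp add: SL2Z_def)
  moreover have "mat 1 \<in> Gamma_inf" using T_pow_Gamma_inf[of 0] by (simp add: T_pow_0)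
  ultimately have "0 = \<psi> (inv\<^bsub>SL2Z\<^esub> \<gamma> ** \<gamma>)" using parabolic_cocycle_Gamma_inf[OF \<psi>] by simp
  then have "0 = \<psi> (inv\<^bsub>SL2Z\<^esub> \<gamma> ** \<gamma>) p" by (simp only: zero_fun_apply)
  also have "\<dots> = \<psi> \<gamma> (sym_inv d (inv\<^bsub>SL2Z\<^esub> \<gamma>) p) + \<psi> (inv\<^bsub>SL2Z\<^esub> \<gamma>) p"
    using assms by (simp add: parabolic_cocycle_mult[OF \<psi>] SL2Z_closed dual_rep_def sym_rep_def sym_space_def)
  finally show ?thesis by (simp add: eq_neg_iff_add_eq_0 add.commute)
qed

text \<open>From \<gamma>x - \<gamma>\<tau> = (x - \<tau>) / ((c x + d)(c \<tau> + d)): the j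
  factors in x cancel part of the weight and leave (c X + d)^(d - j) with exponent the degree bound
  minus j, and the j factors in \<tau> raise k to k + j.\<close>

lemma eis_dual_term_eq:
  assumes \<gamma>: "\<gamma> \<in> carrier SL2Z" and "j \<le> d" "Im \<tau> > 0"
  shows "eis_dual_term d k j \<psi> \<tau> \<gamma> =
    \<psi> (inv\<^bsub>SL2Z\<^esub> \<gamma>) ([:of_int (\<gamma> $ 2 $ 2), of_int (\<gamma> $ 2 $ 1):] ^ (d - j) * [:- \<tau>, 1:] ^ j) /
    (of_int (\<gamma> $ 2 $ 1) * \<tau> + of_int (\<gamma> $ 2 $ 2)) ^ (k + j)"
proof -
  define a b c e where "a = complex_of_int (\<gamma> $ 1 $ 1)" "b = complex_of_int (\<gamma> $ 1 $ 2)"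
    "c = complex_of_int (\<gamma> $ 2 $ 1)" "e = complex_of_int (\<gamma> $ 2 $ 2)"
  note abce = this
  have "complex_of_int (\<gamma> $ 1 $ 1 * \<gamma> $ 2 $ 2 - \<gamma> $ 1 $ 2 * \<gamma> $ 2 $ 1) = 1"
    using \<gamma> by (simp only: carrier_SL2Z_iff of_int_1)
  then have det: "a * e - b * c = 1" by (simp add: abce)
  have split_power: "A ^ p * A ^ j * (t / (A * z)) ^ j = 1 / z ^ j * (A ^ p * t ^ j)"
    if "A \<noteq> 0" for A z t :: complex and p j :: nat
    using that by (simp add: power_divide power_mult_distrib)
  let ?z = "c * \<tau> + e"
  let ?q = "[:e, c:] ^ (d - j) * [:- \<tau>, 1:] ^ j"
  have z: "?z \<noteq> 0"
  proof
    assume z: "?z = 0"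
    then have "Im ?z = 0" by simp
    then have "c = 0" using assms(3) by (simp add: abce)
    with z det show False by simp
  qed
  have deg: "degree ?q \<le> d" using degree_linear_powers_le[of e c "d - j" "- \<tau>" 1 j] assms(2) by simp
  have "sym_inv d \<gamma> ([:- moebius_act \<gamma> \<tau>, 1:] ^ j) = smult (1 / ?z ^ j) ?q"
  proof (rule sym_inv_eqI[OF \<gamma>])
    show "degree ([:- moebius_act \<gamma> \<tau>, 1:] ^ j) \<le> d"
      using degree_linear_power_le[of "- moebius_act \<gamma> \<tau>" 1 j] assms(2) by simp
    fix x assume "of_int (\<gamma> $ 2 $ 1) * x + of_int (\<gamma> $ 2 $ 2) \<noteq> (0::complex)"
    then have y: "c * x + e \<noteq> 0" by (simp add: abce)
    have "moebius_act \<gamma> x - moebius_act \<gamma> \<tau> = (x - \<tau>) / ((c * x + e) * ?z)"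
    proof -
      have "(a * x + b) * ?z - (a * \<tau> + b) * (c * x + e) = (a * e - b * c) * (x - \<tau>)"
        by (simp add: algebra_simps)
      then show ?thesis
        unfolding moebius_act_def abce [symmetric] diff_frac_eq[OF y z] by (simp only: det mult_1)
    qed
    moreover have "(c * x + e) ^ d = (c * x + e) ^ (d - j) * (c * x + e) ^ j"
      using assms(2) by (simp flip: power_add)
    ultimately have "(c * x + e) ^ d * (moebius_act \<gamma> x - moebius_act \<gamma> \<tau>) ^ j =
        1 / ?z ^ j * ((c * x + e) ^ (d - j) * (x - \<tau>) ^ j)"
      using split_power[OF y, of "d - j" j "x - \<tau>" ?z] by (simp only:)
    then show "(of_int (\<gamma> $ 2 $ 1) * x + of_int (\<gamma> $ 2 $ 2)) ^ d * poly ([:- moebius_act \<gamma> \<tau>, 1:] ^ j) (moebius_act \<gamma> x) =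
        poly (smult (1 / ?z ^ j) ?q) x"
      by (simp add: add.commute mult.commute flip: abce)
  qed
  then have "eis_dual_term d k j \<psi> \<tau> \<gamma> = \<psi> (inv\<^bsub>SL2Z\<^esub> \<gamma>) (smult (?z powi (- int k)) (smult (1 / ?z ^ j) ?q))"
    using \<gamma> by (simp add: eis_dual_term_def slash_def sym_rep_def flip: abce)
  also have "\<dots> = ?z powi (- int k) * (1 / ?z ^ j * \<psi> (inv\<^bsub>SL2Z\<^esub> \<gamma>) ?q)"
    using deg by (simp add: dual_spaceD(2)[OF dual_cocycle_in] SL2Z_closed \<gamma> order_trans[OF degree_smult_le] del: smult_smult)
  also have "\<dots> = \<psi> (inv\<^bsub>SL2Z\<^esub> \<gamma>) ?q / ?z ^ (k + j)"
    by (simp only: power_int_minus power_int_of_nat power_add divide_inverse inverse_mult_distrib mult_1 mult_ac)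
  finally show ?thesis unfolding abce .
qed

text \<open>The sign of the row enters once through the polynomial argument and once through the
  automorphy factor; the exponents d - j and k + j have equal parity because d and k are
  even.\<close>

lemma eis_dual_term_left:
  assumes "even d" "even k" "j \<le> d" "Im \<tau> > 0" "t \<in> Gamma_inf" "\<gamma> \<in> carrier SL2Z"
  shows "eis_dual_term d k j \<psi> \<tau> (t ** \<gamma>) = eis_dual_term d k j \<psi> \<tau> \<gamma>"
proof -
  define e where "e = complex_of_int (t $ 2 $ 2)"
  define c d' where "c = complex_of_int (\<gamma> $ 2 $ 1)" "d' = complex_of_int (\<gamma> $ 2 $ 2)"
  note cd = this
  have e: "e = 1 \<or> e = - 1" using Gamma_inf_diagonal(3)[OF assms(5)] by (auto simp: e_def)
  have row: "complex_of_int ((t ** \<gamma>) $ 2 $ 1) = e * c" "complex_of_int ((t ** \<gamma>) $ 2 $ 2) = e * d'"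
    using Gamma_inf_diagonal(1)[OF assms(5)] by (simp_all add: e_def cd)
  have "eis_dual_term d k j \<psi> \<tau> (t ** \<gamma>) =
      \<psi> (inv\<^bsub>SL2Z\<^esub> \<gamma>) ([:e * d', e * c:] ^ (d - j) * [:- \<tau>, 1:] ^ j) / (e * c * \<tau> + e * d') ^ (k + j)"
    using assms by (subst eis_dual_term_eq) (simp_all only: SL2Z_closed Gamma_inf_carrier row dual_cocycle_inv_Gamma_inf_mult)
  also have "e * c * \<tau> + e * d' = e * (c * \<tau> + d')" by (simp add: algebra_simps)
  also have "[:e * d', e * c:] ^ (d - j) * [:- \<tau>, 1:] ^ j = smult (e ^ (d - j)) ([:d', c:] ^ (d - j) * [:- \<tau>, 1:] ^ j)"
    by (simp only: linear_power_smult mult_smult_left)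
  also have "\<psi> (inv\<^bsub>SL2Z\<^esub> \<gamma>) \<dots> = e ^ (d - j) * \<psi> (inv\<^bsub>SL2Z\<^esub> \<gamma>) ([:d', c:] ^ (d - j) * [:- \<tau>, 1:] ^ j)"
    using assms(3,6) degree_linear_powers_le[of d' c "d - j" "- \<tau>" 1 j]
    by (intro dual_spaceD(2)[OF dual_cocycle_in]) (auto simp: SL2Z_closed)
  also have "e ^ (d - j) * \<psi> (inv\<^bsub>SL2Z\<^esub> \<gamma>) ([:d', c:] ^ (d - j) * [:- \<tau>, 1:] ^ j) / (e * (c * \<tau> + d')) ^ (k + j) =
      e ^ (d - j) / e ^ (k + j) * (\<psi> (inv\<^bsub>SL2Z\<^esub> \<gamma>) ([:d', c:] ^ (d - j) * [:- \<tau>, 1:] ^ j) / (c * \<tau> + d') ^ (k + j))"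
    by (simp add: power_mult_distrib)
  also have "e ^ (d - j) / e ^ (k + j) = 1"
  proof -
    have "even (d - j) = even (k + j)" using assms(1-3) by auto
    then show ?thesis using e by (cases "even (k + j)") (auto simp: power_minus_odd)
  qed
  finally show ?thesis
    using assms by (subst eis_dual_term_eq[of \<gamma>]) (simp_all add: cd)
qed

text \<open>The exponent of c is k + j from the automorphy factor, less the d - j factors c taken
  out of the power of the bottom-row polynomial.\<close>

definition dual_coeff :: "nat \<Rightarrow> nat \<Rightarrow> nat \<Rightarrow> int^2^2 \<Rightarrow> complex" where
  "dual_coeff k j r \<gamma> = (- 1) ^ (j - r) * of_nat (j choose r) *
     \<psi> (inv\<^bsub>SL2Z\<^esub> \<gamma>) ([:row_ratio \<gamma>, 1:] ^ (d - j + r)) / of_int (\<gamma> $ 2 $ 1) ^ (k + 2 * j - d)"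

text \<open>After the shift by -m the factor X - \<tau> becomes (X + d/c) - w, and the binomial
  theorem in these two quantities produces the powers w^-(k+r).\<close>

lemma eis_dual_term_right:
  assumes "j \<le> d" "k \<ge> d" "Im \<tau> > 0" "\<gamma> \<in> carrier SL2Z" "\<gamma> $ 2 $ 1 \<noteq> 0"
  shows "eis_dual_term d k j \<psi> \<tau> (\<gamma> ** T_pow m) =
    (\<Sum>r=0..j. dual_coeff k j r \<gamma> / (\<tau> + row_ratio \<gamma> + of_int m) ^ (k + r))"
proof -
  define c d' where "c = complex_of_int (\<gamma> $ 2 $ 1)" "d' = complex_of_int (\<gamma> $ 2 $ 2)"
  note cd = this
  define x w where "x = row_ratio \<gamma>" "w = \<tau> + row_ratio \<gamma> + of_int m"
  note xw = this
  let ?L = "\<psi> (inv\<^bsub>SL2Z\<^esub> \<gamma>)" and ?e = "complex_of_int ((\<gamma> ** T_pow m) $ 2 $ 2)"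
  have w: "w \<noteq> 0" unfolding xw by (rule nonreal_shift_nonzero[OF assms(3)])
  have c: "c \<noteq> 0" using assms(5) by (simp add: cd)
  have cx: "c * x = d'" using c by (simp add: xw row_ratio_def cd)
  have L: "?L \<in> dual_space (sym_space d)" using assms(4) by (simp add: dual_cocycle_in SL2Z_closed)
  have row: "complex_of_int ((\<gamma> ** T_pow m) $ 2 $ 1) = c" "?e = c * of_int m + d'"
    by (simp_all add: cd)
  let ?p = "[:?e, c:] ^ (d - j) * [:- \<tau>, 1:] ^ j"
  have deg: "degree ?p \<le> d" using degree_linear_powers_le[of ?e c "d - j" "- \<tau>" 1 j] assms(1) by simp
  have g: "\<gamma> ** T_pow m \<in> carrier SL2Z" using assms(4) by (simp add: SL2Z_closed)
  have cw: "c * \<tau> + ?e = c * w" unfolding row xw using cx by (simp add: xw algebra_simps)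
  have "eis_dual_term d k j \<psi> \<tau> (\<gamma> ** T_pow m) = \<psi> (inv\<^bsub>SL2Z\<^esub> (\<gamma> ** T_pow m)) ?p / (c * w) ^ (k + j)"
    unfolding eis_dual_term_eq[OF g assms(1,3)] row(1) cw ..
  also have "\<psi> (inv\<^bsub>SL2Z\<^esub> (\<gamma> ** T_pow m)) ?p = ?L (pcompose ?p [:- of_int m, 1:])"
    by (rule dual_cocycle_inv_mult_T_pow[OF assms(4) deg])
  also have "pcompose ?p [:- of_int m, 1:] = [:c * x, c * 1:] ^ (d - j) * [:x - w, 1:] ^ j"
  proof -
    have "c * of_int m + d' + c * - of_int m = c * x" "- \<tau> + 1 * - of_int m = x - w"
      by (simp_all add: cx) (simp add: xw)
    then show ?thesis unfolding row pcompose_mult pcompose_linear_power by simp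
  qed
  also have "\<dots> = (\<Sum>r\<le>j. smult (c ^ (d - j) * of_nat (j choose r) * (- w) ^ (j - r)) ([:x, 1:] ^ (d - j + r)))"
  proof -
    have "[:x - w, 1:] ^ j = ([:x, 1:] + [:- w:]) ^ j" by simp
    also have "\<dots> = (\<Sum>r\<le>j. smult (of_nat (j choose r) * (- w) ^ (j - r)) ([:x, 1:] ^ r))"
      by (subst binomial_ring) (simp add: poly_const_pow of_nat_poly mult_ac)
    finally have "[:x - w, 1:] ^ j = (\<Sum>r\<le>j. smult (of_nat (j choose r) * (- w) ^ (j - r)) ([:x, 1:] ^ r))" .
    then show ?thesis
      unfolding linear_power_smult sum_distrib_left
      by (simp only: sum_distrib_left) (intro sum.cong refl, simp add: power_add mult_smult_left mult_smult_right mult_ac)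
  qed
  also have "?L \<dots> = (\<Sum>r\<le>j. c ^ (d - j) * of_nat (j choose r) * (- w) ^ (j - r) * ?L ([:x, 1:] ^ (d - j + r)))"
    by (rule dual_space_sum[OF L]) (use assms(1) in \<open>auto intro: order_trans[OF degree_linear_power_le]\<close>)
  also have "\<dots> / (c * w) ^ (k + j) = (\<Sum>r\<le>j. dual_coeff k j r \<gamma> / w ^ (k + r))"
    unfolding sum_divide_distrib
  proof (rule sum.cong[OF refl])
    fix r assume "r \<in> {..j}"
    then have "w ^ (k + j) = w ^ (k + r) * w ^ (j - r)" by (simp flip: power_add)
    moreover have "(- w) ^ (j - r) = (- 1) ^ (j - r) * w ^ (j - r)" by (rule power_minus)
    moreover have "c ^ (k + j) = c ^ (k + 2 * j - d) * c ^ (d - j)"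
    proof -
      have "k + j = (k + 2 * j - d) + (d - j)" using assms(1,2) by simp
      then show ?thesis by (metis power_add)
    qed
    ultimately show "c ^ (d - j) * of_nat (j choose r) * (- w) ^ (j - r) * ?L ([:x, 1:] ^ (d - j + r)) / (c * w) ^ (k + j) =
        dual_coeff k j r \<gamma> / w ^ (k + r)"
      using w c by (simp add: dual_coeff_def power_mult_distrib divide_simps flip: cd xw)
  qed
  finally show ?thesis unfolding xw by (simp add: atLeast0AtMost)
qed

text \<open>
  Since \<open>\<psi>(\<gamma>\<^sup>-\<^sup>1)((cX + d)\<^sup>e) = - \<psi>(\<gamma>)((a - cX)\<^sup>\<d>\<^sup>-\<^sup>e)\<close>, the coefficient can be estimated by the
  growth of \<open>\<psi>(\<gamma>)\<close>, where \<open>a\<close> may be reduced modulo \<open>c\<close> by a power of \<open>T\<close> from the left.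
  A direct estimate of \<open>\<psi>(\<gamma>\<^sup>-\<^sup>1)\<close> would lose a factor \<open>\<bar>c\<bar>\<^sup>\<d>\<close> for \<open>j = 0\<close>.
\<close>

lemma dual_coeff_bound:
  assumes "j \<le> d" "k \<ge> 5 + d"
  obtains B where "\<And>r \<gamma>. r \<in> {0..j} \<Longrightarrow> \<gamma> \<in> carrier SL2Z \<Longrightarrow> \<gamma> $ 2 $ 1 \<noteq> 0 \<Longrightarrow>
    norm (dual_coeff k j r \<gamma>) \<le> B / \<bar>real_of_int (\<gamma> $ 2 $ 1)\<bar> ^ 4"
proof -
  obtain C :: real where C: "C \<ge> 0" and growth:
    "\<And>\<gamma> N n. \<gamma> \<in> carrier SL2Z \<Longrightarrow> \<bar>real_of_int (\<gamma> $ 1 $ 1)\<bar> \<le> N \<Longrightarrow> \<bar>real_of_int (\<gamma> $ 2 $ 1)\<bar> \<le> N \<Longrightarrow>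
      n \<le> d \<Longrightarrow> norm (\<psi> \<gamma> (monom 1 n)) \<le> C * \<bar>real_of_int (\<gamma> $ 2 $ 1)\<bar> * N ^ d"
    using dual_cocycle_growth[OF \<psi>] by blast
  define B where "B = 2 ^ d * (2 ^ d * (real (Suc d) * C))"
  have "norm (dual_coeff k j r \<gamma>) \<le> B / \<bar>real_of_int (\<gamma> $ 2 $ 1)\<bar> ^ 4"
    if r: "r \<in> {0..j}" and \<gamma>: "\<gamma> \<in> carrier SL2Z" "\<gamma> $ 2 $ 1 \<noteq> 0" for r \<gamma>
  proof -
    define c where "c = \<bar>real_of_int (\<gamma> $ 2 $ 1)\<bar>"
    have c: "c \<ge> 1" using \<gamma>(2) by (simp add: c_def flip: of_int_abs)
    obtain m where m: "\<bar>\<gamma> $ 1 $ 1 + m * \<gamma> $ 2 $ 1\<bar> \<le> \<bar>\<gamma> $ 2 $ 1\<bar>"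
      using exists_T_pow_reduce[OF \<gamma>(2)] .
    \<comment> \<open>Left translation keeps the bottom row and \<psi>(\<gamma>^-1) while reducing
      the upper left entry, so that N = |c| may be used for \<psi>(\<delta>).\<close>
    define \<delta> where "\<delta> = T_pow m ** \<gamma>"
    have \<delta>: "\<delta> \<in> carrier SL2Z" "\<delta> $ 2 $ 1 = \<gamma> $ 2 $ 1" "\<delta> $ 2 $ 2 = \<gamma> $ 2 $ 2" "\<bar>\<delta> $ 1 $ 1\<bar> \<le> \<bar>\<gamma> $ 2 $ 1\<bar>"
      using \<gamma> m by (simp_all add: \<delta>_def SL2Z_closed)
    have a: "\<bar>real_of_int (\<delta> $ 1 $ 1)\<bar> \<le> c"
      using \<delta>(4) unfolding c_def by (metis of_int_abs of_int_le_iff)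
    define e where "e = d - j + r"
    have e: "e \<le> d" "d - e = j - r" using r assms(1) by (auto simp: e_def)
    define a' c' d' where "a' = complex_of_int (\<delta> $ 1 $ 1)" "c' = complex_of_int (\<delta> $ 2 $ 1)" "d' = complex_of_int (\<delta> $ 2 $ 2)"
    note acd = this
    have nc: "norm c' = c" "norm (- c') = c" "c' \<noteq> 0" using \<gamma> \<delta> by (simp_all add: acd c_def)

    \<comment> \<open>Under \<delta>^-1 the form c X + d becomes 1/(a - c X), so its e-th power
      cancels e of the d factors a - c X of the action.\<close>
    have flip: "sym_inv d (inv\<^bsub>SL2Z\<^esub> \<delta>) ([:d', c':] ^ e) = [:a', - c':] ^ (d - e)"
    proof (rule sym_inv_eqI)
      show "inv\<^bsub>SL2Z\<^esub> \<delta> \<in> carrier SL2Z" using \<delta> by (simp add: SL2Z_closed)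
      show "degree ([:d', c':] ^ e) \<le> d" using degree_linear_power_le[of d' c' e] e by simp
      define b' where "b' = complex_of_int (\<delta> $ 1 $ 2)"
      have "complex_of_int (\<delta> $ 1 $ 1 * \<delta> $ 2 $ 2 - \<delta> $ 1 $ 2 * \<delta> $ 2 $ 1) = 1"
        using \<delta>(1) by (simp only: carrier_SL2Z_iff of_int_1)
      then have det: "a' * d' - b' * c' = 1" by (simp add: acd b'_def)
      fix x assume "of_int ((inv\<^bsub>SL2Z\<^esub> \<delta>) $ 2 $ 1) * x + of_int ((inv\<^bsub>SL2Z\<^esub> \<delta>) $ 2 $ 2) \<noteq> (0::complex)"
      then have y: "a' - c' * x \<noteq> 0" using \<delta> by (simp add: acd)
      have "c' * ((d' * x - b') / (a' - c' * x)) + d' = 1 / (a' - c' * x)"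
      proof -
        have "1 = c' * (d' * x - b') + d' * (a' - c' * x)" using det by (simp add: algebra_simps)
        also have "\<dots> / (a' - c' * x) = c' * ((d' * x - b') / (a' - c' * x)) + d'"
          using y by (simp only: add_divide_distrib nonzero_mult_div_cancel_right times_divide_eq_right not_False_eq_True)
        finally show ?thesis by simp
      qed
      moreover have "(a' - c' * x) ^ d = (a' - c' * x) ^ (d - e) * (a' - c' * x) ^ e"
        using e(1) by (simp only: power_add [symmetric] le_add_diff_inverse2)
      moreover have "moebius_act (inv\<^bsub>SL2Z\<^esub> \<delta>) x = (d' * x - b') / (a' - c' * x)"
        using \<delta> by (simp add: moebius_act_def acd b'_def)
      ultimately show "(of_int ((inv\<^bsub>SL2Z\<^esub> \<delta>) $ 2 $ 1) * x + of_int ((inv\<^bsub>SL2Z\<^esub> \<delta>) $ 2 $ 2)) ^ d *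
          poly ([:d', c':] ^ e) (moebius_act (inv\<^bsub>SL2Z\<^esub> \<delta>) x) = poly ([:a', - c':] ^ (d - e)) x"
        using y \<delta>(1) by (simp add: add.commute mult.commute power_one_over flip: acd)
    qed
    have "norm (\<psi> \<delta> ([:a', - c':] ^ (d - e))) \<le> (2 * c) ^ (d - e) * (\<Sum>i\<le>d. norm (\<psi> \<delta> (monom 1 i)))"
    proof (rule norm_dual_le[OF dual_cocycle_in[OF \<delta>(1)]])
      show "degree ([:a', - c':] ^ (d - e)) \<le> d" using degree_linear_power_le[of a' "- c'" "d - e"] by simp
      show "norm (coeff ([:a', - c':] ^ (d - e)) i) \<le> (2 * c) ^ (d - e)" for i
        by (rule norm_coeff_linear_power_le) (use a nc in \<open>simp_all add: acd\<close>)
    qed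
    also have "\<dots> \<le> (2 * c) ^ (d - e) * (real (Suc d) * C * c ^ Suc d)"
    proof (rule mult_left_mono)
      have "(\<Sum>i\<le>d. norm (\<psi> \<delta> (monom 1 i))) \<le> (\<Sum>i\<le>d. C * c * c ^ d)"
        using growth[OF \<delta>(1) a] \<delta>(2) by (intro sum_mono) (simp add: c_def)
      then show "(\<Sum>i\<le>d. norm (\<psi> \<delta> (monom 1 i))) \<le> real (Suc d) * C * c ^ Suc d"
        by (simp add: mult_ac)
    qed (use c in simp)
    finally have n1: "norm (\<psi> \<delta> ([:a', - c':] ^ (d - e))) \<le> 2 ^ (j - r) * (real (Suc d) * C) * (c ^ (j - r) * c ^ Suc d)"
      by (simp add: e power_mult_distrib mult_ac)

    have ratio: "[:row_ratio \<gamma>, 1:] ^ e = smult (1 / c' ^ e) ([:d', c':] ^ e)"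
    proof -
      have "[:row_ratio \<gamma>, 1:] = [:1 / c' * d', 1 / c' * c':]" using nc(3) \<delta> by (simp add: row_ratio_def acd)
      then show ?thesis by (simp only: linear_power_smult power_one_over)
    qed
    have "\<psi> (inv\<^bsub>SL2Z\<^esub> \<gamma>) ([:row_ratio \<gamma>, 1:] ^ e) = 1 / c' ^ e * \<psi> (inv\<^bsub>SL2Z\<^esub> \<gamma>) ([:d', c':] ^ e)"
      unfolding ratio
      by (rule dual_spaceD(2)[OF dual_cocycle_in[OF SL2Z_closed(2)[OF \<gamma>(1)]]
            order_trans[OF degree_linear_power_le e(1)]])
    also have "\<psi> (inv\<^bsub>SL2Z\<^esub> \<gamma>) ([:d', c':] ^ e) = \<psi> (inv\<^bsub>SL2Z\<^esub> \<delta>) ([:d', c':] ^ e)"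
      using \<gamma> by (simp add: \<delta>_def dual_cocycle_inv_Gamma_inf_mult)
    also have "\<dots> = - \<psi> \<delta> ([:a', - c':] ^ (d - e))"
      using dual_cocycle_inv[OF \<delta>(1) order_trans[OF degree_linear_power_le e(1)], of d' c'] unfolding flip .
    finally have n2: "norm (\<psi> (inv\<^bsub>SL2Z\<^esub> \<gamma>) ([:row_ratio \<gamma>, 1:] ^ e)) = norm (\<psi> \<delta> ([:a', - c':] ^ (d - e))) / c ^ e"
      by (simp add: norm_mult norm_divide norm_power nc)

    have b: "real (j choose r) \<le> 2 ^ d" by (rule binomial_le_two_power[OF assms(1)])
    have b': "(2::real) ^ (j - r) \<le> 2 ^ d" using assms(1) by simp
    have "norm (dual_coeff k j r \<gamma>) =
        real (j choose r) * (norm (\<psi> \<delta> ([:a', - c':] ^ (d - e))) / c ^ e) / c ^ (k + 2 * j - d)"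
      by (simp add: dual_coeff_def norm_mult norm_divide norm_power c_def n2 flip: e_def)
    also have "\<dots> \<le> 2 ^ d * ((2 ^ d * (real (Suc d) * C)) * (c ^ (j - r) * c ^ Suc d) / c ^ e) / c ^ (k + 2 * j - d)"
      using n1 b b' C c
      by (intro divide_right_mono mult_mono order_trans[OF n1]) (auto intro!: mult_right_mono)
    also have "\<dots> = B * (c ^ (j - r) * c ^ Suc d) / (c ^ e * c ^ (k + 2 * j - d))"
      by (simp add: B_def)
    also have "\<dots> \<le> B / c ^ 4"
    proof -
      \<comment> \<open>Comparing exponents, the claim is d + 5 \<le> k + 2 r, so r = 0 is the tight
        case.\<close>
      have "c ^ (j - r) * c ^ Suc d * c ^ 4 \<le> c ^ e * c ^ (k + 2 * j - d)"
        unfolding power_add [symmetric] using c assms r by (intro power_increasing) (auto simp: e_def)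
      moreover have "B \<ge> 0" using C by (simp add: B_def)
      ultimately have "B * (c ^ (j - r) * c ^ Suc d * c ^ 4) \<le> B * (c ^ e * c ^ (k + 2 * j - d))"
        by (intro mult_left_mono)
      moreover have "0 < c ^ e * c ^ (k + 2 * j - d)" "0 < c ^ 4" using c by auto
      ultimately show ?thesis by (simp only: pos_divide_le_eq pos_le_divide_eq times_divide_eq_left mult.assoc)
    qed
    finally show ?thesis by (simp add: c_def)
  qed
  then show ?thesis using that by blast
qed

text \<open>The sign (-1)^(j-r) of the binomial expansion and (-1)^(k+r) from the Lipschitz formula
  multiply to (-1)^(j+k), independent of r, which can be pulled out as (-1)^(j-k).\<close>

lemma Fourier_term_dual:
  assumes "k \<ge> 5 + d" "j \<le> d"
  shows "Fourier_term {0..j} (dual_coeff k j) (\<lambda>r. k + r) n \<gamma> = fc_dual_term d k j \<psi> n \<gamma>"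
proof -
  define x c where "x = row_ratio \<gamma>" "c = complex_of_int (\<gamma> $ 2 $ 1)"
  note xc = this
  let ?L = "\<lambda>r. \<psi> (inv\<^bsub>SL2Z\<^esub> \<gamma>) ([:x, 1:] ^ (d - j + r))"
  have pi: "(- 1) ^ (j - r) * (- 2 * of_real pi * \<i>) ^ (k + r) =
      (- 1) powi (int j - int k) * (2 * of_real pi * \<i>) ^ (k + r)" if "r \<in> {0..j}" for r
  proof -
    have "(- 2 * of_real pi * \<i>) ^ (k + r) = (- 1) ^ (k + r) * (2 * of_real pi * \<i>) ^ (k + r)"
      using power_minus[of "2 * of_real pi * \<i>" "k + r"] by simp
    moreover have "(- 1) ^ (j - r) * (- 1) ^ (k + r) = ((- 1) powi (int j - int k) :: complex)"
    proof -
      have "(- 1) ^ (j - r) * (- 1) ^ (k + r) = ((- 1) ^ (j + k) :: complex)"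
        using that by (simp flip: power_add)
      also have "\<dots> = (- 1) powi (int j - int k)"
        by (simp add: power_int_diff power_add) (cases "even k"; simp)
      finally show ?thesis .
    qed
    ultimately show ?thesis by (simp flip: mult.assoc)
  qed
  have "Fourier_term {0..j} (dual_coeff k j) (\<lambda>r. k + r) n \<gamma> =
      ee (of_nat n * x) / c ^ (k + 2 * j - d) * (\<Sum>r=0..j. ((- 1) ^ (j - r) * (- 2 * of_real pi * \<i>) ^ (k + r)) *
        (of_nat (j choose r) / fact (k + r - 1) * ?L r * of_nat n ^ (k + r - 1)))"
    unfolding Fourier_term_def dual_coeff_def xc [symmetric] sum_distrib_left
    by (intro sum.cong refl) (simp add: divide_inverse mult_ac)
  also have "\<dots> = ee (of_nat n * x) / c ^ (k + 2 * j - d) * (\<Sum>r=0..j. ((- 1) powi (int j - int k) * (2 * of_real pi * \<i>) ^ (k + r)) *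
        (of_nat (j choose r) / fact (k + r - 1) * ?L r * of_nat n ^ (k + r - 1)))"
    by (rule arg_cong[of _ _ "(*) _"], rule sum.cong[OF refl]) (simp only: pi)
  also have "\<dots> = fc_dual_term d k j \<psi> n \<gamma>"
    unfolding fc_dual_term_def Let_def row_ratio_def [symmetric] sum_distrib_left
    unfolding xc [symmetric]
    by (intro sum.cong refl) (simp add: divide_inverse mult_ac)
  finally show ?thesis .
qed

theorem eis_dual_Fourier_expansion:
  assumes k: "even d" "even k" "k \<ge> 5 + d" and j: "j \<le> d" and \<tau>: "Im \<tau> > 0"
    and u: "\<And>C. C \<in> rcosets\<^bsub>SL2Z\<^esub> Gamma_inf \<Longrightarrow> u C \<in> C"
    and v: "\<And>D. D \<in> nontrivial_double_cosets \<Longrightarrow> v D \<in> D"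
  shows "(\<lambda>C. eis_dual_term d k j \<psi> \<tau> (u C)) summable_on rcosets\<^bsub>SL2Z\<^esub> Gamma_inf"
    and "n \<ge> 1 \<Longrightarrow> (\<lambda>D. fc_dual_term d k j \<psi> n (v D)) summable_on nontrivial_double_cosets"
    and "(\<lambda>n. fc_dual v d k j \<psi> n * ee (of_nat n * \<tau>)) summable_on {1..}"
    and "eis_dual u d k j \<psi> \<tau> = (\<Sum>\<^sub>\<infinity>n\<in>{1..}. fc_dual v d k j \<psi> n * ee (of_nat n * \<tau>))"
proof -
  obtain B where B: "\<And>r \<gamma>. r \<in> {0..j} \<Longrightarrow> \<gamma> \<in> carrier SL2Z \<Longrightarrow> \<gamma> $ 2 $ 1 \<noteq> 0 \<Longrightarrow>
    norm (dual_coeff k j r \<gamma>) \<le> B / \<bar>real_of_int (\<gamma> $ 2 $ 1)\<bar> ^ 4"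
    using dual_coeff_bound[OF j k(3)] by blast
  have zero: "eis_dual_term d k j \<psi> \<tau> \<gamma> = 0" if "\<gamma> \<in> Gamma_inf" for \<gamma>
    using that by (simp add: eis_dual_term_def parabolic_cocycle_Gamma_inf[OF \<psi>] inv_Gamma_inf)
  have K: "2 \<le> k + r" for r using k by simp
  have kd: "k \<ge> d" using k by simp
  note main = rcoset_sum_Fourier_expansion[where f = "eis_dual_term d k j \<psi> \<tau>" and R = "{0..j}"
      and A = "dual_coeff k j" and K = "\<lambda>r. k + r" and B = B and u = u and v = v and \<tau> = \<tau>,
      OF \<tau> finite_atLeastAtMost K u v eis_dual_term_left[OF k(1,2) j \<tau>] zero
      eis_dual_term_right[OF j kd \<tau>] B, unfolded Fourier_term_dual[OF k(3) j]]
  show "(\<lambda>C. eis_dual_term d k j \<psi> \<tau> (u C)) summable_on rcosets\<^bsub>SL2Z\<^esub> Gamma_inf"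
    by (rule main(1))
  show "n \<ge> 1 \<Longrightarrow> (\<lambda>D. fc_dual_term d k j \<psi> n (v D)) summable_on nontrivial_double_cosets"
    by (rule main(2))
  show "(\<lambda>n. fc_dual v d k j \<psi> n * ee (of_nat n * \<tau>)) summable_on {1..}"
    unfolding fc_dual_def by (rule main(3))
  show "eis_dual u d k j \<psi> \<tau> = (\<Sum>\<^sub>\<infinity>n\<in>{1..}. fc_dual v d k j \<psi> n * ee (of_nat n * \<tau>))"
    unfolding fc_dual_def eis_dual_def by (rule main(4))
qed

end

text \<open>\<open>infsum\<close> is 0 on a family that is not summable, so the identities are
  accompanied by summability of the sums occurring in them.\<close>

theorem theoremA:
  fixes d k j :: nat
    and \<phi> :: "int^2^2 \<Rightarrow> complex poly"
    and \<psi> :: "int^2^2 \<Rightarrow> complex poly \<Rightarrow> complex"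
    and u v :: "(int^2^2) set \<Rightarrow> int^2^2"
    and \<tau> :: complex
  assumes "even d" and "even k" and "k \<ge> 5 + d" and "j \<le> d"
    and "\<phi> \<in> parabolic_cocycles (sym_space d) (sym_rep d)"
    and "\<psi> \<in> parabolic_cocycles (dual_space (sym_space d)) (dual_rep (sym_space d) (sym_rep d))"
    and "\<forall>C\<in>rcosets\<^bsub>SL2Z\<^esub> Gamma_inf. u C \<in> C"
    and "\<forall>D\<in>nontrivial_double_cosets. v D \<in> D"
    and "Im \<tau> > 0"
  shows
    "((\<forall>i\<le>d. (\<lambda>C. coeff (eis_term k \<phi> \<tau> (u C)) i) summable_on rcosets\<^bsub>SL2Z\<^esub> Gamma_inf) \<and>
      (\<forall>r\<le>d. \<forall>n\<ge>1. (\<lambda>D. fc_term d k \<phi> n r (v D)) summable_on nontrivial_double_cosets) \<and>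
      (\<forall>r\<le>d. (\<lambda>n. fc v d k \<phi> n r * ee (of_nat n * \<tau>)) summable_on {1..}) \<and>
      eis u d k \<phi> \<tau> =
        (\<Sum>r=0..d. [:- \<tau>, 1:] ^ r * [:\<Sum>\<^sub>\<infinity>n\<in>{1..}. fc v d k \<phi> n r * ee (of_nat n * \<tau>):])) \<and>
     ((\<lambda>C. eis_dual_term d k j \<psi> \<tau> (u C)) summable_on rcosets\<^bsub>SL2Z\<^esub> Gamma_inf \<and>
      (\<forall>n\<ge>1. (\<lambda>D. fc_dual_term d k j \<psi> n (v D)) summable_on nontrivial_double_cosets) \<and>
      (\<lambda>n. fc_dual v d k j \<psi> n * ee (of_nat n * \<tau>)) summable_on {1..} \<and>
      eis_dual u d k j \<psi> \<tau> =
        (\<Sum>\<^sub>\<infinity>n\<in>{1..}. fc_dual v d k j \<psi> n * ee (of_nat n * \<tau>)))"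
proof -
  have u: "\<And>C. C \<in> rcosets\<^bsub>SL2Z\<^esub> Gamma_inf \<Longrightarrow> u C \<in> C"
    and v: "\<And>D. D \<in> nontrivial_double_cosets \<Longrightarrow> v D \<in> D"
    using assms(7,8) by auto
  note expansions = eis_Fourier_expansion[OF assms(5) assms(2,3,9) u v]
    eis_dual_Fourier_expansion[OF assms(6) assms(1-4,9) u v]
  show ?thesis by (intro conjI allI impI expansions)
qed

end
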